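(* Let $2<p<6$, $2<q<4$ and $q>\frac p2+1$. Then there exist a non-compact metric graph $\mathcal{G}$, with exactly $2$ half-lines and no vertex of degree $2$, not isometric to the real line or to a tower of bubbles, and such that every point of $\mathcal{G}$ lies on a trail that contains two half-lines, and a value $m>0$, such that ground states of $F_{p,q}$ at mass $m$ on $\mathcal{G}$ do not exist.
   Context: A metric graph $\mathcal{G}=(V,E)$ is connected, has finite vertex set $V$ and finite edge set $E$ (loops and multiple edges allowed); each bounded edge is identified with a compact interval of positive length, each unbounded edge (half-line) with $[0,+\infty)$, whose origin is a vertex (points at infinity are not vertices). $\mathcal{G}$ is non-compact if it has at least one half-line. The degree of a vertex is the number of edge-ends at it (a loop counts twice). A trail is a connected path in $\mathcal{G}$ in which every edge of the path is run through exactly once. A tower of bubbles is a graph obtained from $\mathbb{R}$ by identifying, for finitely many (at least one) values $0<a_1<\dots<a_k$, the point $-a_j$ with the point $a_j$ for each $j$. $H^1(\mathcal{G})$ is the space of continuous functions on $\mathcal{G}$ with $\int_{\mathcal G}(|u'|^2+|u|^2)\,dx<\infty$ (weak derivative on each edge), and $H^1_\mu(\mathcal{G})=\{u\in H^1(\mathcal{G}):\|u\|_{L^2(\mathcal{G})}^2=\mu\}$ for $\mu>0$. $F_{p,q}(u,\mathcal{G})=\frac12\int_{\mathcal{G}}|u'|^2dx-\frac1p\int_{\mathcal{G}}|u|^pdx-\frac1q\sum_{v\in V}|u(v)|^q$. A ground state of $F_{p,q}$ at mass $\mu$ on $\mathcal{G}$ is a function $u\in H^1_\mu(\mathcal{G})$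 with $F_{p,q}(u,\mathcal{G})=\inf_{w\in H^1_\mu(\mathcal{G})}F_{p,q}(w,\mathcal{G})$. *)

theory Defs
  imports "HOL-Analysis.Analysis"
begin

section \<open>Metric graphs\<close>

text \<open>
  Edge \<open>e\<close> is a copy of \<open>[0, len e]\<close>, with \<open>0\<close> placed at \<open>src e\<close> and, if \<open>len e < \<infinity>\<close>, \<open>len e\<close>
  placed at \<open>tgt e\<close>. An edge of infinite length is a half-line; its \<open>tgt\<close> is meaningless and is
  never used. The choice of which end is called \<open>src\<close> is only a parametrisation.
\<close>

record ('v, 'e) mgraph =
  verts :: "'v set"
  edges :: "'e set"
  src :: "'e \<Rightarrow> 'v"
  tgt :: "'e \<Rightarrow> 'v"
  len :: "'e \<Rightarrow> ereal"

definition half_lines :: "('v, 'e) mgraph \<Rightarrow> 'e set" where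
  "half_lines G = {e \<in> edges G. len G e = \<infinity>}"

definition bounded_edges :: "('v, 'e) mgraph \<Rightarrow> 'e set" where
  "bounded_edges G = {e \<in> edges G. len G e < \<infinity>}"

definition adjacency :: "('v, 'e) mgraph \<Rightarrow> 'v rel" where
  "adjacency G = {(v, w). \<exists>e \<in> bounded_edges G.
     (v = src G e \<and> w = tgt G e) \<or> (v = tgt G e \<and> w = src G e)}"

definition metric_graph :: "('v, 'e) mgraph \<Rightarrow> bool" where
  "metric_graph G \<longleftrightarrow>
     finite (verts G) \<and> verts G \<noteq> {} \<and> finite (edges G) \<and>
     (\<forall>e \<in> edges G. 0 < len G e \<and> src G e \<in> verts G) \<and>
     (\<forall>e \<in> bounded_edges G. tgt G e \<in> verts G) \<and>
     (\<forall>v \<in> verts G. \<forall>w \<in> verts G. (v, w) \<in> (adjacency G)\<^sup>*)"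

definition noncompact :: "('v, 'e) mgraph \<Rightarrow> bool" where
  "noncompact G \<longleftrightarrow> half_lines G \<noteq> {}"

definition vdegree :: "('v, 'e) mgraph \<Rightarrow> 'v \<Rightarrow> nat" where
  "vdegree G v = card {e \<in> edges G. src G e = v} + card {e \<in> bounded_edges G. tgt G e = v}"


subsection \<open>The points of a metric graph\<close>

datatype ('v, 'e) gpoint = Vertex 'v | Inner 'e real

definition points :: "('v, 'e) mgraph \<Rightarrow> ('v, 'e) gpoint set" where
  "points G = Vertex ` verts G \<union> {Inner e x | e x. e \<in> edges G \<and> x \<in> einterval 0 (len G e)}"

definition closed_edge :: "('v, 'e) mgraph \<Rightarrow> 'e \<Rightarrow> real set" where
  "closed_edge G e = {x. 0 \<le> x \<and> ereal x \<le> len G e}"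

text \<open>The gluing map from the disjoint union of the closed edges to the graph.\<close>

definition pt :: "('v, 'e) mgraph \<Rightarrow> 'e \<Rightarrow> real \<Rightarrow> ('v, 'e) gpoint" where
  "pt G e x = (if x = 0 then Vertex (src G e)
               else if ereal x = len G e then Vertex (tgt G e)
               else Inner e x)"


subsection \<open>Distances obtained by gluing\<close>

text \<open>
  \<open>step P Q c\<close> says that one can go from \<open>P\<close> to \<open>Q\<close> at cost \<open>c\<close> within a single piece before gluing;
  the distance after gluing is the infimum of the costs of finite chains of such steps.
\<close>

inductive chain :: "('a \<Rightarrow> 'a \<Rightarrow> real \<Rightarrow> bool) \<Rightarrow> 'a \<Rightarrow> 'a \<Rightarrow> real \<Rightarrow> bool"
  for step :: "'a \<Rightarrow> 'a \<Rightarrow> real \<Rightarrow> bool" where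
  chain_refl: "chain step P P 0"
| chain_step: "chain step P Q l \<Longrightarrow> step Q R c \<Longrightarrow> chain step P R (l + c)"

definition chain_dist :: "('a \<Rightarrow> 'a \<Rightarrow> real \<Rightarrow> bool) \<Rightarrow> 'a \<Rightarrow> 'a \<Rightarrow> real" where
  "chain_dist step P Q = Inf {l. chain step P Q l}"

definition edge_step ::
  "('v, 'e) mgraph \<Rightarrow> ('v, 'e) gpoint \<Rightarrow> ('v, 'e) gpoint \<Rightarrow> real \<Rightarrow> bool" where
  "edge_step G P Q c \<longleftrightarrow>
     (\<exists>e \<in> edges G. \<exists>x \<in> closed_edge G e. \<exists>y \<in> closed_edge G e.
        P = pt G e x \<and> Q = pt G e y \<and> c = dist x y)"

definition gdist :: "('v, 'e) mgraph \<Rightarrow> ('v, 'e) gpoint \<Rightarrow> ('v, 'e) gpoint \<Rightarrow> real" where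
  "gdist G = chain_dist (edge_step G)"

definition isometric ::
  "'a set \<Rightarrow> ('a \<Rightarrow> 'a \<Rightarrow> real) \<Rightarrow> 'b set \<Rightarrow> ('b \<Rightarrow> 'b \<Rightarrow> real) \<Rightarrow> bool" where
  "isometric M d N d' \<longleftrightarrow>
     (\<exists>f. bij_betw f M N \<and> (\<forall>x \<in> M. \<forall>y \<in> M. d' (f x) (f y) = d x y))"


subsection \<open>Towers of bubbles\<close>

text \<open>
  The quotient of the real line that glues \<open>-a\<close> to \<open>a\<close> for every \<open>a \<in> A\<close>, with the quotient metric;
  it is a tower of bubbles when \<open>A = {a\<^sub>1 < \<dots> < a\<^sub>k}\<close> is a finite nonempty set of positive reals.
\<close>

definition tower_rel :: "real set \<Rightarrow> real rel" where
  "tower_rel A = {(x, y). x = y \<or> (y = - x \<and> \<bar>x\<bar> \<in> A)}"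

definition tower_points :: "real set \<Rightarrow> real set set" where
  "tower_points A = UNIV // tower_rel A"

definition tower_step :: "real set \<Rightarrow> real set \<Rightarrow> real set \<Rightarrow> real \<Rightarrow> bool" where
  "tower_step A X Y c \<longleftrightarrow>
     X \<in> tower_points A \<and> Y \<in> tower_points A \<and> (\<exists>x \<in> X. \<exists>y \<in> Y. c = dist x y)"

definition tower_dist :: "real set \<Rightarrow> real set \<Rightarrow> real set \<Rightarrow> real" where
  "tower_dist A = chain_dist (tower_step A)"

definition isometric_to_tower :: "('v, 'e) mgraph \<Rightarrow> bool" where
  "isometric_to_tower G \<longleftrightarrow>
     (\<exists>A. finite A \<and> A \<noteq> {} \<and> A \<subseteq> {0<..} \<and>
          isometric (points G) (gdist G) (tower_points A) (tower_dist A))"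


subsection \<open>Trails\<close>

text \<open>
  \<open>(e, True)\<close> is the edge \<open>e\<close> run through from \<open>src e\<close>, \<open>(e, False)\<close> the reverse. The value \<open>None\<close>
  is the end of a half-line at infinity, which is not a vertex, so that a trail cannot be
  continued there.
\<close>

definition run_start :: "('v, 'e) mgraph \<Rightarrow> 'e \<times> bool \<Rightarrow> 'v option" where
  "run_start G s = (if snd s then Some (src G (fst s))
                    else if len G (fst s) = \<infinity> then None
                    else Some (tgt G (fst s)))"

definition run_end :: "('v, 'e) mgraph \<Rightarrow> 'e \<times> bool \<Rightarrow> 'v option" where
  "run_end G s = run_start G (fst s, \<not> snd s)"

definition trail :: "('v, 'e) mgraph \<Rightarrow> ('e \<times> bool) list \<Rightarrow> bool" where
  "trail G t \<longleftrightarrow>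
     fst ` set t \<subseteq> edges G \<and> distinct (map fst t) \<and>
     successively (\<lambda>s s'. run_end G s \<noteq> None \<and> run_end G s = run_start G s') t"

definition lies_on :: "('v, 'e) mgraph \<Rightarrow> ('v, 'e) gpoint \<Rightarrow> ('e \<times> bool) list \<Rightarrow> bool" where
  "lies_on G P t \<longleftrightarrow> (\<exists>e \<in> fst ` set t. \<exists>x \<in> closed_edge G e. P = pt G e x)"

definition contains_two_half_lines :: "('v, 'e) mgraph \<Rightarrow> ('e \<times> bool) list \<Rightarrow> bool" where
  "contains_two_half_lines G t \<longleftrightarrow>
     (\<exists>h \<in> half_lines G. \<exists>h' \<in> half_lines G. h \<noteq> h' \<and> {h, h'} \<subseteq> fst ` set t)"


section \<open>The space \<open>H\<^sup>1\<close> and the energy\<close>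

definition locally_integrable :: "real set \<Rightarrow> (real \<Rightarrow> real) \<Rightarrow> bool" where
  "locally_integrable I f \<longleftrightarrow> (\<forall>K. compact K \<and> K \<subseteq> I \<longrightarrow> set_integrable lborel K f)"

text \<open>Test functions are the \<open>C\<^sup>1\<close> functions with compact support in the open interval \<open>I\<close>.\<close>

definition test_function :: "real set \<Rightarrow> (real \<Rightarrow> real) \<Rightarrow> bool" where
  "test_function I \<phi> \<longleftrightarrow>
     \<phi> C1_differentiable_on UNIV \<and>
     (\<exists>K. compact K \<and> K \<subseteq> I \<and> (\<forall>x. x \<notin> K \<longrightarrow> \<phi> x = 0))"

definition has_weak_deriv :: "real set \<Rightarrow> (real \<Rightarrow> real) \<Rightarrow> (real \<Rightarrow> real) \<Rightarrow> bool" where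
  "has_weak_deriv I f g \<longleftrightarrow>
     locally_integrable I f \<and> locally_integrable I g \<and>
     (\<forall>\<phi>. test_function I \<phi> \<longrightarrow>
        (LINT x:I|lborel. f x * deriv \<phi> x) = - (LINT x:I|lborel. g x * \<phi> x))"

text \<open>A representative; the weak derivative is unique up to a null set.\<close>

definition weak_deriv :: "real set \<Rightarrow> (real \<Rightarrow> real) \<Rightarrow> real \<Rightarrow> real" where
  "weak_deriv I f = (SOME g. has_weak_deriv I f g)"

abbreviation open_edge :: "('v, 'e) mgraph \<Rightarrow> 'e \<Rightarrow> real set" where
  "open_edge G e \<equiv> einterval 0 (len G e)"

text \<open>
  The graph carries the quotient topology of the disjoint union of its closed edges, so a function
  on it is continuous iff its pullback to every closed edge is.
\<close>

definition continuous_on_graph :: "('v, 'e) mgraph \<Rightarrow> (('v, 'e) gpoint \<Rightarrow> real) \<Rightarrow> bool" where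
  "continuous_on_graph G u \<longleftrightarrow>
     (\<forall>e \<in> edges G. continuous_on (closed_edge G e) (\<lambda>x. u (pt G e x)))"

definition H1 :: "('v, 'e) mgraph \<Rightarrow> (('v, 'e) gpoint \<Rightarrow> real) set" where
  "H1 G = {u. continuous_on_graph G u \<and>
     (\<forall>e \<in> edges G.
        set_integrable lborel (open_edge G e) (\<lambda>x. \<bar>u (pt G e x)\<bar>\<^sup>2) \<and>
        (\<exists>g. has_weak_deriv (open_edge G e) (\<lambda>x. u (pt G e x)) g \<and>
             set_integrable lborel (open_edge G e) (\<lambda>x. \<bar>g x\<bar>\<^sup>2)))}"

definition graph_integral :: "('v, 'e) mgraph \<Rightarrow> ('e \<Rightarrow> real \<Rightarrow> real) \<Rightarrow> real" where
  "graph_integral G f = (\<Sum>e \<in> edges G. LINT x:open_edge G e|lborel. f e x)"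

definition H1_mass :: "('v, 'e) mgraph \<Rightarrow> real \<Rightarrow> (('v, 'e) gpoint \<Rightarrow> real) set" where
  "H1_mass G \<mu> = {u \<in> H1 G. graph_integral G (\<lambda>e x. \<bar>u (pt G e x)\<bar>\<^sup>2) = \<mu>}"

definition energy :: "real \<Rightarrow> real \<Rightarrow> ('v, 'e) mgraph \<Rightarrow> (('v, 'e) gpoint \<Rightarrow> real) \<Rightarrow> real" where
  "energy p q G u =
     1 / 2 * graph_integral G (\<lambda>e x. \<bar>weak_deriv (open_edge G e) (\<lambda>y. u (pt G e y)) x\<bar>\<^sup>2)
     - 1 / p * graph_integral G (\<lambda>e x. \<bar>u (pt G e x)\<bar> powr p)
     - 1 / q * (\<Sum>v \<in> verts G. \<bar>u (Vertex v)\<bar> powr q)"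

text \<open>
  The infimum is taken in the extended reals, since \<open>Inf\<close> of a set of reals that is unbounded
  below is an unspecified real number.
\<close>

definition ground_state ::
  "real \<Rightarrow> real \<Rightarrow> ('v, 'e) mgraph \<Rightarrow> real \<Rightarrow> (('v, 'e) gpoint \<Rightarrow> real) \<Rightarrow> bool" where
  "ground_state p q G \<mu> u \<longleftrightarrow>
     u \<in> H1_mass G \<mu> \<and> ereal (energy p q G u) = (INF w \<in> H1_mass G \<mu>. ereal (energy p q G w))"

end

theory Submission
  imports Defs
begin

text \<open>
  The graph is a rose: one vertex, two half-lines and many long loops. The prescribed mass is that of the soliton of
  height 1 on the line, so the infimum of the energy on the graph is at most the energy of that
  soliton, as one sees by pushing truncated solitons to infinity along a half-line.

  Let \<open>u\<close> have this mass, with maximum \<open>s\<close> of \<open>\<bar>u\<bar>\<close> and value \<open>\<tau>\<close> at the vertex. Adding the multiple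
  \<open>s powr (p - 2) / p\<close> of the mass to the energy makes the potential nonnegative on \<open>[-s, s]\<close>, and
  then \<open>u'\<^sup>2 / 2 + pot \<ge> \<bar>(\<Psi> \<circ> u)'\<bar>\<close> for a suitable \<open>\<Psi>\<close>. The two half-lines and the edge carrying the
  maximum cover every value in \<open>(0, s)\<close> twice, which already costs at least the energy of the soliton, whatever
  \<open>s\<close> is. Each remaining loop costs an extra multiple of \<open>\<tau>\<^sup>2\<close>, because the mass is too small for
  \<open>\<bar>u\<bar>\<close> to stay close to \<open>s\<close> along a long loop. With enough loops this beats the vertex
  term \<open>\<bar>\<tau>\<bar> powr q / q\<close> for \<open>s\<close> in a compact range; very small and very large \<open>s\<close> are excluded
  directly, the latter because \<open>q < 4\<close>. If \<open>\<tau> = 0\<close>, the inequality is strict since equality would force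
  \<open>\<bar>u'\<bar> \<le> C \<bar>u\<bar>\<close>, which is impossible for a function that vanishes at the vertex. So no function
  attains the infimum.
\<close>


section \<open>Functions with a weak derivative are primitives\<close>

text \<open>The obstacle is the vertex term: it is negative, so a function sitting at the vertex
  might undercut the soliton. As \<open>q > 2\<close>, it is at most a constant times \<tau>^2 once
  the height \<open>s\<close> is bounded, and an extra loop costs an amount of exactly this order;
  hence a graph with many loops. The constants must not chase each other: the heights
  \<open>s1\<close> and \<open>S\<close> depend on \<open>p\<close>, \<open>q\<close> and the mass
  only, the length \<open>l\<close> on \<open>s1\<close> and the mass, the cost \<open>c\<close> per
  loop on \<open>p\<close>, \<open>l\<close> and \<open>s1\<close>, and the number of loops is
  chosen last.

  The height of \<open>u\<close> is not prescribed, so the potential is adapted to it: with the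
  multiplier \<open>s powr (p - 2) / p\<close> it vanishes at 0 and at the height itself, and
  scaling reduces all heights to height 1. The resulting lower bound, a function of \<open>s\<close>
  alone, is minimal at \<open>s = 1\<close>, where it equals the energy of the soliton.

  Five loops already exclude the line and the towers of bubbles, because the midpoints of the loops
  are pairwise equidistant.\<close>

text \<open>A \<open>C\<^sup>1\<close> step from 0 to 1: test functions have to be continuously differentiable, so an indicator
  function is approximated by a quadratic spline, whose derivative is a tent.\<close>

definition ramp :: "real \<Rightarrow> real" where
  "ramp r = ((max 0 r)\<^sup>2 - 2 * (max 0 (r - 1))\<^sup>2 + (max 0 (r - 2))\<^sup>2) / 2"

definition tent :: "real \<Rightarrow> real" where
  "tent r = max 0 r - 2 * max 0 (r - 1) + max 0 (r - 2)"

lemma has_real_derivative_max0_square: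
  "((\<lambda>r. (max 0 r)\<^sup>2) has_real_derivative 2 * max 0 r) (at (r::real))"
proof -
  consider "r < 0" | "r = 0" | "r > 0" by linarith
  then show ?thesis
  proof cases
    case 1
    have "((\<lambda>r::real. 0) has_real_derivative 0) (at r)" by simp
    then have "((\<lambda>r. (max 0 r)\<^sup>2) has_real_derivative 0) (at r)"
      by (rule DERIV_cong_ev[THEN iffD1, OF refl _ refl, rotated])
         (use 1 in \<open>auto intro!: eventually_nhds_in_open[of "{..<0}", THEN eventually_mono]\<close>)
    then show ?thesis using 1 by simp
  next
    case 2
    have "((\<lambda>h::real. (max 0 h)\<^sup>2 / h) \<longlongrightarrow> 0) (at 0)"
    proof (rule Lim_null_comparison)
      show "\<forall>\<^sub>F h::real in at 0. norm ((max 0 h)\<^sup>2 / h) \<le> \<bar>h\<bar>"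
        by (auto simp: max_def power2_eq_square)
      show "((\<lambda>h::real. \<bar>h\<bar>) \<longlongrightarrow> 0) (at 0)"
        by (rule tendsto_rabs_zero) simp
    qed
    then show ?thesis using 2 by (simp add: DERIV_def)
  next
    case 3
    have "((\<lambda>r::real. r\<^sup>2) has_real_derivative 2 * r) (at r)"
      by (auto intro!: derivative_eq_intros)
    then have "((\<lambda>r. (max 0 r)\<^sup>2) has_real_derivative 2 * r) (at r)"
      by (rule DERIV_cong_ev[THEN iffD1, OF refl _ refl, rotated])
         (use 3 in \<open>auto intro!: eventually_nhds_in_open[of "{0<..}", THEN eventually_mono]\<close>)
    then show ?thesis using 3 by simp
  qed
qed

lemma has_real_derivative_ramp [derivative_intros]:
  assumes "(f has_real_derivative D) (at x)"
  shows "((\<lambda>x. ramp (f x)) has_real_derivative tent (f x) * D) (at x)"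
proof -
  have 1: "((\<lambda>r. (max 0 (r - c))\<^sup>2) has_real_derivative 2 * max 0 (r - c)) (at r)" for r c :: real
    using DERIV_shift[of "\<lambda>r. (max 0 r)\<^sup>2" "2 * max 0 (r - c)" r "-c"]
      has_real_derivative_max0_square[of "r - c"] by simp
  have "(ramp has_real_derivative tent r) (at r)" for r
    unfolding ramp_def[abs_def] tent_def
    by (rule derivative_eq_intros 1 1[where c = 0, simplified] refl | simp)+
  from DERIV_chain2[OF this assms] show ?thesis .
qed

lemma tent_eq_0: "r \<le> 0 \<Longrightarrow> tent r = 0" "2 \<le> r \<Longrightarrow> tent r = 0"
  by (auto simp: tent_def)

lemma tent_nonneg: "0 \<le> tent r"
  by (auto simp: tent_def max_def)

lemma continuous_on_tent [continuous_intros]: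
  "continuous_on S f \<Longrightarrow> continuous_on S (\<lambda>x. tent (f x))"
  unfolding tent_def by (intro continuous_intros)

lemma ramp_eq_0: "r \<le> 0 \<Longrightarrow> ramp r = 0"
  by (auto simp: ramp_def)

lemma ramp_eq_1: "2 \<le> r \<Longrightarrow> ramp r = 1"
  by (auto simp: ramp_def power2_eq_square algebra_simps)

lemma mono_ramp: "mono ramp"
proof (rule monoI)
  fix x y :: real assume "x \<le> y"
  then show "ramp x \<le> ramp y"
    by (rule DERIV_nonneg_imp_nondecreasing)
       (use has_real_derivative_ramp[OF DERIV_ident] tent_nonneg in force)
qed

lemma ramp_bounds: "0 \<le> ramp r" "ramp r \<le> 1"
  using monoD[OF mono_ramp, of "min 0 r" r] monoD[OF mono_ramp, of r "max 2 r"]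
  by (auto simp: ramp_eq_0 ramp_eq_1)

text \<open>The kernels \<open>k * tent (k * (z - x))\<close> live on \<open>[x, x + 2/k]\<close>
  and have integral 1 there: a one-sided approximate identity, which needs \<open>f\<close> only to
  the right of \<open>x\<close>. Taking \<open>k = Suc n\<close> keeps \<open>k\<close>
  positive.\<close>

lemma tent_mean_tendsto:
  assumes "continuous_on {x..x + d} f" "d > 0"
  shows "(\<lambda>n. integral {x..x + d} (\<lambda>z. f z * (real (Suc n) * tent (real (Suc n) * (z - x))))) \<longlonglongrightarrow> f x"
proof (rule LIMSEQ_I)
  fix e :: real assume "e > 0"
  have "continuous (at x within {x..x+d}) f"
    using assms by (auto simp: continuous_on_eq_continuous_within)
  then obtain r where r: "r > 0" "\<And>z. z \<in> {x..x + d} \<Longrightarrow> \<bar>z - x\<bar> < r \<Longrightarrow> \<bar>f z - f x\<bar> < e / 2"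
    using \<open>e > 0\<close> unfolding continuous_within_eps_delta dist_real_def
    by (metis half_gt_zero)
  \<comment> \<open>Beyond \<open>N\<close> the support of the kernel, of length
    \<open>2 / k\<close>, is shorter than both \<open>r\<close> and \<open>d\<close>.\<close>
  obtain N :: nat where N: "real N > 2 / min r d" using reals_Archimedean2 by blast
  show "\<exists>no. \<forall>n\<ge>no. norm (integral {x..x + d} (\<lambda>z. f z * (real (Suc n) * tent (real (Suc n) * (z - x)))) - f x) < e"
  proof (intro exI allI impI)
    fix n assume "n \<ge> N"
    define k where "k = real (Suc n)"
    have k: "k > 2 / min r d" "k > 0" using N \<open>n \<ge> N\<close> by (auto simp: k_def)
    then have kr: "k * r > 2" "k * d > 2"
      using r(1) assms(2) by (auto simp: field_simps min_def split: if_splits)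
       (smt (verit) mult_left_mono mult.commute)+
    let ?B = "\<lambda>z. k * tent (k * (z - x))"
    have der: "((\<lambda>z. ramp (k * (z - x))) has_real_derivative ?B z) (at z)" for z
      by (auto intro!: derivative_eq_intros)
    have "(?B has_integral ramp (k * (x + d - x)) - ramp (k * (x - x))) {x..x + d}"
      using assms(2) has_field_derivative_at_within[OF der]
      by (intro fundamental_theorem_of_calculus)
         (auto simp flip: has_real_derivative_iff_has_vector_derivative)
    then have B: "(?B has_integral 1) {x..x + d}"
      using kr by (simp add: ramp_eq_0 ramp_eq_1)
    have fB: "(\<lambda>z. f z * ?B z) integrable_on {x..x + d}"
      by (intro integrable_continuous_real continuous_intros assms)
    have "norm (integral {x..x + d} (\<lambda>z. f z * ?B z - f x * ?B z)) \<le> integral {x..x + d} (\<lambda>z. e / 2 * ?B z)"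
    proof (rule integral_norm_bound_integral)
      show "(\<lambda>z. f z * ?B z - f x * ?B z) integrable_on {x..x + d}"
        using has_integral_mult_right[OF B, of "f x"] by (intro integrable_diff fB) blast
      show "(\<lambda>z. e / 2 * ?B z) integrable_on {x..x + d}"
        using has_integral_mult_right[OF B, of "e / 2"] by blast
      fix z assume z: "z \<in> {x..x + d}"
      show "norm (f z * ?B z - f x * ?B z) \<le> e / 2 * ?B z"
      proof (cases "\<bar>z - x\<bar> < r")
        case True
        then have "\<bar>f z - f x\<bar> * ?B z \<le> e / 2 * ?B z"
          using r(2)[OF z] tent_nonneg k(2) by (intro mult_right_mono) auto
        then show ?thesis
          using tent_nonneg k(2) by (auto simp: abs_mult simp flip: left_diff_distrib)
      next
        case False
        then have "k * (z - x) \<ge> k * r" using z k(2) by (intro mult_left_mono) auto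
        then have "tent (k * (z - x)) = 0" using kr by (intro tent_eq_0) auto
        then show ?thesis by simp
      qed
    qed
    also have "integral {x..x + d} (\<lambda>z. e / 2 * ?B z) = e / 2"
      using integral_unique[OF has_integral_mult_right[OF B, of "e / 2"]] by (simp only: mult_1_right)
    also have "integral {x..x + d} (\<lambda>z. f z * ?B z - f x * ?B z) = integral {x..x + d} (\<lambda>z. f z * ?B z) - f x"
      using integral_unique[OF has_integral_diff[OF integrable_integral[OF fB] has_integral_mult_right[OF B, of "f x"]]]
      by (simp only: mult_1_right)
    finally show "norm (integral {x..x + d} (\<lambda>z. f z * (real (Suc n) * tent (real (Suc n) * (z - x)))) - f x) < e"
      using \<open>e > 0\<close> by (simp add: k_def)
  qed
qed

lemma set_integral_restrict:
  assumes "K \<subseteq> I" "\<And>x. x \<in> I \<Longrightarrow> x \<notin> K \<Longrightarrow> h x = (0::real)"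
  shows "(LINT x:I|M. h x) = (LINT x:K|M. h x)"
  unfolding set_lebesgue_integral_def using assms
  by (intro Bochner_Integration.integral_cong) (auto simp: indicator_def)

text \<open>The test function is a difference of two ramps, which tends pointwise to the indicator
  of \<open>{x<..y}\<close>. Its derivative is a difference of two approximate identities and
  produces \<open>f x - f y\<close>, while dominated convergence produces the integral of
  \<open>g\<close>.\<close>

lemma weak_deriv_FTC:
  assumes wd: "has_weak_deriv I f g" and "open I" and cont: "continuous_on I f"
    and "x \<le> y" "{x..y} \<subseteq> I"
  shows "(g has_integral (f y - f x)) {x..y}"
proof -
  have "y \<in> I" using assms by auto
  then obtain d0 where d0: "d0 > 0" "ball y d0 \<subseteq> I" using \<open>open I\<close> by (meson openE)
  \<comment> \<open>The ramps rise to the right of \<open>x\<close> and of \<open>y\<close>, so room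
    beyond \<open>y\<close> is needed; half the radius keeps the closed interval \<open>J\<close>
    inside \<open>I\<close>.\<close>
  define d where "d = d0 / 2"
  have d: "d > 0" using d0 by (simp add: d_def)
  define J where "J = {x..y + d}"
  have J: "J \<subseteq> I"
  proof
    fix z assume z: "z \<in> J"
    show "z \<in> I"
    proof (cases "z \<le> y")
      case True then show ?thesis using z assms by (auto simp: J_def)
    next
      case False
      then have "z \<in> ball y d0" using z d0 by (auto simp: J_def d_def dist_real_def)
      then show ?thesis using d0 by auto
    qed
  qed
  have contJ: "continuous_on J f" using cont J continuous_on_subset by blast
  have gJ: "set_integrable lborel J g"
    using wd J unfolding has_weak_deriv_def locally_integrable_def by (auto simp: J_def)
  then have gJ': "integrable lborel (\<lambda>z. indicator J z * g z)" by (simp add: set_integrable_def)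
  define \<phi> where "\<phi> n z = ramp (real (Suc n) * (z - x)) - ramp (real (Suc n) * (z - y))" for n z
  define \<psi> where "\<psi> n w z = real (Suc n) * tent (real (Suc n) * (z - w))" for n w z
  have der: "(\<phi> n has_real_derivative (\<psi> n x z - \<psi> n y z)) (at z)" for n z
    unfolding \<phi>_def[abs_def] \<psi>_def by (auto intro!: derivative_eq_intros)
  have cpsi: "continuous_on S (\<psi> n w)" for n w S
    unfolding \<psi>_def[abs_def] by (intro continuous_intros)
  have deriv: "deriv (\<phi> n) z = \<psi> n x z - \<psi> n y z" for n z
    using der by (rule DERIV_imp_deriv)
  obtain N :: nat where N: "real N > 2 / d" using reals_Archimedean2 by blast
  have ev: "eventually (\<lambda>n. real (Suc n) * d \<ge> 2) sequentially"
  proof (rule eventually_sequentiallyI)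
    fix n assume "n \<ge> N"
    then have "real (Suc n) \<ge> 2 / d" using N by linarith
    then show "real (Suc n) * d \<ge> 2" using d by (simp add: field_simps)
  qed
  have big: "2 \<le> real (Suc n) * (z - w)" if "real (Suc n) * d \<ge> 2" "z \<ge> w + d" for n z w
    using that mult_left_mono[of d "z - w" "real (Suc n)"] by linarith
  have neg: "real (Suc n) * (z - w) \<le> 0" if "z \<le> w" for n z w
    using that by (simp add: mult_nonneg_nonpos)
  \<comment> \<open>Left of \<open>J\<close> both ramps are 0, right of it both are 1 and
    cancel.\<close>
  have phi0: "\<phi> n z = 0" if "real (Suc n) * d \<ge> 2" "z \<notin> J" for n z
  proof (cases "z < x")
    case True
    then show ?thesis using \<open>x \<le> y\<close> unfolding \<phi>_def by (simp add: ramp_eq_0 neg del: of_nat_Suc)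
  next
    case False
    then have "z \<ge> y + d" using that(2) by (auto simp: J_def)
    then show ?thesis using that(1) \<open>x \<le> y\<close> unfolding \<phi>_def by (simp add: ramp_eq_1 big del: of_nat_Suc)
  qed
  have psi0: "\<psi> n w z = 0" if "real (Suc n) * d \<ge> 2" "z \<notin> {w..w + d}" for n z w
    using that unfolding \<psi>_def
    by (cases "z \<le> w") (auto simp: tent_eq_0 neg big simp del: of_nat_Suc)
  have test: "test_function I (\<phi> n)" if "real (Suc n) * d \<ge> 2" for n
    unfolding test_function_def C1_differentiable_on_def
  proof (intro conjI exI ballI)
    show "(\<phi> n has_vector_derivative (\<psi> n x z - \<psi> n y z)) (at z)" for z
      using der by (simp flip: has_real_derivative_iff_has_vector_derivative)
    show "continuous_on UNIV (\<lambda>z. \<psi> n x z - \<psi> n y z)" by (intro continuous_intros cpsi)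
    show "compact J" by (simp add: J_def)
    show "J \<subseteq> I" by fact
    show "\<forall>z. z \<notin> J \<longrightarrow> \<phi> n z = 0" using phi0 that by blast
  qed
  have lhs: "(LINT z:I|lborel. f z * deriv (\<phi> n) z) =
      integral {x..x + d} (\<lambda>z. f z * \<psi> n x z) - integral {y..y + d} (\<lambda>z. f z * \<psi> n y z)"
    if n: "real (Suc n) * d \<ge> 2" for n
  proof -
    have part: "set_integrable lborel I (\<lambda>z. f z * \<psi> n w z)"
        "(LINT z:I|lborel. f z * \<psi> n w z) = integral {w..w + d} (\<lambda>z. f z * \<psi> n w z)"
      if w: "{w..w + d} \<subseteq> J" for w
    proof -
      have c: "continuous_on {w..w + d} (\<lambda>z. f z * \<psi> n w z)"
        by (intro continuous_intros cpsi continuous_on_subset[OF contJ w])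
      have si: "set_integrable lborel {w..w + d} (\<lambda>z. f z * \<psi> n w z)"
        by (rule borel_integrable_atLeastAtMost'[OF c])
      have "(\<lambda>z. indicator I z * (f z * \<psi> n w z)) = (\<lambda>z. indicator {w..w + d} z * (f z * \<psi> n w z))"
        using psi0[OF n] w J by (auto simp: indicator_def fun_eq_iff)
      with si show "set_integrable lborel I (\<lambda>z. f z * \<psi> n w z)" by (simp add: set_integrable_def)
      have "(LINT z:I|lborel. f z * \<psi> n w z) = (LINT z:{w..w + d}|lborel. f z * \<psi> n w z)"
        using psi0[OF n] w J by (intro set_integral_restrict) auto
      then show "(LINT z:I|lborel. f z * \<psi> n w z) = integral {w..w + d} (\<lambda>z. f z * \<psi> n w z)"
        using set_borel_integral_eq_integral(2)[OF si] by simp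
    qed
    have sub: "{x..x + d} \<subseteq> J" "{y..y + d} \<subseteq> J" using \<open>x \<le> y\<close> by (auto simp: J_def)
    show ?thesis
      unfolding deriv right_diff_distrib
      by (simp add: part[OF sub(1)] part[OF sub(2)] set_integral_diff)
  qed
  have wdn: "(LINT z:I|lborel. f z * deriv (\<phi> n) z) = - (LINT z:J|lborel. g z * \<phi> n z)"
    if n: "real (Suc n) * d \<ge> 2" for n
  proof -
    have "(LINT z:I|lborel. g z * \<phi> n z) = (LINT z:J|lborel. g z * \<phi> n z)"
      using phi0[OF n] J by (intro set_integral_restrict) auto
    then show ?thesis using wd test[OF n] unfolding has_weak_deriv_def by auto
  qed
  have "(\<lambda>n. integral {x..x + d} (\<lambda>z. f z * \<psi> n x z) - integral {y..y + d} (\<lambda>z. f z * \<psi> n y z))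
      \<longlonglongrightarrow> f x - f y"
    unfolding \<psi>_def using \<open>x \<le> y\<close> d
    by (intro tendsto_diff tent_mean_tendsto continuous_on_subset[OF contJ]) (auto simp: J_def)
  moreover have "eventually (\<lambda>n. integral {x..x + d} (\<lambda>z. f z * \<psi> n x z)
      - integral {y..y + d} (\<lambda>z. f z * \<psi> n y z) = - (LINT z:J|lborel. g z * \<phi> n z)) sequentially"
    using ev by (rule eventually_mono) (metis lhs wdn)
  ultimately have L1: "(\<lambda>n. - (LINT z:J|lborel. g z * \<phi> n z)) \<longlonglongrightarrow> f x - f y"
    by (rule Lim_transform_eventually)
  have L2: "(\<lambda>n. (LINT z:J|lborel. g z * \<phi> n z)) \<longlonglongrightarrow> (LINT z:J|lborel. g z * indicator {x<..y} z)"
    unfolding set_lebesgue_integral_def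
  proof (rule integral_dominated_convergence)
    have gm: "(\<lambda>z. indicator J z * g z) \<in> borel_measurable lborel" using gJ' by auto
    have "(\<lambda>z. indicator J z * g z * indicator {x<..y} z) \<in> borel_measurable lborel"
      using gm by measurable
    then show "(\<lambda>z. indicator J z *\<^sub>R (g z * indicator {x<..y} z)) \<in> borel_measurable lborel"
      by (simp add: mult.assoc)
    show "(\<lambda>z. indicator J z *\<^sub>R (g z * \<phi> n z)) \<in> borel_measurable lborel" for n
    proof -
      have "continuous_on UNIV (\<phi> n)"
        using der by (auto intro: DERIV_isCont simp: continuous_on_eq_continuous_at)
      then have "\<phi> n \<in> borel_measurable borel" by (rule borel_measurable_continuous_onI)
      then have "(\<lambda>z. (indicator J z * g z) * \<phi> n z) \<in> borel_measurable lborel"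
        using gm by measurable
      then show ?thesis by (simp add: mult.assoc)
    qed
    show "integrable lborel (\<lambda>z. \<bar>indicator J z * g z\<bar>)" using gJ' by auto
    show "AE z in lborel. norm (indicator J z *\<^sub>R (g z * \<phi> n z)) \<le> \<bar>indicator J z * g z\<bar>" for n
    proof (rule AE_I2)
      fix z
      have "\<bar>\<phi> n z\<bar> \<le> 1"
        using ramp_bounds[of "real (Suc n) * (z - x)"] ramp_bounds[of "real (Suc n) * (z - y)"]
        unfolding \<phi>_def by linarith
      then show "norm (indicator J z *\<^sub>R (g z * \<phi> n z)) \<le> \<bar>indicator J z * g z\<bar>"
        by (auto simp: abs_mult indicator_def mult_left_le)
    qed
    show "AE z in lborel. (\<lambda>n. indicator J z *\<^sub>R (g z * \<phi> n z)) \<longlonglongrightarrow> indicator J z *\<^sub>R (g z * indicator {x<..y} z)"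
    proof (rule AE_I2)
      fix z
      have step: "(\<lambda>n. ramp (real (Suc n) * (z - w))) \<longlonglongrightarrow> (if z \<le> w then 0 else 1)" for w
      proof (cases "z \<le> w")
        case True then show ?thesis by (simp add: ramp_eq_0 neg del: of_nat_Suc)
      next
        case False
        obtain N :: nat where N: "real N > 2 / (z - w)" using reals_Archimedean2 by blast
        have "eventually (\<lambda>n. ramp (real (Suc n) * (z - w)) = 1) sequentially"
        proof (rule eventually_sequentiallyI)
          fix n assume "n \<ge> N"
          then have "real (Suc n) \<ge> 2 / (z - w)" using N by linarith
          then show "ramp (real (Suc n) * (z - w)) = 1"
            using False by (intro ramp_eq_1) (simp add: field_simps)
        qed
        then show ?thesis using False by (simp add: tendsto_eventually)
      qed
      have "(\<lambda>n. \<phi> n z) \<longlonglongrightarrow> (if z \<le> x then 0 else 1) - (if z \<le> y then 0 else 1)"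
        unfolding \<phi>_def by (intro tendsto_diff step)
      also have "(if z \<le> x then 0 else 1) - (if z \<le> y then 0 else 1) = (indicator {x<..y} z :: real)"
        using \<open>x \<le> y\<close> by (auto simp: indicator_def)
      finally show "(\<lambda>n. indicator J z *\<^sub>R (g z * \<phi> n z)) \<longlonglongrightarrow> indicator J z *\<^sub>R (g z * indicator {x<..y} z)"
        by (intro tendsto_intros)
    qed
  qed
  have "(LINT z:J|lborel. g z * indicator {x<..y} z) = f y - f x"
    using LIMSEQ_unique[OF L1 tendsto_minus[OF L2]] by simp
  also have "(LINT z:J|lborel. g z * indicator {x<..y} z) = (LINT z:{x<..y}|lborel. g z)"
    unfolding set_lebesgue_integral_def using \<open>x \<le> y\<close> d
    by (intro Bochner_Integration.integral_cong) (auto simp: indicator_def J_def)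
  also have "\<dots> = (LINT z:{x..y}|lborel. g z)"
    by (rule set_integral_discrete_difference[of "{x}"]) auto
  finally have e: "(LINT z:{x..y}|lborel. g z) = f y - f x" .
  have "set_integrable lborel {x..y} g"
    using gJ by (rule set_integrable_subset) (use d in \<open>auto simp: J_def\<close>)
  from set_borel_integral_eq_integral[OF this] show ?thesis
    using e by (simp add: has_integral_integral)
qed

text \<open>The sets \<open>{..a}\<close> are an intersection-stable generator of the Borel sets, so
  Dynkin's argument spreads the vanishing to all of them, and then uniqueness of densities applies.
  Complements need the integral over the whole line, which is a limit of the given ones.\<close>

lemma AE_eq_0_if_interval_integrals_0:
  fixes d :: "real \<Rightarrow> real"
  assumes d: "integrable lborel d" and 0: "\<And>a. (LINT z:{..a}|lborel. d z) = 0"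
  shows "AE z in lborel. d z = 0"
proof (rule density_unique_real[OF d])
  show "integrable lborel (\<lambda>_. 0 :: real)" by simp
next
  have si: "set_integrable lborel A d" if "A \<in> sets borel" for A
    using integrable_mult_indicator[OF _ d, of A] that by (simp add: set_integrable_def)
  have total: "(LINT z:UNIV|lborel. d z) = 0"
  proof -
    have "(\<lambda>n::nat. LINT z:{..real n}|lborel. d z) \<longlonglongrightarrow> (LINT z:(\<Union>n::nat. {..real n})|lborel. d z)"
      by (intro set_integral_cont_up si) (auto simp: incseq_def)
    moreover have "(\<Union>n::nat. {..real n}) = UNIV" using real_arch_simple by auto
    ultimately show ?thesis by (simp add: 0 LIMSEQ_const_iff)
  qed
  fix A :: "real set" assume "A \<in> sets lborel"
  then have A: "A \<in> sigma_sets UNIV (range (\<lambda>a::real. {..a}))"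
    by (simp add: borel_eq_atMost)
  have "Int_stable (range (\<lambda>a::real. {..a}))"
    by (auto simp: Int_stable_def)
  moreover have "range (\<lambda>a::real. {..a}) \<subseteq> Pow UNIV" by auto
  moreover note A
  ultimately have "(LINT z:A|lborel. d z) = 0"
  proof (induction rule: sigma_sets_induct_disjoint)
    case (basic A) then show ?case using 0 by auto
  next
    case empty then show ?case by (simp add: set_lebesgue_integral_def)
  next
    case (compl A)
    then have A: "A \<in> sets borel" by (simp add: borel_eq_atMost)
    have "(LINT z:A \<union> (UNIV - A)|lborel. d z) = (LINT z:A|lborel. d z) + (LINT z:UNIV - A|lborel. d z)"
      using A by (intro set_integral_Un si) auto
    then show ?case using total compl by simp
  next
    case (union B)
    then have B: "B i \<in> sets borel" for i by (auto simp: borel_eq_atMost)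
    have "(LINT z:(\<Union>i. B i)|lborel. d z) = (\<Sum>i. LINT z:B i|lborel. d z)"
      using B union by (intro lebesgue_integral_countable_add si) (auto simp: disjoint_family_on_def)
    then show ?case using union by simp
  qed
  then show "(LINT z:A|lborel. d z) = (LINT z:A|lborel. 0)" by (simp add: set_lebesgue_integral_def)
qed

text \<open>On a compact subinterval both candidates have the primitive \<open>f\<close>, so their
  difference integrates to 0 over every initial piece. Countably many such subintervals exhaust the
  interval.\<close>

lemma weak_deriv_AE_unique:
  assumes wd: "has_weak_deriv (einterval a b) f g" "has_weak_deriv (einterval a b) f g'"
    and cont: "continuous_on (einterval a b) f" and "a < b"
  shows "AE x in lborel. x \<in> einterval a b \<longrightarrow> g x = g' x"
proof -
  obtain u l :: "nat \<Rightarrow> real" where ul: "einterval a b = (\<Union>i. {l i .. u i})" "\<And>i. l i < u i"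
    using einterval_Icc_approximation[OF \<open>a < b\<close>] by metis
  have "AE x in lborel. x \<in> {l i..u i} \<longrightarrow> g x = g' x" for i
  proof -
    have sub: "{l i..u i} \<subseteq> einterval a b" using ul by auto
    have gi: "set_integrable lborel {l i..u i} g" "set_integrable lborel {l i..u i} g'"
      using wd sub unfolding has_weak_deriv_def locally_integrable_def by auto
    define d where "d z = indicator {l i..u i} z * (g z - g' z)" for z
    have si: "set_integrable lborel {l i..u i} (\<lambda>z. g z - g' z)" by (intro set_integral_diff gi)
    have "AE z in lborel. d z = 0"
    proof (rule AE_eq_0_if_interval_integrals_0)
      show "integrable lborel d" using si by (simp add: d_def[abs_def] set_integrable_def)
      fix c
      have eq: "(LINT z:{..c}|lborel. d z) = (LINT z:{l i..min c (u i)}|lborel. g z - g' z)"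
        unfolding set_lebesgue_integral_def d_def
        by (intro Bochner_Integration.integral_cong) (auto simp: indicator_def)
      show "(LINT z:{..c}|lborel. d z) = 0"
      proof (cases "l i \<le> c")
        case True
        have s: "{l i..min c (u i)} \<subseteq> einterval a b" using sub by auto
        have "((\<lambda>z. g z - g' z) has_integral 0) {l i..min c (u i)}"
          using has_integral_diff[OF weak_deriv_FTC[OF wd(1) _ cont] weak_deriv_FTC[OF wd(2) _ cont],
              of "l i" "min c (u i)"] True ul(2)[of i] sub s
          by (auto simp: open_einterval less_imp_le)
        moreover have "set_integrable lborel {l i..min c (u i)} (\<lambda>z. g z - g' z)"
          by (rule set_integrable_subset[OF si]) auto
        ultimately show ?thesis
          unfolding eq by (simp add: integral_unique set_borel_integral_eq_integral(2))
      next
        case False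
        then show ?thesis unfolding eq by (simp add: set_lebesgue_integral_def)
      qed
    qed
    then show ?thesis by (rule AE_mp) (auto simp: d_def)
  qed
  then have "AE x in lborel. \<forall>i. x \<in> {l i..u i} \<longrightarrow> g x = g' x" by (subst AE_all_countable) auto
  then show ?thesis by (rule AE_mp) (auto simp: ul)
qed

text \<open>\<open>weak_deriv\<close> is an arbitrary choice that can differ from a given
  representative on a null set; these two facts are all that controls it.\<close>

lemma weak_deriv_AE_eq:
  assumes "has_weak_deriv (einterval a b) f g" "continuous_on (einterval a b) f" "a < b"
  shows "has_weak_deriv (einterval a b) f (weak_deriv (einterval a b) f)"
    and "AE x in lborel. x \<in> einterval a b \<longrightarrow> weak_deriv (einterval a b) f x = g x"
proof -
  show *: "has_weak_deriv (einterval a b) f (weak_deriv (einterval a b) f)"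
    unfolding weak_deriv_def using someI[of "has_weak_deriv (einterval a b) f", OF assms(1)] by simp
  show "AE x in lborel. x \<in> einterval a b \<longrightarrow> weak_deriv (einterval a b) f x = g x"
    by (rule weak_deriv_AE_unique[OF * assms])
qed

text \<open>The function is a pointwise limit of its restrictions to compact intervals, each of
  which is integrable.\<close>

lemma locally_integrable_measurable:
  assumes "locally_integrable (einterval a b) g" "a < b"
  shows "set_borel_measurable lborel (einterval a b) g"
proof -
  obtain u l :: "nat \<Rightarrow> real" where ul: "einterval a b = (\<Union>i. {l i .. u i})" "incseq u" "decseq l"
    using einterval_Icc_approximation[OF \<open>a < b\<close>] by metis
  have "(\<lambda>x. indicator (einterval a b) x *\<^sub>R g x) \<in> borel_measurable lborel"
  proof (rule borel_measurable_LIMSEQ_real)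
    show "(\<lambda>x. indicator {l i..u i} x *\<^sub>R g x) \<in> borel_measurable lborel" for i
    proof -
      have "set_integrable lborel {l i..u i} g"
        using assms(1) ul(1) unfolding locally_integrable_def by auto
      then show ?thesis unfolding set_integrable_def by (rule borel_measurable_integrable)
    qed
    fix x
    have "(\<lambda>i. indicat_real {l i..u i} x) \<longlonglongrightarrow> indicator (\<Union>i. {l i..u i}) x"
      using ul(2,3) by (intro LIMSEQ_indicator_incseq) (fastforce simp: incseq_def decseq_def intro: order_trans)
    then show "(\<lambda>i. indicator {l i..u i} x *\<^sub>R g x) \<longlonglongrightarrow> indicator (einterval a b) x *\<^sub>R g x"
      unfolding ul(1) by (intro tendsto_intros)
  qed
  then show ?thesis by (simp add: set_borel_measurable_def)
qed

section \<open>Calibrations\<close>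

text \<open>A substitute for the chain rule when \<open>f\<close> is merely a primitive of
  \<open>g\<close>. Instead of differentiating \<Phi> \<circ> f almost everywhere, the interval is
  cut into pieces on which \<open>W \<circ> f\<close> is nearly constant, and the mean value theorem
  is applied to \<Phi> rather than to \<open>f\<close>. As in the calculus of variations, a
  calibration bounds an integral from below by end values alone.\<close>

lemma calibration:
  fixes f g h \<Phi> W :: "real \<Rightarrow> real"
  assumes "a \<le> b" and cont: "continuous_on {a..b} f"
    and prim: "\<And>x y. a \<le> x \<Longrightarrow> x \<le> y \<Longrightarrow> y \<le> b \<Longrightarrow> (g has_integral (f y - f x)) {x..y}"
    and g: "(\<lambda>x. \<bar>g x\<bar>) integrable_on {a..b}" and h: "h integrable_on {a..b}"
    and \<Phi>: "\<And>z. (\<Phi> has_real_derivative W z) (at z)" and W: "continuous_on UNIV W"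
    and le: "\<And>x. x \<in> {a..b} \<Longrightarrow> \<bar>W (f x)\<bar> * \<bar>g x\<bar> \<le> h x"
  shows "\<bar>\<Phi> (f b) - \<Phi> (f a)\<bar> \<le> integral {a..b} h"
proof (rule field_le_epsilon)
  fix e :: real assume "e > 0"
  define G where "G = integral {a..b} (\<lambda>x. \<bar>g x\<bar>)"
  have "G \<ge> 0" unfolding G_def by (intro Henstock_Kurzweil_Integration.integral_nonneg g) auto
  \<comment> \<open>The \<open>+ 1\<close> covers \<open>G = 0\<close>.\<close>
  define \<epsilon> where "\<epsilon> = e / (G + 1)"
  have \<epsilon>: "\<epsilon> > 0" "\<epsilon> * G \<le> e" using \<open>e > 0\<close> \<open>G \<ge> 0\<close> by (auto simp: \<epsilon>_def field_simps)
  have "continuous_on {a..b} (\<lambda>x. W (f x))"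
    using continuous_on_compose[OF cont continuous_on_subset[OF W]] by (simp add: o_def)
  then have "uniformly_continuous_on {a..b} (\<lambda>x. W (f x))"
    by (intro compact_uniformly_continuous) auto
  then obtain d where d: "d > 0"
    "\<And>x y. x \<in> {a..b} \<Longrightarrow> y \<in> {a..b} \<Longrightarrow> \<bar>y - x\<bar> < d \<Longrightarrow> \<bar>W (f y) - W (f x)\<bar> < \<epsilon>"
    using \<epsilon>(1) unfolding uniformly_continuous_on_def dist_real_def by metis
  have int: "(\<lambda>z. h z + \<epsilon> * \<bar>g z\<bar>) integrable_on {x..y}" if "a \<le> x" "y \<le> b" for x y
    using that by (intro integrable_add integrable_on_mult_right integrable_subinterval_real[OF g]
      integrable_subinterval_real[OF h]) auto
  have local: "\<bar>\<Phi> (f y) - \<Phi> (f x)\<bar> \<le> integral {x..y} (\<lambda>z. h z + \<epsilon> * \<bar>g z\<bar>)"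
    if xy: "a \<le> x" "x \<le> y" "y \<le> b" "y - x < d" for x y
  proof -
    have contxy: "continuous_on {x..y} f" using xy by (intro continuous_on_subset[OF cont]) auto
    have "\<exists>\<xi>. \<xi> \<in> closed_segment (f x) (f y) \<and> \<Phi> (f y) - \<Phi> (f x) = (f y - f x) * W \<xi>"
    proof (cases "f x" "f y" rule: linorder_cases)
      case less
      from MVT2[OF this, of \<Phi> W] \<Phi> obtain \<xi> where "f x < \<xi>" "\<xi> < f y" "\<Phi> (f y) - \<Phi> (f x) = (f y - f x) * W \<xi>"
        by blast
      then show ?thesis by (intro exI[of _ \<xi>]) (auto simp: closed_segment_eq_real_ivl)
    next
      case greater
      from MVT2[OF this, of \<Phi> W] \<Phi> obtain \<xi> where "f y < \<xi>" "\<xi> < f x" "\<Phi> (f x) - \<Phi> (f y) = (f x - f y) * W \<xi>"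
        by blast
      then show ?thesis by (intro exI[of _ \<xi>]) (auto simp: closed_segment_eq_real_ivl algebra_simps)
    qed auto
    then obtain \<xi> where \<xi>: "\<xi> \<in> closed_segment (f x) (f y)" "\<Phi> (f y) - \<Phi> (f x) = (f y - f x) * W \<xi>"
      by blast
    \<comment> \<open>The intermediate value theorem realises \<xi> as a value of \<open>f\<close>
      on the same piece, so that the uniform continuity of \<open>W \<circ> f\<close> can compare
      \<open>W \<xi>\<close> with \<open>W (f t)\<close>.\<close>
    have "\<exists>z\<in>{x..y}. f z = \<xi>"
    proof -
      have "is_interval (f ` {x..y})"
        using connected_continuous_image[OF contxy] by (simp add: is_interval_connected_1)
      then have "closed_segment (f x) (f y) \<subseteq> f ` {x..y}"
        using xy(2) by (intro closed_segment_subset is_interval_convex) auto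
      then show ?thesis using \<xi>(1) by auto
    qed
    then obtain z where z: "z \<in> {x..y}" "f z = \<xi>" by blast
    have gxy: "(\<lambda>x. \<bar>g x\<bar>) integrable_on {x..y}"
      using xy by (intro integrable_subinterval_real[OF g]) auto
    have p: "(g has_integral (f y - f x)) {x..y}" using prim xy by blast
    have "\<bar>f y - f x\<bar> \<le> integral {x..y} (\<lambda>x. \<bar>g x\<bar>)"
      using integral_norm_bound_integral[OF has_integral_integrable[OF p] gxy] integral_unique[OF p] by simp
    then have "\<bar>\<Phi> (f y) - \<Phi> (f x)\<bar> \<le> integral {x..y} (\<lambda>x. \<bar>g x\<bar>) * \<bar>W (f z)\<bar>"
      unfolding \<xi>(2) z(2) abs_mult by (intro mult_right_mono) auto
    also have "\<dots> = integral {x..y} (\<lambda>t. \<bar>g t\<bar> * \<bar>W (f z)\<bar>)" by simp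
    also have "\<dots> \<le> integral {x..y} (\<lambda>t. h t + \<epsilon> * \<bar>g t\<bar>)"
    proof (rule integral_le)
      show "(\<lambda>t. \<bar>g t\<bar> * \<bar>W (f z)\<bar>) integrable_on {x..y}"
        by (intro integrable_on_mult_left gxy)
      show "(\<lambda>t. h t + \<epsilon> * \<bar>g t\<bar>) integrable_on {x..y}" using int xy by blast
      fix t assume t: "t \<in> {x..y}"
      have "\<bar>W (f z) - W (f t)\<bar> < \<epsilon>"
        by (rule d(2)) (use z t xy in auto)
      then have "\<bar>W (f z)\<bar> \<le> \<bar>W (f t)\<bar> + \<epsilon>" by linarith
      then have "\<bar>g t\<bar> * \<bar>W (f z)\<bar> \<le> \<bar>g t\<bar> * (\<bar>W (f t)\<bar> + \<epsilon>)" by (intro mult_left_mono) auto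
      also have "\<dots> \<le> h t + \<epsilon> * \<bar>g t\<bar>" using le[of t] t xy by (auto simp: algebra_simps)
      finally show "\<bar>g t\<bar> * \<bar>W (f z)\<bar> \<le> h t + \<epsilon> * \<bar>g t\<bar>" .
    qed
    finally show ?thesis .
  qed
  \<comment> \<open>The strict inequality also makes \<open>N\<close> positive, even if
    \<open>a = b\<close>.\<close>
  obtain N :: nat where N: "real N > (b - a) / d" using reals_Archimedean2 by blast
  define x where "x i = a + real i * ((b - a) / real N)" for i
  have "real N > 0" using N \<open>a \<le> b\<close> d(1) by (smt (verit) divide_nonneg_pos)
  moreover have "b - a < d * real N" using N d(1) by (simp add: field_simps)
  ultimately have "(b - a) / real N < d" "0 \<le> (b - a) / real N"
    using \<open>a \<le> b\<close> by (auto simp: pos_divide_less_eq)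
  moreover have "x (Suc i) = x i + (b - a) / real N" for i
    by (simp add: x_def distrib_right add_divide_distrib)
  ultimately have step: "x (Suc i) - x i < d" "x i \<le> x (Suc i)" for i
    by simp_all
  have xN: "x N = b" "x 0 = a" using \<open>real N > 0\<close> by (auto simp: x_def)
  have mono: "x i \<le> x j" if "i \<le> j" for i j
    using step(2) that by (rule lift_Suc_mono_le)
  have "\<bar>\<Phi> (f (x i)) - \<Phi> (f a)\<bar> \<le> integral {a..x i} (\<lambda>z. h z + \<epsilon> * \<bar>g z\<bar>)" if "i \<le> N" for i
    using that
  proof (induction i)
    case 0 then show ?case by (simp add: xN)
  next
    case (Suc i)
    have 1: "a \<le> x i" "x (Suc i) \<le> b" using mono[of 0 i] mono[of "Suc i" N] Suc.prems xN by auto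
    have "\<bar>\<Phi> (f (x (Suc i))) - \<Phi> (f (x i))\<bar> \<le> integral {x i..x (Suc i)} (\<lambda>z. h z + \<epsilon> * \<bar>g z\<bar>)"
      by (rule local) (use 1 step in auto)
    moreover have "integral {a..x i} (\<lambda>z. h z + \<epsilon> * \<bar>g z\<bar>) + integral {x i..x (Suc i)} (\<lambda>z. h z + \<epsilon> * \<bar>g z\<bar>)
        = integral {a..x (Suc i)} (\<lambda>z. h z + \<epsilon> * \<bar>g z\<bar>)"
      by (rule Henstock_Kurzweil_Integration.integral_combine) (use 1 step int in auto)
    ultimately show ?case using Suc by linarith
  qed
  from this[of N] have "\<bar>\<Phi> (f b) - \<Phi> (f a)\<bar> \<le> integral {a..b} (\<lambda>z. h z + \<epsilon> * \<bar>g z\<bar>)"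
    by (simp add: xN)
  also have "\<dots> = integral {a..b} h + \<epsilon> * G"
    using g h by (subst Henstock_Kurzweil_Integration.integral_add) (auto simp: G_def intro: integrable_on_mult_right)
  finally show "\<bar>\<Phi> (f b) - \<Phi> (f a)\<bar> \<le> integral {a..b} h + e" using \<epsilon>(2) by linarith
qed

section \<open>Sobolev functions on a single edge\<close>

definition cedge :: "ereal \<Rightarrow> real set" where
  "cedge L = {x. 0 \<le> x \<and> ereal x \<le> L}"

text \<open>The weak derivative is replaced by its consequence that \<open>f\<close> is a primitive
  of \<open>g\<close> up to and including the end points, the form in which calibrations use
  it.\<close>

definition H1_edge :: "ereal \<Rightarrow> (real \<Rightarrow> real) \<Rightarrow> (real \<Rightarrow> real) \<Rightarrow> bool" where
  "H1_edge L f g \<longleftrightarrow> continuous_on (cedge L) f \<and>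
     set_borel_measurable lborel (einterval 0 L) g \<and>
     set_integrable lborel (einterval 0 L) (\<lambda>x. (f x)\<^sup>2) \<and>
     set_integrable lborel (einterval 0 L) (\<lambda>x. (g x)\<^sup>2) \<and>
     (\<forall>x y. x \<in> cedge L \<longrightarrow> y \<in> cedge L \<longrightarrow> x \<le> y \<longrightarrow> (g has_integral (f y - f x)) {x..y})"

lemma Ioo_subset_einterval: "x \<in> cedge L \<Longrightarrow> y \<in> cedge L \<Longrightarrow> {x<..<y} \<subseteq> einterval 0 L"
  by (auto simp: cedge_def einterval_def) (metis less_ereal.simps(1) order_less_le_trans)

lemma Icc_subset_cedge: "x \<in> cedge L \<Longrightarrow> y \<in> cedge L \<Longrightarrow> {x..y} \<subseteq> cedge L"
  by (auto simp: cedge_def) (metis ereal_less_eq(3) order_trans)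

text \<open>|t| \<le> 1 + t^2, and a bounded interval has finite measure.\<close>

lemma set_integrable_abs_if_square:
  assumes "set_borel_measurable lborel O' g" "set_integrable lborel O' (\<lambda>x. (g x)\<^sup>2)"
    and "{x<..<y} \<subseteq> O'"
  shows "set_integrable lborel {x<..<y} (g :: real \<Rightarrow> real)"
proof -
  have "set_integrable lborel {x<..<y} (\<lambda>x. 1 + (g x)\<^sup>2)"
  proof (intro set_integral_add)
    show "set_integrable lborel {x<..<y} (\<lambda>x. (g x)\<^sup>2)"
      by (rule set_integrable_subset[OF assms(2) _ assms(3)]) auto
    show "set_integrable lborel {x<..<y} (\<lambda>x. 1 :: real)"
      by (cases "x \<le> y") (auto simp: set_integrable_def)
  qed
  then show ?thesis
  proof (rule set_integrable_bound)
    show "set_borel_measurable lborel {x<..<y} g"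
      by (rule set_borel_measurable_subset[OF assms(1) _ assms(3)]) auto
    have "\<bar>t\<bar> \<le> 1 + t\<^sup>2" for t :: real
      using zero_le_power2[of "\<bar>t\<bar> - 1/2"] by (simp add: power2_eq_square algebra_simps)
    then show "AE z in lborel. z \<in> {x<..<y} \<longrightarrow> norm (g z) \<le> norm (1 + (g z)\<^sup>2)"
      by (simp add: add_nonneg_nonneg)
  qed
qed

text \<open>In the open edge this is \<open>weak_deriv_FTC\<close>. For the end points,
  \<open>f\<close> minus the indefinite integral of \<open>g\<close> is continuous on the closed
  interval and constant in its interior, hence constant.\<close>

lemma H1_edgeI:
  assumes wd: "has_weak_deriv (einterval 0 L) f g" and cont: "continuous_on (cedge L) f"
    and f2: "set_integrable lborel (einterval 0 L) (\<lambda>x. (f x)\<^sup>2)"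
    and g2: "set_integrable lborel (einterval 0 L) (\<lambda>x. (g x)\<^sup>2)" and "0 < L"
  shows "H1_edge L f g"
  unfolding H1_edge_def
proof (intro conjI allI impI cont f2 g2)
  show gm: "set_borel_measurable lborel (einterval 0 L) g"
    using wd \<open>0 < L\<close> unfolding has_weak_deriv_def by (intro locally_integrable_measurable) auto
  fix x y assume xy: "x \<in> cedge L" "y \<in> cedge L" "x \<le> y"
  show "(g has_integral (f y - f x)) {x..y}"
  proof (cases "x = y")
    case False
    then have "x < y" using xy by auto
    have sub: "{x<..<y} \<subseteq> einterval 0 L" using xy by (intro Ioo_subset_einterval)
    have "set_integrable lborel {x<..<y} g" by (rule set_integrable_abs_if_square[OF gm g2 sub])
    then have gi: "g integrable_on {x..y}"
      using set_borel_integral_eq_integral(1) by (auto simp: integrable_on_Icc_iff_Ioo)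
    define D where "D z = f z - integral {x..z} g" for z
    have contD: "continuous_on {x..y} D"
      unfolding D_def[abs_def]
      by (intro continuous_intros continuous_on_subset[OF cont] indefinite_integral_continuous_1 gi
          Icc_subset_cedge xy)
    define m where "m = (x + y) / 2"
    have m: "x < m" "m < y" using \<open>x < y\<close> by (auto simp: m_def)
    have cont': "continuous_on (einterval 0 L) f"
      by (rule continuous_on_subset[OF cont]) (auto simp: cedge_def einterval_def zero_ereal_def)
    have D: "D z' = D z" if "x < z" "z \<le> z'" "z' < y" for z z'
    proof -
      have "(g has_integral (f z' - f z)) {z..z'}"
        by (rule weak_deriv_FTC[OF wd _ cont']) (use that sub in \<open>auto simp: open_einterval\<close>)
      moreover have "integral {x..z} g + integral {z..z'} g = integral {x..z'} g"
        by (rule Henstock_Kurzweil_Integration.integral_combine)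
           (use that in \<open>auto intro: integrable_subinterval_real[OF gi]\<close>)
      ultimately show ?thesis by (simp add: D_def integral_unique)
    qed
    have "D z = D m" if "z \<in> {x<..<y}" for z
      using D[of z m] D[of m z] m that by (cases "z \<le> m") auto
    then have "D z = D m" if "z \<in> {x..y}" for z
      using continuous_constant_on_closure[of "{x<..<y}" D "D m" z] contD that \<open>x < y\<close> by auto
    from this[of x] this[of y] have "D y = D x" using xy by auto
    then have "integral {x..y} g = f y - f x" by (simp add: D_def)
    then show ?thesis using gi by (simp add: has_integral_integral)
  qed auto
qed

lemma H1_edge_calibration:
  assumes e: "H1_edge L f g" and xy: "x \<in> cedge L" "y \<in> cedge L" "x \<le> y"
    and h: "set_integrable lborel (einterval 0 L) h"
    and \<Phi>: "\<And>z. (\<Phi> has_real_derivative W z) (at z)" and W: "continuous_on UNIV W"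
    and le: "\<And>x. x \<in> cedge L \<Longrightarrow> \<bar>W (f x)\<bar> * \<bar>g x\<bar> \<le> h x"
  shows "\<bar>\<Phi> (f y) - \<Phi> (f x)\<bar> \<le> (LINT t:{x<..<y}|lborel. h t)"
proof -
  have sub: "{x<..<y} \<subseteq> einterval 0 L" using xy by (intro Ioo_subset_einterval)
  have subc: "{x..y} \<subseteq> cedge L" using xy by (intro Icc_subset_cedge)
  have si: "set_integrable lborel {x<..<y} h" by (rule set_integrable_subset[OF h _ sub]) auto
  have "set_integrable lborel {x<..<y} g"
    using e sub unfolding H1_edge_def by (intro set_integrable_abs_if_square[of "einterval 0 L"]) auto
  then have "set_integrable lborel {x<..<y} (\<lambda>x. \<bar>g x\<bar>)" by (rule set_integrable_abs)
  then have gi: "(\<lambda>x. \<bar>g x\<bar>) integrable_on {x..y}"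
    using set_borel_integral_eq_integral(1) by (auto simp: integrable_on_Icc_iff_Ioo)
  have hi: "h integrable_on {x..y}"
    using set_borel_integral_eq_integral(1)[OF si] by (auto simp: integrable_on_Icc_iff_Ioo)
  have "\<bar>\<Phi> (f y) - \<Phi> (f x)\<bar> \<le> integral {x..y} h"
  proof (rule calibration[OF xy(3) _ _ gi hi \<Phi> W])
    show "continuous_on {x..y} f" using e subc unfolding H1_edge_def by (auto intro: continuous_on_subset)
    show "(g has_integral f t' - f t) {t..t'}" if "x \<le> t" "t \<le> t'" "t' \<le> y" for t t'
    proof -
      have "t \<in> {x..y}" "t' \<in> {x..y}" using that by auto
      then show ?thesis using e subc that unfolding H1_edge_def by blast
    qed
    show "\<bar>W (f t)\<bar> * \<bar>g t\<bar> \<le> h t" if "t \<in> {x..y}" for t using le subc that by auto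
  qed
  moreover have "(h has_integral (LINT t:{x<..<y}|lborel. h t)) {x..y}"
    using set_borel_integral_eq_integral[OF si] by (simp add: has_integral_Icc_iff_Ioo has_integral_integral)
  ultimately show ?thesis by (simp add: integral_unique)
qed

lemma set_integral_mono_set:
  assumes "set_integrable M B h" "A \<in> sets M" "A \<subseteq> B" "\<And>x. x \<in> B \<Longrightarrow> 0 \<le> (h x :: real)"
  shows "(LINT x:A|M. h x) \<le> (LINT x:B|M. h x)"
  unfolding set_lebesgue_integral_def using set_integrable_subset[OF assms(1-3)] assms
  by (intro integral_mono) (auto simp: set_integrable_def indicator_def)

lemma set_integral_mono_Un:
  assumes "set_integrable M C h" "A \<in> sets M" "B \<in> sets M" "A \<inter> B = {}" "A \<union> B \<subseteq> C"
    "\<And>x. x \<in> C \<Longrightarrow> 0 \<le> (h x :: real)"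
  shows "(LINT x:A|M. h x) + (LINT x:B|M. h x) \<le> (LINT x:C|M. h x)"
proof -
  have "set_integrable M A h" "set_integrable M B h"
    using assms by (auto intro: set_integrable_subset[OF assms(1)])
  then have "(LINT x:A|M. h x) + (LINT x:B|M. h x) = (LINT x:A \<union> B|M. h x)"
    using assms(4) by (simp add: set_integral_Un)
  also have "\<dots> \<le> (LINT x:C|M. h x)"
    using assms by (intro set_integral_mono_set) auto
  finally show ?thesis .
qed

lemma einterval_0_infinity: "einterval 0 \<infinity> = {0<..}"
  by (auto simp: einterval_def zero_ereal_def)

lemma einterval_0_ereal: "einterval 0 (ereal l) = {0<..<l}"
  by (auto simp: einterval_def zero_ereal_def)

lemma cedge_infinity: "cedge \<infinity> = {0..}"
  by (auto simp: cedge_def)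

lemma cedge_ereal: "cedge (ereal l) = {0..l}"
  by (auto simp: cedge_def)

lemma H1_edge_square_bound:
  assumes "H1_edge L f g" "\<kappa> > 0"
  shows "set_integrable lborel (einterval 0 L) (\<lambda>x. \<kappa> * (f x)\<^sup>2 + (g x)\<^sup>2 / \<kappa>)"
    and "\<bar>2 * f x\<bar> * \<bar>g x\<bar> \<le> \<kappa> * (f x)\<^sup>2 + (g x)\<^sup>2 / \<kappa>"
proof -
  show "set_integrable lborel (einterval 0 L) (\<lambda>x. \<kappa> * (f x)\<^sup>2 + (g x)\<^sup>2 / \<kappa>)"
    using assms unfolding H1_edge_def by (intro set_integral_add) auto
  have "0 \<le> (\<kappa> * \<bar>f x\<bar> - \<bar>g x\<bar>)\<^sup>2 / \<kappa>" using assms by simp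
  then show "\<bar>2 * f x\<bar> * \<bar>g x\<bar> \<le> \<kappa> * (f x)\<^sup>2 + (g x)\<^sup>2 / \<kappa>"
    using assms(2) by (simp add: power2_diff power_mult_distrib abs_mult field_simps power2_eq_square)
qed

lemma has_real_derivative_square: "((\<lambda>y::real. y\<^sup>2) has_real_derivative 2 * z) (at z)"
  by (auto intro!: derivative_eq_intros)

text \<open>Otherwise the square of \<open>f\<close> would be at least \<epsilon>^2 on a set of
  infinite length.\<close>

lemma half_line_small:
  assumes e: "H1_edge \<infinity> f g" and "0 \<le> x" "0 < \<epsilon>"
  obtains y where "x \<le> y" "\<bar>f y\<bar> < \<epsilon>"
proof (rule ccontr)
  assume "\<not> thesis"
  then have "\<forall>y. x \<le> y \<longrightarrow> \<not> \<bar>f y\<bar> < \<epsilon>" using that by blast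
  then have big: "\<epsilon> \<le> \<bar>f y\<bar>" if "x \<le> y" for y using that by auto
  define T where "T = (LINT t:{0<..}|lborel. (f t)\<^sup>2)"
  have f2: "set_integrable lborel {0<..} (\<lambda>t. (f t)\<^sup>2)"
    using e unfolding H1_edge_def einterval_0_infinity by blast
  have "real k * \<epsilon>\<^sup>2 \<le> T" for k
  proof -
    have "real k * \<epsilon>\<^sup>2 = (LINT t:{x<..<x + real k}|lborel. \<epsilon>\<^sup>2)"
      by (simp add: set_lebesgue_integral_def)
    also have "\<dots> \<le> (LINT t:{x<..<x + real k}|lborel. (f t)\<^sup>2)"
    proof (rule set_integral_mono)
      show "set_integrable lborel {x<..<x + real k} (\<lambda>t. (f t)\<^sup>2)"
        by (rule set_integrable_subset[OF f2]) (use \<open>0 \<le> x\<close> in auto)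
      show "\<epsilon>\<^sup>2 \<le> (f t)\<^sup>2" if "t \<in> {x<..<x + real k}" for t
        using big[of t] that \<open>0 < \<epsilon>\<close> by (simp add: abs_le_square_iff[symmetric])
    qed (auto simp: set_integrable_def)
    also have "\<dots> \<le> T" unfolding T_def
      by (rule set_integral_mono_set[OF f2]) (use \<open>0 \<le> x\<close> in auto)
    finally show ?thesis .
  qed
  moreover obtain k :: nat where "real k > T / \<epsilon>\<^sup>2" using reals_Archimedean2 by blast
  ultimately show False using \<open>0 < \<epsilon>\<close> by (simp add: field_simps) (meson not_le)
qed

text \<open>The end value at infinity is 0. No limit of \<open>f\<close> is needed for this: some
  point beyond \<open>x\<close> where \<open>f\<close> is small suffices, because \<Phi> is
  continuous at 0.\<close>

lemma half_line_calibration: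
  assumes e: "H1_edge \<infinity> f g" and "0 \<le> x"
    and h: "set_integrable lborel {0<..} h"
    and \<Phi>: "\<And>z. (\<Phi> has_real_derivative W z) (at z)" and W: "continuous_on UNIV W"
    and le: "\<And>x. 0 \<le> x \<Longrightarrow> \<bar>W (f x)\<bar> * \<bar>g x\<bar> \<le> h x"
  shows "\<bar>\<Phi> (f x) - \<Phi> 0\<bar> \<le> (LINT t:{x<..}|lborel. h t)"
proof (rule field_le_epsilon)
  fix \<epsilon> :: real assume "\<epsilon> > 0"
  have h0: "0 \<le> h t" if "0 < t" for t
    using le[of t] that by (meson abs_ge_zero less_imp_le mult_nonneg_nonneg order_trans)
  have "isCont \<Phi> 0" using \<Phi> by (rule DERIV_isCont)
  then obtain d where d: "d > 0" "\<And>y. \<bar>y\<bar> < d \<Longrightarrow> \<bar>\<Phi> y - \<Phi> 0\<bar> < \<epsilon>"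
    using \<open>\<epsilon> > 0\<close> unfolding continuous_at_eps_delta dist_real_def by force
  obtain y where y: "x \<le> y" "\<bar>f y\<bar> < d" using half_line_small[OF e \<open>0 \<le> x\<close> d(1)] .
  have "\<bar>\<Phi> (f y) - \<Phi> (f x)\<bar> \<le> (LINT t:{x<..<y}|lborel. h t)"
    by (rule H1_edge_calibration[OF e _ _ y(1) _ \<Phi> W])
       (use \<open>0 \<le> x\<close> y(1) h le in \<open>auto simp: cedge_infinity einterval_0_infinity\<close>)
  also have "\<dots> \<le> (LINT t:{x<..}|lborel. h t)"
    using \<open>0 \<le> x\<close> h0 by (intro set_integral_mono_set set_integrable_subset[OF h]) auto
  finally show "\<bar>\<Phi> (f x) - \<Phi> 0\<bar> \<le> (LINT t:{x<..}|lborel. h t) + \<epsilon>"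
    using d(2)[OF y(2)] by linarith
qed

lemma half_line_square_le:
  assumes e: "H1_edge \<infinity> f g" and "0 \<le> x" "0 < \<kappa>"
  shows "(f x)\<^sup>2 \<le> (LINT t:{x<..}|lborel. \<kappa> * (f t)\<^sup>2 + (g t)\<^sup>2 / \<kappa>)"
proof -
  have "\<bar>(f x)\<^sup>2 - 0\<^sup>2\<bar> \<le> (LINT t:{x<..}|lborel. \<kappa> * (f t)\<^sup>2 + (g t)\<^sup>2 / \<kappa>)"
  proof (rule half_line_calibration[OF e \<open>0 \<le> x\<close> _ has_real_derivative_square])
    show "continuous_on UNIV (\<lambda>z. 2 * z :: real)" by (intro continuous_intros)
  qed (use H1_edge_square_bound[OF e \<open>0 < \<kappa>\<close>] in \<open>auto simp only: einterval_0_infinity\<close>)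
  then show ?thesis by simp
qed

text \<open>The tail integrals tend to 0 and dominate the square of \<open>f\<close> on the tail. So
  from some point on |f| stays below its value at a chosen \<open>z\<close> with
  \<open>f z \<noteq> 0\<close>, and a compact interval remains.\<close>

lemma half_line_attains_max:
  assumes e: "H1_edge \<infinity> f g"
  obtains x0 where "0 \<le> x0" "\<And>x. 0 \<le> x \<Longrightarrow> \<bar>f x\<bar> \<le> \<bar>f x0\<bar>"
proof (cases "\<forall>x\<ge>0. f x = 0")
  case True
  then show ?thesis using that[of 0] by auto
next
  case False
  then obtain z where z: "0 \<le> z" "f z \<noteq> 0" by auto
  define h where "h t = 1 * (f t)\<^sup>2 + (g t)\<^sup>2 / 1" for t
  have h: "set_integrable lborel {0<..} h"
    using H1_edge_square_bound(1)[OF e, of 1] by (simp add: h_def[abs_def] einterval_0_infinity)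
  have "(\<lambda>n::nat. LINT t:{real n<..}|lborel. h t) \<longlonglongrightarrow> (LINT t:(\<Inter>n::nat. {real n<..})|lborel. h t)"
    by (rule set_integral_cont_down) (use h in \<open>auto simp: decseq_def\<close>)
  moreover have "(\<Inter>n::nat. {real n<..}) = {}"
  proof -
    have "\<exists>n::nat. \<not> real n < x" for x using real_arch_simple[of x] by (auto simp: not_less)
    then show ?thesis by auto
  qed
  ultimately have "(\<lambda>n::nat. LINT t:{real n<..}|lborel. h t) \<longlonglongrightarrow> 0"
    by (simp add: set_lebesgue_integral_def)
  then have "eventually (\<lambda>n. (LINT t:{real n<..}|lborel. h t) < (f z)\<^sup>2) sequentially"
    using z(2) by (intro order_tendstoD(2)) auto
  then obtain n :: nat where n: "(LINT t:{real n<..}|lborel. h t) < (f z)\<^sup>2"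
    by (meson eventually_happens' sequentially_bot)
  have tail: "\<bar>f x\<bar> \<le> \<bar>f z\<bar>" if "real n \<le> x" for x
  proof -
    have "(f x)\<^sup>2 \<le> (LINT t:{x<..}|lborel. h t)"
      using half_line_square_le[OF e, of x 1] that by (simp add: h_def[abs_def])
    also have "\<dots> \<le> (LINT t:{real n<..}|lborel. h t)"
      using that by (intro set_integral_mono_set set_integrable_subset[OF h]) (auto simp: h_def)
    finally show ?thesis using n by (simp add: abs_le_square_iff)
  qed
  define R where "R = max (real n) z"
  have R: "0 \<le> R" "z \<le> R" "real n \<le> R" using z(1) by (auto simp: R_def)
  have "continuous_on {0..R} (\<lambda>x. \<bar>f x\<bar>)"
    using e unfolding H1_edge_def cedge_infinity
    by (intro continuous_intros) (auto intro: continuous_on_subset)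
  moreover have "compact {0..R}" "{0..R} \<noteq> {}" using R by auto
  ultimately obtain x0 where x0: "x0 \<in> {0..R}" "\<And>x. x \<in> {0..R} \<Longrightarrow> \<bar>f x\<bar> \<le> \<bar>f x0\<bar>"
    using continuous_attains_sup by metis
  show ?thesis
  proof (rule that)
    show "0 \<le> x0" using x0 by auto
    fix x :: real assume "0 \<le> x"
    then show "\<bar>f x\<bar> \<le> \<bar>f x0\<bar>"
      using x0(2)[of x] x0(2)[of z] tail[of x] z(1) R by (cases "x \<le> R") auto
  qed
qed

section \<open>The potential adapted to a height, and its square root\<close>

definition cal :: "real \<Rightarrow> real \<Rightarrow> real" where
  "cal p z = sqrt (2 / p) * \<bar>z\<bar> * sqrt (max 0 (1 - \<bar>z\<bar> powr (p - 2)))"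

text \<open>The mass density times the multiplier \<open>s powr (p - 2) / p\<close>, minus the power
  density of the energy; the multiplier is the one that makes \<open>s\<close> a zero.\<close>

definition pot :: "real \<Rightarrow> real \<Rightarrow> real \<Rightarrow> real" where
  "pot p s y = (s powr (p - 2) * y\<^sup>2 - \<bar>y\<bar> powr p) / p"

lemma abs_powr_split: "2 < p \<Longrightarrow> \<bar>y\<bar> powr p = y\<^sup>2 * \<bar>y\<bar> powr (p - 2)" for y p :: real
  using powr_add[of "\<bar>y\<bar>" 2 "p - 2"] by (cases "y = 0") auto

lemma pot_eq: "2 < p \<Longrightarrow> pot p s y = y\<^sup>2 * (s powr (p - 2) - \<bar>y\<bar> powr (p - 2)) / p"
  by (simp add: pot_def abs_powr_split algebra_simps)

lemma pot_nonneg: "2 < p \<Longrightarrow> \<bar>y\<bar> \<le> s \<Longrightarrow> 0 \<le> pot p s y"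
  by (auto simp: pot_eq intro!: divide_nonneg_pos mult_nonneg_nonneg powr_mono2)

lemma pot_le: "2 < p \<Longrightarrow> pot p s y \<le> s powr (p - 2) / p * y\<^sup>2"
  by (simp add: pot_def diff_divide_distrib)

lemma cal_nonneg: "2 < p \<Longrightarrow> 0 \<le> cal p z"
  by (simp add: cal_def)

lemma continuous_on_cal [continuous_intros]:
  assumes "2 < p" "continuous_on S f"
  shows "continuous_on S (\<lambda>x. cal p (f x))"
  unfolding cal_def using assms
  by (intro continuous_intros continuous_on_powr') auto

text \<open>The primitive is not elementary, so it is only characterised by the properties used. It
  is odd because \<open>cal p\<close> is even and it is normalised at 0.\<close>

lemma cal_primitive_exists:
  assumes "2 < p"
  obtains \<Phi> where "\<And>z. (\<Phi> has_real_derivative cal p z) (at z)" "\<Phi> 0 = 0"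
    "\<And>z. \<Phi> (- z) = - \<Phi> z" "mono \<Phi>"
proof -
  have "\<exists>F. \<forall>x::real. -\<infinity> < ereal x \<longrightarrow> ereal x < \<infinity> \<longrightarrow> (F has_vector_derivative cal p x) (at x)"
  proof (rule einterval_antiderivative)
    show "isCont (cal p) x" for x
      using continuous_on_cal[OF assms continuous_on_id, of UNIV] by (simp add: continuous_on_eq_continuous_at)
  qed auto
  then obtain F where F: "\<And>x. (F has_real_derivative cal p x) (at x)"
    by (auto simp: has_real_derivative_iff_has_vector_derivative)
  define \<Phi> where "\<Phi> z = F z - F 0" for z
  have d: "(\<Phi> has_real_derivative cal p z) (at z)" for z
    unfolding \<Phi>_def[abs_def] by (auto intro!: derivative_eq_intros F)
  have odd: "\<Phi> (- z) = - \<Phi> z" for z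
  proof -
    have "((\<lambda>z. \<Phi> z + \<Phi> (- z)) has_real_derivative 0) (at z)" for z
      by (auto intro!: derivative_eq_intros DERIV_chain2[OF d] d simp: cal_def)
    then have "\<Phi> z + \<Phi> (- z) = \<Phi> 0 + \<Phi> (- 0)" by (intro DERIV_isconst_all[of "\<lambda>z. \<Phi> z + \<Phi> (- z)"]) auto
    then show ?thesis by (simp add: \<Phi>_def)
  qed
  have "mono \<Phi>"
  proof (rule monoI)
    fix x y :: real assume "x \<le> y"
    then show "\<Phi> x \<le> \<Phi> y"
      by (rule DERIV_nonneg_imp_nondecreasing) (use d cal_nonneg[OF assms] in blast)
  qed
  with d odd show ?thesis using that[of \<Phi>] by (simp add: \<Phi>_def)
qed

text \<open>On \<open>[-1, 1]\<close> the function \<open>cal p\<close> is the square root of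
  \<open>2 * pot p 1\<close>, extended by 0. The potential of height \<open>s\<close> is a rescaling
  of the one of height 1, so that a single primitive \<Phi> serves all heights.\<close>

lemma cal_scaled_square:
  assumes "2 < p" "0 < s" "\<bar>y\<bar> \<le> s"
  shows "(s powr (p / 2) * cal p (y / s))\<^sup>2 = 2 * pot p s y"
proof -
  have le: "\<bar>y / s\<bar> powr (p - 2) \<le> 1"
    using assms powr_mono2[of "p - 2" "\<bar>y / s\<bar>" 1] by auto
  have "(s powr (p / 2))\<^sup>2 = s powr p"
    using assms by (simp add: power2_eq_square flip: powr_add)
  then have "(s powr (p / 2) * cal p (y / s))\<^sup>2 = s powr p * (2 / p * (y / s)\<^sup>2 * (1 - \<bar>y / s\<bar> powr (p - 2)))"
    using assms le by (simp add: cal_def power_mult_distrib real_sqrt_pow2 del: abs_divide)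
  also have "\<bar>y / s\<bar> powr (p - 2) = \<bar>y\<bar> powr (p - 2) / s powr (p - 2)"
    using assms by (simp add: powr_divide)
  also have "s powr p = s\<^sup>2 * s powr (p - 2)"
    using abs_powr_split[OF assms(1), of s] assms by simp
  also have "s\<^sup>2 * s powr (p - 2) * (2 / p * (y / s)\<^sup>2 * (1 - \<bar>y\<bar> powr (p - 2) / s powr (p - 2)))
      = 2 * pot p s y"
    using assms by (simp add: pot_eq field_simps)
  finally show ?thesis .
qed

text \<open>The Modica-Mortola inequality: \<open>a * b \<le> (a\<^sup>2 + b\<^sup>2) / 2\<close>
  with \<open>a\<close> the square root of twice the potential. It is the hypothesis that the
  calibrations require.\<close>

lemma cal_scaled_le:
  assumes "2 < p" "0 < s" "\<bar>y\<bar> \<le> s"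
  shows "\<bar>s powr (p / 2) * cal p (y / s)\<bar> * \<bar>b\<bar> \<le> b\<^sup>2 / 2 + pot p s y"
proof -
  have "2 * (\<bar>s powr (p / 2) * cal p (y / s)\<bar> * \<bar>b\<bar>) \<le> (s powr (p / 2) * cal p (y / s))\<^sup>2 + b\<^sup>2"
    using sum_squares_bound[of "\<bar>s powr (p / 2) * cal p (y / s)\<bar>" "\<bar>b\<bar>"] by simp
  then show ?thesis using cal_scaled_square[OF assms] by simp
qed

lemma continuous_on_cal_scaled:
  "2 < p \<Longrightarrow> continuous_on UNIV (\<lambda>y. s powr (p / 2) * cal p (y / s))"
  unfolding divide_inverse by (intro continuous_intros)

lemma has_real_derivative_scaled:
  assumes "2 < p" "0 < s" and \<Phi>: "\<And>z. (\<Phi> has_real_derivative cal p z) (at z)"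
  shows "((\<lambda>y. s powr (p / 2 + 1) * \<Phi> (y / s)) has_real_derivative s powr (p / 2) * cal p (z / s)) (at z)"
proof -
  have "((\<lambda>y. s powr (p / 2 + 1) * \<Phi> (y / s)) has_real_derivative s powr (p / 2 + 1) * (cal p (z / s) * (1 / s))) (at z)"
    using assms(2) by (intro DERIV_cmult DERIV_chain2[OF \<Phi>]) (auto intro!: derivative_eq_intros)
  then show ?thesis using assms(2) by (simp add: powr_add)
qed

text \<open>The power is dominated by \<open>s powr (p - 2)\<close> times the square; boundedness
  alone would not do on a half-line.\<close>

lemma H1_edge_powr_integrable:
  assumes e: "H1_edge L f g" and bd: "\<And>x. x \<in> cedge L \<Longrightarrow> \<bar>f x\<bar> \<le> s" and "2 < p"
  shows "set_integrable lborel (einterval 0 L) (\<lambda>x. \<bar>f x\<bar> powr p)"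
proof -
  have sub: "einterval 0 L \<subseteq> cedge L" by (auto simp: cedge_def einterval_def zero_ereal_def)
  have "set_integrable lborel (einterval 0 L) (\<lambda>x. s powr (p - 2) * (f x)\<^sup>2)"
    using e unfolding H1_edge_def by auto
  then show ?thesis
  proof (rule set_integrable_bound)
    have "continuous_on (einterval 0 L) (\<lambda>x. \<bar>f x\<bar> powr p)"
      using e sub \<open>2 < p\<close> unfolding H1_edge_def
      by (intro continuous_on_powr' continuous_intros) (auto intro: continuous_on_subset)
    then show "set_borel_measurable lborel (einterval 0 L) (\<lambda>x. \<bar>f x\<bar> powr p)"
      unfolding set_borel_measurable_def
      using borel_measurable_continuous_on_indicator[of "einterval 0 L" "\<lambda>x. \<bar>f x\<bar> powr p"] by simp
    show "AE x in lborel. x \<in> einterval 0 L \<longrightarrow> norm (\<bar>f x\<bar> powr p) \<le> norm (s powr (p - 2) * (f x)\<^sup>2)"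
    proof (rule AE_I2, rule impI)
      fix x assume "x \<in> einterval 0 L"
      then have "\<bar>f x\<bar> \<le> s" using bd sub by auto
      then have "\<bar>f x\<bar> powr (p - 2) \<le> s powr (p - 2)" using \<open>2 < p\<close> by (intro powr_mono2) auto
      then show "norm (\<bar>f x\<bar> powr p) \<le> norm (s powr (p - 2) * (f x)\<^sup>2)"
        using \<open>2 < p\<close> by (simp add: abs_powr_split abs_mult mult_mono mult.commute)
    qed
  qed
qed

lemma H1_edge_action_integrable:
  assumes e: "H1_edge L f g" and bd: "\<And>x. x \<in> cedge L \<Longrightarrow> \<bar>f x\<bar> \<le> s" and "2 < p"
  shows "set_integrable lborel (einterval 0 L) (\<lambda>x. (g x)\<^sup>2 / 2 + pot p s (f x))"
  unfolding pot_def using e H1_edge_powr_integrable[OF assms]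
  by (intro set_integral_add set_integral_diff set_integrable_divide) (auto simp: H1_edge_def)

section \<open>The action on one edge\<close>

lemma einterval_subset_cedge: "einterval 0 L \<subseteq> cedge L"
  by (auto simp: cedge_def einterval_def zero_ereal_def)

lemma set_integral_nonneg:
  "(\<And>x. x \<in> A \<Longrightarrow> 0 \<le> (f x :: real)) \<Longrightarrow> 0 \<le> (LINT x:A|M. f x)"
  unfolding set_lebesgue_integral_def
  by (intro Bochner_Integration.integral_nonneg) (auto simp: indicator_def)

definition action :: "real \<Rightarrow> ereal \<Rightarrow> real \<Rightarrow> (real \<Rightarrow> real) \<Rightarrow> (real \<Rightarrow> real) \<Rightarrow> real" where
  "action p L s f g = (LINT x:einterval 0 L|lborel. (g x)\<^sup>2 / 2 + pot p s (f x))"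

context
  fixes p :: real and \<Phi> :: "real \<Rightarrow> real"
  assumes p: "2 < p"
    and \<Phi>: "\<And>z. (\<Phi> has_real_derivative cal p z) (at z)" "\<Phi> 0 = 0"
      "\<And>z. \<Phi> (- z) = - \<Phi> z" "mono \<Phi>"
begin

text \<open>The \<Psi> of the overview at height \<open>s\<close>: the least action of a passage
  from 0 to \<open>y\<close> is bounded below by its value at |y|.\<close>

definition Psi :: "real \<Rightarrow> real \<Rightarrow> real" where
  "Psi s y = s powr (p / 2 + 1) * \<Phi> (y / s)"

lemma Psi_derivative:
  "0 < s \<Longrightarrow> (Psi s has_real_derivative s powr (p / 2) * cal p (z / s)) (at z)"
  unfolding Psi_def[abs_def] using has_real_derivative_scaled[OF p _ \<Phi>(1)] by simp

lemma Psi_0: "Psi s 0 = 0"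
  by (simp add: Psi_def \<Phi>)

lemma Psi_self: "0 < s \<Longrightarrow> Psi s s = s powr (p / 2 + 1) * \<Phi> 1"
  by (simp add: Psi_def)

lemma Psi_nonneg: "0 < s \<Longrightarrow> 0 \<le> y \<Longrightarrow> 0 \<le> Psi s y"
  using monoD[OF \<Phi>(4), of 0 "y / s"] by (simp add: Psi_def \<Phi>)

lemma abs_Psi: "0 < s \<Longrightarrow> \<bar>Psi s y\<bar> = Psi s \<bar>y\<bar>"
proof (cases "0 \<le> y")
  case False
  moreover assume "0 < s"
  ultimately show ?thesis using Psi_nonneg[of s "-y"] \<Phi>(3)[of "y / s"]
    by (simp add: Psi_def)
qed (auto simp: Psi_nonneg)

text \<open>Since \<Psi> is odd, a change of sign can only increase the cost, and it is enough to
  follow |f|.\<close>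

lemma Psi_diff_le: "0 < s \<Longrightarrow> Psi s \<bar>x\<bar> - Psi s \<bar>y\<bar> \<le> \<bar>Psi s x - Psi s y\<bar>"
  using abs_Psi[of s x] abs_Psi[of s y] by linarith

context
  fixes L :: ereal and f g :: "real \<Rightarrow> real" and s :: real
  assumes e: "H1_edge L f g" and bd: "\<And>x. x \<in> cedge L \<Longrightarrow> \<bar>f x\<bar> \<le> s" and s: "0 < s"
begin

lemma action_integrable: "set_integrable lborel (einterval 0 L) (\<lambda>x. (g x)\<^sup>2 / 2 + pot p s (f x))"
  by (rule H1_edge_action_integrable[OF e bd p])

lemma action_density_nonneg: "x \<in> cedge L \<Longrightarrow> 0 \<le> (g x)\<^sup>2 / 2 + pot p s (f x)"
  using pot_nonneg[OF p bd] by (simp add: add_nonneg_nonneg)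

lemma action_nonneg: "0 \<le> action p L s f g"
  unfolding action_def using action_density_nonneg einterval_subset_cedge[of L]
  by (intro set_integral_nonneg) auto

lemma action_split:
  assumes "A \<in> sets borel" "B \<in> sets borel" "A \<inter> B = {}" "A \<union> B \<subseteq> einterval 0 L"
  shows "(LINT t:A|lborel. (g t)\<^sup>2 / 2 + pot p s (f t)) + (LINT t:B|lborel. (g t)\<^sup>2 / 2 + pot p s (f t))
    \<le> action p L s f g"
  unfolding action_def
proof (rule set_integral_mono_Un[OF action_integrable])
  show "0 \<le> (g x)\<^sup>2 / 2 + pot p s (f x)" if "x \<in> einterval 0 L" for x
    using that einterval_subset_cedge by (intro action_density_nonneg) blast
qed (use assms in simp_all)

lemma Psi_diff_le_action:
  assumes "x \<in> cedge L" "y \<in> cedge L" "x \<le> y"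
  shows "\<bar>Psi s (f y) - Psi s (f x)\<bar> \<le> (LINT t:{x<..<y}|lborel. (g t)\<^sup>2 / 2 + pot p s (f t))"
  by (rule H1_edge_calibration[OF e assms action_integrable Psi_derivative[OF s] continuous_on_cal_scaled[OF p]
      cal_scaled_le[OF p s bd]])

text \<open>A loop that contains the maximum point makes two passages between |f 0| and
  \<open>s\<close>, one on each side of \<open>x0\<close>.\<close>

lemma loop_action_ge:
  assumes "L = ereal l" "f l = f 0" "x0 \<in> {0..l}" "\<bar>f x0\<bar> = s"
  shows "2 * (Psi s s - Psi s \<bar>f 0\<bar>) \<le> action p L s f g"
proof -
  let ?h = "\<lambda>t. (g t)\<^sup>2 / 2 + pot p s (f t)"
  have "Psi s s - Psi s \<bar>f 0\<bar> \<le> (LINT t:{0<..<x0}|lborel. ?h t)"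
    using Psi_diff_le_action[of 0 x0] Psi_diff_le[OF s, of "f x0" "f 0"] assms
    by (simp add: cedge_ereal)
  moreover have "Psi s s - Psi s \<bar>f 0\<bar> \<le> (LINT t:{x0<..<l}|lborel. ?h t)"
    using Psi_diff_le_action[of x0 l] Psi_diff_le[OF s, of "f x0" "f l"] assms
    by (simp add: cedge_ereal abs_minus_commute)
  moreover have "(LINT t:{0<..<x0}|lborel. ?h t) + (LINT t:{x0<..<l}|lborel. ?h t) \<le> action p L s f g"
    using assms by (intro action_split) (auto simp: einterval_0_ereal)
  ultimately show ?thesis unfolding mult_2 by (meson add_mono order_trans)
qed

lemma Psi_less_action_from_zero:
  assumes b: "b \<in> cedge L" and f0: "f 0 = 0" and fb: "\<bar>f b\<bar> = s"
  shows "Psi s s < (LINT t:{0<..<b}|lborel. (g t)\<^sup>2 / 2 + pot p s (f t))"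
proof (rule ccontr)
  assume "\<not> ?thesis"
  then have le: "(LINT t:{0<..<b}|lborel. (g t)\<^sup>2 / 2 + pot p s (f t)) \<le> Psi s s" by simp
  define w where "w x = s powr (p / 2) * cal p (f x / s)" for x
  have "0 \<le> b" "ereal b \<le> L" using b by (auto simp: cedge_def)
  then have b0: "0 \<le> b" "0 \<in> cedge L"
    using order_trans[of "ereal 0" "ereal b" L] by (auto simp: cedge_def)
  have sub: "{0<..<b} \<subseteq> einterval 0 L" using b b0 by (intro Ioo_subset_einterval)
  have w0: "0 \<le> w x" for x unfolding w_def using cal_nonneg[OF p] by simp
  have wle: "w x * \<bar>g x\<bar> \<le> (g x)\<^sup>2 / 2 + pot p s (f x)" if "x \<in> cedge L" for x
    using cal_scaled_le[OF p s bd[OF that], of "g x"] w0[of x] unfolding w_def by simp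
  \<comment> \<open>Measurability of the product is checked on extensions by 0, because
    \<open>f\<close> and \<open>g\<close> are controlled on the edge only.\<close>
  have wint: "set_integrable lborel (einterval 0 L) (\<lambda>x. w x * \<bar>g x\<bar>)"
  proof (rule set_integrable_bound[OF action_integrable])
    have "continuous_on (einterval 0 L) w"
      unfolding w_def[abs_def] divide_inverse using e einterval_subset_cedge[of L] p unfolding H1_edge_def
      by (intro continuous_intros) (auto intro: continuous_on_subset)
    then have "(\<lambda>x. indicator (einterval 0 L) x *\<^sub>R w x) \<in> borel_measurable borel"
      by (intro borel_measurable_continuous_on_indicator) auto
    then have "(\<lambda>x. (indicator (einterval 0 L) x *\<^sub>R w x) * \<bar>indicator (einterval 0 L) x *\<^sub>R g x\<bar>) \<in> borel_measurable lborel"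
      using e unfolding H1_edge_def set_borel_measurable_def by (intro borel_measurable_times borel_measurable_abs) auto
    also have "(\<lambda>x. (indicator (einterval 0 L) x *\<^sub>R w x) * \<bar>indicator (einterval 0 L) x *\<^sub>R g x\<bar>)
        = (\<lambda>x. indicator (einterval 0 L) x *\<^sub>R (w x * \<bar>g x\<bar>))"
      by (auto simp: indicator_def)
    finally show "set_borel_measurable lborel (einterval 0 L) (\<lambda>x. w x * \<bar>g x\<bar>)"
      by (simp add: set_borel_measurable_def)
    show "AE x in lborel. x \<in> einterval 0 L \<longrightarrow> norm (w x * \<bar>g x\<bar>) \<le> norm ((g x)\<^sup>2 / 2 + pot p s (f x))"
      using wle w0 action_density_nonneg einterval_subset_cedge[of L] by (intro AE_I2) (auto simp: abs_mult)
  qed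
  \<comment> \<open>The calibration also works with the smaller density
    \<open>w * \<bar>g\<bar>\<close>. With the assumption of the contradiction, both densities have
    the same integral.\<close>
  have "Psi s s \<le> \<bar>Psi s (f b) - Psi s (f 0)\<bar>"
    using Psi_diff_le[OF s, of "f b" "f 0"] by (simp add: f0 fb Psi_0)
  also have "\<dots> \<le> (LINT t:{0<..<b}|lborel. w t * \<bar>g t\<bar>)"
  proof (rule H1_edge_calibration[OF e b0(2) b b0(1) wint Psi_derivative[OF s] continuous_on_cal_scaled[OF p]])
    show "\<bar>s powr (p / 2) * cal p (f x / s)\<bar> * \<bar>g x\<bar> \<le> w x * \<bar>g x\<bar>" for x
      using w0[of x] unfolding w_def by simp
  qed
  finally have ge: "Psi s s \<le> (LINT t:{0<..<b}|lborel. w t * \<bar>g t\<bar>)" .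
  have i1: "set_integrable lborel {0<..<b} (\<lambda>x. (g x)\<^sup>2 / 2 + pot p s (f x))"
    by (rule set_integrable_subset[OF action_integrable _ sub]) auto
  have i2: "set_integrable lborel {0<..<b} (\<lambda>x. w x * \<bar>g x\<bar>)"
    by (rule set_integrable_subset[OF wint _ sub]) auto
  \<comment> \<open>The gap between the two densities is half a perfect square, so its vanishing
    integral forces |g| = w almost everywhere.\<close>
  define k where "k x = (g x)\<^sup>2 / 2 + pot p s (f x) - w x * \<bar>g x\<bar>" for x
  have ik: "set_integrable lborel {0<..<b} k"
    unfolding k_def[abs_def] by (rule set_integral_diff(1)[OF i1 i2])
  have k: "k x = (\<bar>g x\<bar> - w x)\<^sup>2 / 2" if "x \<in> {0<..<b}" for x
  proof -
    have "x \<in> cedge L" using that sub einterval_subset_cedge[of L] by auto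
    then have "(w x)\<^sup>2 = 2 * pot p s (f x)" unfolding w_def using cal_scaled_square[OF p s bd] by blast
    then show ?thesis by (simp add: k_def power2_diff)
  qed
  have "(LINT t:{0<..<b}|lborel. k t) = (LINT t:{0<..<b}|lborel. (g t)\<^sup>2 / 2 + pot p s (f t)) - (LINT t:{0<..<b}|lborel. w t * \<bar>g t\<bar>)"
    unfolding k_def[abs_def] by (rule set_integral_diff(2)[OF i1 i2])
  then have "(LINT t:{0<..<b}|lborel. k t) \<le> 0" using le ge by linarith
  moreover have "0 \<le> (LINT t:{0<..<b}|lborel. k t)" by (rule set_integral_nonneg) (simp add: k)
  ultimately have "(LINT t|lborel. indicator {0<..<b} t * k t) = 0"
    by (simp add: set_lebesgue_integral_def)
  moreover have "integrable lborel (\<lambda>t. indicator {0<..<b} t * k t)"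
    using ik by (simp add: set_integrable_def)
  moreover have "AE t in lborel. 0 \<le> indicator {0<..<b} t * k t"
    by (intro AE_I2) (auto simp: indicator_def k)
  ultimately have "AE t in lborel. indicator {0<..<b} t * k t = 0"
    by (subst (asm) integral_nonneg_eq_0_iff_AE) auto
  then have gw: "AE t in lborel. t \<in> {0<..<b} \<longrightarrow> \<bar>g t\<bar> = w t"
    by (rule AE_mp) (auto simp: indicator_def k)
  define c where "c = sqrt (2 * (s powr (p - 2) / p))"
  have c: "0 \<le> c" using p by (simp add: c_def)
  have wc: "w x \<le> c * \<bar>f x\<bar>" if "x \<in> cedge L" for x
  proof -
    have "(w x)\<^sup>2 = 2 * pot p s (f x)" unfolding w_def using cal_scaled_square[OF p s bd] that by blast
    also have "\<dots> \<le> 2 * (s powr (p - 2) / p * (f x)\<^sup>2)" using pot_le[OF p] by (intro mult_left_mono) auto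
    also have "\<dots> = (c * \<bar>f x\<bar>)\<^sup>2" using p by (simp add: c_def power_mult_distrib)
    finally show ?thesis by (rule power2_le_imp_le) (simp add: c)
  qed
  \<comment> \<open>Now \<open>\<bar>g\<bar> \<le> c \<bar>f\<bar>\<close> almost everywhere, so \<open>ln (\<epsilon>\<^sup>2 + f\<^sup>2)\<close> is Lipschitz with a constant independent of \<open>\<epsilon>\<close>,
    although it grows from \<open>ln (\<epsilon>\<^sup>2)\<close> to at least \<open>ln (s\<^sup>2)\<close>.\<close>
  define \<epsilon> where "\<epsilon> = s * exp (- (c * b + 1))"
  have \<epsilon>: "0 < \<epsilon>" using s by (simp add: \<epsilon>_def)
  have "\<bar>ln (\<epsilon>\<^sup>2 + (f b)\<^sup>2) - ln (\<epsilon>\<^sup>2 + (f 0)\<^sup>2)\<bar> \<le> (LINT t:{0<..<b}|lborel. \<bar>2 * f t / (\<epsilon>\<^sup>2 + (f t)\<^sup>2)\<bar> * \<bar>g t\<bar>)"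
  proof (rule H1_edge_calibration[OF e b0(2) b b0(1), where \<Phi> = "\<lambda>y. ln (\<epsilon>\<^sup>2 + y\<^sup>2)" and W = "\<lambda>y. 2 * y / (\<epsilon>\<^sup>2 + y\<^sup>2)"])
    have pos: "0 < \<epsilon>\<^sup>2 + y\<^sup>2" for y using \<epsilon> by (intro add_pos_nonneg) auto
    show "((\<lambda>y. ln (\<epsilon>\<^sup>2 + y\<^sup>2)) has_real_derivative 2 * z / (\<epsilon>\<^sup>2 + z\<^sup>2)) (at z)" for z
      using pos[of z] by (auto intro!: derivative_eq_intros)
    show "continuous_on UNIV (\<lambda>y. 2 * y / (\<epsilon>\<^sup>2 + y\<^sup>2))"
      using pos by (intro continuous_intros) (auto simp: less_imp_neq[symmetric])
    have bound: "\<bar>2 * f x / (\<epsilon>\<^sup>2 + (f x)\<^sup>2)\<bar> * \<bar>g x\<bar> \<le> (1 * (f x)\<^sup>2 + (g x)\<^sup>2 / 1) / \<epsilon>\<^sup>2" for x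
    proof -
      have "\<bar>2 * f x / (\<epsilon>\<^sup>2 + (f x)\<^sup>2)\<bar> * \<bar>g x\<bar> = (\<bar>2 * f x\<bar> * \<bar>g x\<bar>) / (\<epsilon>\<^sup>2 + (f x)\<^sup>2)"
        using pos[of "f x"] by (simp add: abs_mult)
      also have "\<dots> \<le> (\<bar>2 * f x\<bar> * \<bar>g x\<bar>) / \<epsilon>\<^sup>2" using \<epsilon> pos by (intro divide_left_mono mult_pos_pos) auto
      also have "\<dots> \<le> (1 * (f x)\<^sup>2 + (g x)\<^sup>2 / 1) / \<epsilon>\<^sup>2"
        using H1_edge_square_bound(2)[OF e, of 1] \<epsilon> by (intro divide_right_mono) auto
      finally show ?thesis .
    qed
    show "set_integrable lborel (einterval 0 L) (\<lambda>t. \<bar>2 * f t / (\<epsilon>\<^sup>2 + (f t)\<^sup>2)\<bar> * \<bar>g t\<bar>)"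
    proof (rule set_integrable_bound)
      show "set_integrable lborel (einterval 0 L) (\<lambda>x. (1 * (f x)\<^sup>2 + (g x)\<^sup>2 / 1) / \<epsilon>\<^sup>2)"
        using H1_edge_square_bound(1)[OF e, of 1] by (intro set_integrable_divide) auto
      have "continuous_on (einterval 0 L) (\<lambda>t. \<bar>2 * f t / (\<epsilon>\<^sup>2 + (f t)\<^sup>2)\<bar>)"
        using e einterval_subset_cedge[of L] pos unfolding H1_edge_def
        by (intro continuous_intros) (auto intro: continuous_on_subset simp: less_imp_neq[symmetric])
      then have "(\<lambda>x. indicator (einterval 0 L) x *\<^sub>R \<bar>2 * f x / (\<epsilon>\<^sup>2 + (f x)\<^sup>2)\<bar>) \<in> borel_measurable borel"
        by (intro borel_measurable_continuous_on_indicator) auto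
      then have "(\<lambda>x. (indicator (einterval 0 L) x *\<^sub>R \<bar>2 * f x / (\<epsilon>\<^sup>2 + (f x)\<^sup>2)\<bar>) * \<bar>indicator (einterval 0 L) x *\<^sub>R g x\<bar>) \<in> borel_measurable lborel"
        using e unfolding H1_edge_def set_borel_measurable_def by (intro borel_measurable_times borel_measurable_abs) auto
      also have "(\<lambda>x. (indicator (einterval 0 L) x *\<^sub>R \<bar>2 * f x / (\<epsilon>\<^sup>2 + (f x)\<^sup>2)\<bar>) * \<bar>indicator (einterval 0 L) x *\<^sub>R g x\<bar>)
          = (\<lambda>x. indicator (einterval 0 L) x *\<^sub>R (\<bar>2 * f x / (\<epsilon>\<^sup>2 + (f x)\<^sup>2)\<bar> * \<bar>g x\<bar>))"
        by (auto simp: indicator_def)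
      finally show "set_borel_measurable lborel (einterval 0 L) (\<lambda>x. \<bar>2 * f x / (\<epsilon>\<^sup>2 + (f x)\<^sup>2)\<bar> * \<bar>g x\<bar>)"
        by (simp add: set_borel_measurable_def)
      show "AE x in lborel. x \<in> einterval 0 L \<longrightarrow> norm (\<bar>2 * f x / (\<epsilon>\<^sup>2 + (f x)\<^sup>2)\<bar> * \<bar>g x\<bar>)
          \<le> norm ((1 * (f x)\<^sup>2 + (g x)\<^sup>2 / 1) / \<epsilon>\<^sup>2)"
        using bound by (intro AE_I2) (simp add: abs_mult)
    qed
  qed auto
  also have "\<dots> \<le> (LINT t:{0<..<b}|lborel. 2 * c)"
  proof (cases "set_integrable lborel {0<..<b} (\<lambda>t. \<bar>2 * f t / (\<epsilon>\<^sup>2 + (f t)\<^sup>2)\<bar> * \<bar>g t\<bar>)")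
    \<comment> \<open>The integral of a non-integrable function is 0 by convention, which makes the
      bound trivial.\<close>
    case False
    then show ?thesis using c
      by (simp add: set_integrable_def set_lebesgue_integral_def not_integrable_integral_eq)
  next
    case True
    then show ?thesis
    proof (rule set_integral_mono_AE)
      show "set_integrable lborel {0<..<b} (\<lambda>x. 2 * c)" using b0 by (auto simp: set_integrable_def)
      show "AE t\<in>{0<..<b} in lborel. \<bar>2 * f t / (\<epsilon>\<^sup>2 + (f t)\<^sup>2)\<bar> * \<bar>g t\<bar> \<le> 2 * c"
        using gw
      proof (rule AE_mp, intro AE_I2 impI)
        fix t assume t: "t \<in> {0<..<b} \<longrightarrow> \<bar>g t\<bar> = w t" "t \<in> {0<..<b}"
        have pos: "0 < \<epsilon>\<^sup>2 + (f t)\<^sup>2" using \<epsilon> by (intro add_pos_nonneg) auto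
        have "t \<in> cedge L" using t sub einterval_subset_cedge[of L] by auto
        then have "\<bar>g t\<bar> \<le> c * \<bar>f t\<bar>" using wc t by auto
        then have "\<bar>2 * f t / (\<epsilon>\<^sup>2 + (f t)\<^sup>2)\<bar> * \<bar>g t\<bar> \<le> \<bar>2 * f t / (\<epsilon>\<^sup>2 + (f t)\<^sup>2)\<bar> * (c * \<bar>f t\<bar>)"
          by (intro mult_left_mono) auto
        also have "\<dots> = 2 * c * ((f t)\<^sup>2 / (\<epsilon>\<^sup>2 + (f t)\<^sup>2))"
          using pos by (simp add: abs_mult power2_eq_square)
        also have "\<dots> \<le> 2 * c * 1" using pos c \<epsilon> by (intro mult_left_mono) (auto simp: divide_le_eq)
        finally show "\<bar>2 * f t / (\<epsilon>\<^sup>2 + (f t)\<^sup>2)\<bar> * \<bar>g t\<bar> \<le> 2 * c" by simp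
      qed
    qed
  qed
  also have "\<dots> = 2 * c * b" using b0 by (simp add: set_lebesgue_integral_def)
  finally have "ln (\<epsilon>\<^sup>2 + s\<^sup>2) - ln (\<epsilon>\<^sup>2) \<le> 2 * c * b"
    using fb f0 by (simp add: fb[symmetric])
  moreover have "ln (s\<^sup>2) \<le> ln (\<epsilon>\<^sup>2 + s\<^sup>2)" using s by (intro ln_mono) auto
  moreover have "ln (\<epsilon>\<^sup>2) = ln (s\<^sup>2) - 2 * (c * b + 1)"
    using s by (simp add: \<epsilon>_def power2_eq_square ln_mult)
  ultimately show False by simp
qed

lemma loop_action_greater:
  assumes "L = ereal l" "f l = f 0" "x0 \<in> {0..l}" "\<bar>f x0\<bar> = s" "f 0 = 0"
  shows "2 * Psi s s < action p L s f g"
proof -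
  let ?h = "\<lambda>t. (g t)\<^sup>2 / 2 + pot p s (f t)"
  have "Psi s s < (LINT t:{0<..<x0}|lborel. ?h t)"
    using Psi_less_action_from_zero[of x0] assms by (simp add: cedge_ereal)
  moreover have "Psi s s \<le> (LINT t:{x0<..<l}|lborel. ?h t)"
    using Psi_diff_le_action[of x0 l] Psi_diff_le[OF s, of "f x0" "f l"] assms
    by (simp add: cedge_ereal abs_minus_commute Psi_0)
  moreover have "(LINT t:{0<..<x0}|lborel. ?h t) + (LINT t:{x0<..<l}|lborel. ?h t) \<le> action p L s f g"
    using assms by (intro action_split) (auto simp: einterval_0_ereal)
  ultimately show ?thesis by linarith
qed

lemma half_line_Psi_le:
  assumes "L = \<infinity>" "0 \<le> x"
  shows "Psi s \<bar>f x\<bar> \<le> (LINT t:{x<..}|lborel. (g t)\<^sup>2 / 2 + pot p s (f t))"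
proof -
  have "\<bar>Psi s (f x) - Psi s 0\<bar> \<le> (LINT t:{x<..}|lborel. (g t)\<^sup>2 / 2 + pot p s (f t))"
  proof (rule half_line_calibration[OF _ assms(2) _ Psi_derivative[OF s] continuous_on_cal_scaled[OF p]])
    show "H1_edge \<infinity> f g" using e assms by simp
    show "set_integrable lborel {0<..} (\<lambda>t. (g t)\<^sup>2 / 2 + pot p s (f t))"
      using action_integrable assms by (simp add: einterval_0_infinity)
    show "\<bar>s powr (p / 2) * cal p (f x / s)\<bar> * \<bar>g x\<bar> \<le> (g x)\<^sup>2 / 2 + pot p s (f x)" if "0 \<le> x" for x
      using that by (intro cal_scaled_le[OF p s bd]) (simp add: cedge_infinity assms)
  qed
  then show ?thesis using abs_Psi[OF s] by (simp add: Psi_0)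
qed

lemma half_line_action_ge:
  assumes "L = \<infinity>"
  shows "Psi s \<bar>f 0\<bar> \<le> action p L s f g"
  using half_line_Psi_le[OF assms order_refl] by (simp add: action_def assms einterval_0_infinity)

lemma half_line_action_split:
  assumes "L = \<infinity>" "0 \<le> x0" "\<bar>f x0\<bar> = s"
  shows "(LINT t:{0<..<x0}|lborel. (g t)\<^sup>2 / 2 + pot p s (f t)) + Psi s s \<le> action p L s f g"
proof -
  have "(LINT t:{0<..<x0}|lborel. (g t)\<^sup>2 / 2 + pot p s (f t)) +
      (LINT t:{x0<..}|lborel. (g t)\<^sup>2 / 2 + pot p s (f t)) \<le> action p L s f g"
    using assms by (intro action_split) (auto simp: einterval_0_infinity)
  then show ?thesis using half_line_Psi_le[of x0] assms by simp
qed

text \<open>One passage from |f 0| up to \<open>s\<close>, then a full descent from \<open>s\<close>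
  to 0 at infinity.\<close>

lemma half_line_action_max_ge:
  assumes "L = \<infinity>" "0 \<le> x0" "\<bar>f x0\<bar> = s"
  shows "2 * Psi s s - Psi s \<bar>f 0\<bar> \<le> action p L s f g"
  using half_line_action_split[OF assms] Psi_diff_le_action[of 0 x0] Psi_diff_le[OF s, of "f x0" "f 0"] assms
  by (simp add: cedge_infinity)

lemma half_line_action_greater:
  assumes "L = \<infinity>" "0 \<le> x0" "\<bar>f x0\<bar> = s" "f 0 = 0"
  shows "2 * Psi s s < action p L s f g"
  using half_line_action_split[OF assms(1-3)] Psi_less_action_from_zero[of x0] assms
  by (simp add: cedge_infinity)

text \<open>A dichotomy. If |f| drops to half of |f 0| somewhere, the kinetic energy pays for a drop
  over a length of at most \<open>l\<close>. Otherwise |f| exceeds half of |f 0| throughout; the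
  mass bound confines |f| \<ge> s1 / 2 to at most half of the loop, because
  \<open>4 * M / s1\<^sup>2 = l / 2\<close>, and on the rest the potential is at least a fixed
  multiple of the square of \<open>f\<close>. The constant is the smaller of the two costs and does
  not depend on \<open>s\<close>.\<close>

lemma extra_loop_action_ge:
  assumes L: "L = ereal l" and "0 < s1" "s1 \<le> s" and l: "l = 8 * M / s1\<^sup>2" "0 < M"
    and mass: "(LINT x:{0<..<l}|lborel. (f x)\<^sup>2) \<le> M" and "f 0 \<noteq> 0"
  shows "min (1 / (8 * l)) (s1 powr (p - 2) * (1 - (1/2) powr (p - 2)) / p * l / 8) * (f 0)\<^sup>2 \<le> action p L s f g"
proof -
  define t where "t = \<bar>f 0\<bar>"
  have t: "0 < t" "(f 0)\<^sup>2 = t\<^sup>2" using \<open>f 0 \<noteq> 0\<close> by (auto simp: t_def)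
  have "0 < l" using l \<open>0 < s1\<close> by simp
  define \<kappa> where "\<kappa> = s1 powr (p - 2) * (1 - (1/2) powr (p - 2)) / p"
  have half: "(1/2) powr (p - 2) \<le> (1::real)" using p by (intro powr_le1) auto
  have \<kappa>: "0 \<le> \<kappa>" unfolding \<kappa>_def using p half by (intro divide_nonneg_pos mult_nonneg_nonneg) auto
  have f2: "set_integrable lborel {0<..<l} (\<lambda>x. (f x)\<^sup>2)" and g2: "set_integrable lborel {0<..<l} (\<lambda>x. (g x)\<^sup>2)"
    using e unfolding H1_edge_def L einterval_0_ereal by auto
  have p2: "set_integrable lborel {0<..<l} (\<lambda>x. pot p s (f x))"
    using H1_edge_powr_integrable[OF e bd p] f2 unfolding pot_def L einterval_0_ereal
    by (intro set_integrable_divide set_integral_diff) auto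
  have A: "action p L s f g = (LINT x:{0<..<l}|lborel. (g x)\<^sup>2) / 2 + (LINT x:{0<..<l}|lborel. pot p s (f x))"
    unfolding action_def L einterval_0_ereal using g2 p2 by (subst set_integral_add) auto
  have pot0: "0 \<le> (LINT x:{0<..<l}|lborel. pot p s (f x))"
    using bd by (intro set_integral_nonneg pot_nonneg[OF p]) (auto simp: L cedge_ereal)
  have kin0: "0 \<le> (LINT x:{0<..<l}|lborel. (g x)\<^sup>2)" by (intro set_integral_nonneg) auto
  show ?thesis
  proof (cases "\<exists>x\<in>{0..l}. \<bar>f x\<bar> \<le> t / 2")
    case True
    then obtain x where x: "x \<in> {0..l}" "\<bar>f x\<bar> \<le> t / 2" by blast
    \<comment> \<open>The mean slope of a drop by \<open>t / 2\<close> over the length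
      \<open>l\<close>. The constant part of \<open>?h\<close> then accounts for half of the drop,
      and the kinetic part for the other half.\<close>
    define \<theta> where "\<theta> = t / (2 * l)"
    have \<theta>: "0 < \<theta>" using t \<open>0 < l\<close> by (simp add: \<theta>_def)
    let ?h = "\<lambda>z. \<theta> / 2 + (g z)\<^sup>2 / (2 * \<theta>)"
    have const: "set_integrable lborel {0<..<l} (\<lambda>z. \<theta> / 2)" using \<open>0 < l\<close> by (auto simp: set_integrable_def)
    have hint: "set_integrable lborel {0<..<l} ?h"
      using g2 by (intro set_integral_add const) auto
    have "\<bar>f x - f 0\<bar> \<le> (LINT z:{0<..<x}|lborel. ?h z)"
    proof (rule H1_edge_calibration[OF e, where W = "\<lambda>_. 1"])
      have "0 \<le> (\<theta> - \<bar>g z\<bar>)\<^sup>2 / (2 * \<theta>)" for z using \<theta> by simp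
      then show "\<bar>1\<bar> * \<bar>g z\<bar> \<le> ?h z" for z using \<theta> by (simp add: power2_diff field_simps power2_eq_square)
    qed (use x hint in \<open>auto simp: L cedge_ereal einterval_0_ereal\<close>)
    also have "\<dots> \<le> (LINT z:{0<..<l}|lborel. ?h z)"
      using x \<theta> by (intro set_integral_mono_set[OF hint]) auto
    also have "\<dots> = \<theta> / 2 * l + (LINT x:{0<..<l}|lborel. (g x)\<^sup>2) / (2 * \<theta>)"
      using g2 \<open>0 < l\<close> by (subst set_integral_add[OF const]) (auto simp: set_lebesgue_integral_def)
    also have "\<theta> / 2 * l = t / 4" using \<open>0 < l\<close> by (simp add: \<theta>_def)
    finally have "t / 4 \<le> (LINT x:{0<..<l}|lborel. (g x)\<^sup>2) / (2 * \<theta>)" using x by (simp add: t_def)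
    then have "t / 4 * (2 * \<theta>) \<le> (LINT x:{0<..<l}|lborel. (g x)\<^sup>2)" using \<theta> by (simp add: field_simps)
    also have "t / 4 * (2 * \<theta>) = t\<^sup>2 / (4 * l)" by (simp add: \<theta>_def power2_eq_square)
    finally have "1 / (8 * l) * t\<^sup>2 \<le> action p L s f g" using A pot0 by simp
    moreover have "min (1 / (8 * l)) (\<kappa> * l / 8) * t\<^sup>2 \<le> 1 / (8 * l) * t\<^sup>2" by (intro mult_right_mono) auto
    ultimately show ?thesis unfolding t(2) \<kappa>_def by linarith
  next
    case False
    \<comment> \<open>Chebyshev's inequality in pointwise form: the left-hand side is nonpositive
      where |f| \<ge> s1 / 2 and at most t^2 \<kappa> / 4 elsewhere, and its integral is controlled
      by the mass.\<close>
    have pt: "t\<^sup>2 / 4 * \<kappa> * (1 - 4 / s1\<^sup>2 * (f x)\<^sup>2) \<le> pot p s (f x)" if "x \<in> {0<..<l}" for x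
    proof (cases "s1 / 2 \<le> \<bar>f x\<bar>")
      case True
      then have "(s1 / 2)\<^sup>2 \<le> \<bar>f x\<bar>\<^sup>2" using \<open>0 < s1\<close> by (intro power_mono) auto
      then have "1 - 4 / s1\<^sup>2 * (f x)\<^sup>2 \<le> 0" using \<open>0 < s1\<close> by (simp add: field_simps)
      then have "t\<^sup>2 / 4 * \<kappa> * (1 - 4 / s1\<^sup>2 * (f x)\<^sup>2) \<le> 0" using \<kappa> by (intro mult_nonneg_nonpos) auto
      also have "0 \<le> pot p s (f x)" using bd that by (intro pot_nonneg[OF p]) (auto simp: L cedge_ereal)
      finally show ?thesis .
    next
      case small: False
      have "x \<in> {0..l}" using that by auto
      then have "t / 2 < \<bar>f x\<bar>" using False not_le by blast
      then have "(t / 2)\<^sup>2 \<le> \<bar>f x\<bar>\<^sup>2" using t by (intro power_mono) auto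
      then have q: "t\<^sup>2 / 4 \<le> (f x)\<^sup>2" by (simp add: power_divide)
      have "\<bar>f x\<bar> powr (p - 2) \<le> (s / 2) powr (p - 2)" using small \<open>s1 \<le> s\<close> p by (intro powr_mono2) auto
      also have "\<dots> = s powr (p - 2) * (1/2) powr (p - 2)"
        using s by (subst powr_mult[symmetric]) auto
      finally have "s powr (p - 2) * (1 - (1/2) powr (p - 2)) \<le> s powr (p - 2) - \<bar>f x\<bar> powr (p - 2)"
        by (simp add: algebra_simps)
      moreover have "s1 powr (p - 2) * (1 - (1/2) powr (p - 2)) \<le> s powr (p - 2) * (1 - (1/2) powr (p - 2))"
        using \<open>0 < s1\<close> \<open>s1 \<le> s\<close> p half by (intro mult_right_mono powr_mono2) auto
      ultimately have "\<kappa> \<le> (s powr (p - 2) - \<bar>f x\<bar> powr (p - 2)) / p"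
        unfolding \<kappa>_def using p by (intro divide_right_mono) auto
      then have "t\<^sup>2 / 4 * \<kappa> \<le> (f x)\<^sup>2 * ((s powr (p - 2) - \<bar>f x\<bar> powr (p - 2)) / p)"
        using q \<kappa> by (intro mult_mono) auto
      also have "\<dots> = pot p s (f x)" by (simp add: pot_eq[OF p])
      finally have "t\<^sup>2 / 4 * \<kappa> \<le> pot p s (f x)" .
      moreover have "t\<^sup>2 / 4 * \<kappa> * (1 - 4 / s1\<^sup>2 * (f x)\<^sup>2) \<le> t\<^sup>2 / 4 * \<kappa> * 1"
        using \<kappa> \<open>0 < s1\<close> by (intro mult_left_mono) auto
      ultimately show ?thesis by linarith
    qed
    have const: "set_integrable lborel {0<..<l} (\<lambda>z. 1 :: real)" using \<open>0 < l\<close> by (auto simp: set_integrable_def)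
    have i: "set_integrable lborel {0<..<l} (\<lambda>x. 1 - 4 / s1\<^sup>2 * (f x)\<^sup>2)"
      using f2 by (intro set_integral_diff const) auto
    have "(LINT x:{0<..<l}|lborel. 1 - 4 / s1\<^sup>2 * (f x)\<^sup>2) = l - 4 / s1\<^sup>2 * (LINT x:{0<..<l}|lborel. (f x)\<^sup>2)"
      using f2 \<open>0 < l\<close> by (subst set_integral_diff(2)[OF const]) (auto simp: set_lebesgue_integral_def)
    also have "\<dots> \<ge> l - 4 / s1\<^sup>2 * M" using mass \<open>0 < s1\<close> by (intro diff_left_mono mult_left_mono) auto
    also have "l - 4 / s1\<^sup>2 * M = l / 2" using l by simp
    finally have "t\<^sup>2 / 4 * \<kappa> * (l / 2) \<le> t\<^sup>2 / 4 * \<kappa> * (LINT x:{0<..<l}|lborel. 1 - 4 / s1\<^sup>2 * (f x)\<^sup>2)"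
      using \<kappa> by (intro mult_left_mono) auto
    also have "\<dots> = (LINT x:{0<..<l}|lborel. t\<^sup>2 / 4 * \<kappa> * (1 - 4 / s1\<^sup>2 * (f x)\<^sup>2))" by simp
    also have "\<dots> \<le> (LINT x:{0<..<l}|lborel. pot p s (f x))"
      using i p2 pt by (intro set_integral_mono) auto
    finally have "\<kappa> * l / 8 * t\<^sup>2 \<le> action p L s f g" using A kin0 by (simp add: algebra_simps)
    moreover have "min (1 / (8 * l)) (\<kappa> * l / 8) * t\<^sup>2 \<le> \<kappa> * l / 8 * t\<^sup>2" by (intro mult_right_mono) auto
    ultimately show ?thesis unfolding t(2) \<kappa>_def by linarith
  qed
qed

end

end

section \<open>The soliton\<close>

lemma integrable_exp_minus_abs:
  assumes "0 < c"
  shows "integrable lborel (\<lambda>x::real. exp (- c * \<bar>x\<bar>))"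
proof -
  have "(\<lambda>x. exp (- c * x)) absolutely_integrable_on {0..}"
    by (intro nonnegative_absolutely_integrable_1 integrable_on_exp_minus_to_infinity assms) auto
  then have "integrable lborel (\<lambda>x. indicator {0..} x * exp (- c * x))"
    by (simp add: set_integrable_def integrable_completion)
  then have h: "integrable lborel (\<lambda>x. indicator {0..} x * exp (- c * x))"
    "integrable lborel (\<lambda>x. indicator {0..} (- x) * exp (- c * (- x)))"
    using lborel_integrable_real_affine[of "\<lambda>x. indicator {0..} x * exp (- c * x)" "-1" 0] by auto
  show ?thesis
  proof (rule Bochner_Integration.integrable_bound[OF Bochner_Integration.integrable_add[OF h]])
    show "AE x in lborel. norm (exp (- c * \<bar>x\<bar>)) \<le>
        norm (indicator {0..} x * exp (- c * x) + indicator {0..} (- x) * exp (- c * (- x)))"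
      by (intro AE_I2) (auto simp: indicator_def)
  qed auto
qed

lemma lborel_FTC:
  assumes "\<And>x. (F has_real_derivative f x) (at x)" "continuous_on UNIV f" "integrable lborel f"
    and "(F \<longlongrightarrow> A) at_bot" "(F \<longlongrightarrow> B) at_top"
  shows "(LINT x|lborel. f x) = B - A"
proof -
  have "(LBINT x=-\<infinity>..\<infinity>. f x) = B - A"
    using assms
    by (intro interval_integral_FTC_integrable)
       (auto simp: ereal_tendsto_simps set_integrable_def continuous_on_eq_continuous_at
         simp flip: has_real_derivative_iff_has_vector_derivative)
  then show ?thesis by (simp add: interval_lebesgue_integral_def set_lebesgue_integral_def)
qed

text \<open>The product of \<open>f\<close> with a test function satisfies the fundamental theorem
  of calculus with finitely many exceptional points and vanishes at both ends. The exceptional set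
  admits the kinks of a truncated soliton.\<close>

lemma has_weak_derivI:
  assumes cont: "continuous_on UNIV f" and "finite S"
    and d: "\<And>x. x \<notin> S \<Longrightarrow> (f has_real_derivative g x) (at x)"
    and g: "\<And>K. compact K \<Longrightarrow> set_integrable lborel K g"
    and I: "I \<in> sets borel"
  shows "has_weak_deriv I f g"
  unfolding has_weak_deriv_def
proof (intro conjI allI impI)
  show "locally_integrable I f"
    unfolding locally_integrable_def
    unfolding set_integrable_def
    using borel_integrable_compact[OF _ continuous_on_subset[OF cont subset_UNIV]] by auto
  show "locally_integrable I g" unfolding locally_integrable_def using g by auto
  fix \<phi> assume "test_function I \<phi>"
  then obtain K where K: "compact K" "K \<subseteq> I" "\<And>x. x \<notin> K \<Longrightarrow> \<phi> x = 0" and C1: "\<phi> C1_differentiable_on UNIV"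
    unfolding test_function_def by auto
  from C1 obtain D where D: "\<And>x. (\<phi> has_real_derivative D x) (at x)" "continuous_on UNIV D"
    unfolding C1_differentiable_on_def by (auto simp: has_real_derivative_iff_has_vector_derivative)
  have contphi: "continuous_on UNIV \<phi>" using D(1) by (auto intro: DERIV_isCont simp: continuous_on_eq_continuous_at)
  have D0: "D x = 0" if "x \<notin> K" for x
  proof -
    have "eventually (\<lambda>y. y \<in> - K) (nhds x)"
      using that K(1) by (intro eventually_nhds_in_open) (auto simp: compact_imp_closed)
    then have "eventually (\<lambda>y. \<phi> y = 0) (nhds x)" by eventually_elim (use K(3) in auto)
    then have "(\<phi> has_real_derivative 0) (at x)"
      using DERIV_cong_ev[OF refl, of \<phi> "\<lambda>_. 0" x 0 0] by simp
    then show ?thesis using D(1) DERIV_unique by blast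
  qed
  obtain B where B: "\<And>x. x \<in> K \<Longrightarrow> \<bar>x\<bar> \<le> B"
    using compact_imp_bounded[OF K(1)] by (auto simp: bounded_iff)
  define R where "R = max 0 B"
  have R: "K \<subseteq> {-R..R}" "0 \<le> R" using B by (force simp: R_def)+
  \<comment> \<open>Enlarged by 1 on both sides, so that \<phi> vanishes at the end points of
    \<open>J\<close>.\<close>
  define J where "J = {-R-1..R+1}"
  have KJ: "K \<subseteq> J" using R by (auto simp: J_def)
  have gJ: "set_integrable lborel J (\<lambda>x. g x * \<phi> x)"
  proof -
    have "bounded (\<phi> ` J)"
      unfolding J_def by (intro compact_imp_bounded compact_continuous_image continuous_on_subset[OF contphi]) auto
    then obtain B where B: "\<And>x. x \<in> J \<Longrightarrow> \<bar>\<phi> x\<bar> \<le> B"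
      unfolding bounded_iff by (metis imageI real_norm_def)
    have gJ0: "set_integrable lborel J g" using g by (simp add: J_def)
    then have "set_integrable lborel J (\<lambda>x. B * g x)" by simp
    then show ?thesis
    proof (rule set_integrable_bound)
      have "(\<lambda>x. (indicator J x *\<^sub>R g x) * \<phi> x) \<in> borel_measurable lborel"
        using gJ0 contphi unfolding set_integrable_def
        by (intro borel_measurable_times) (auto dest: borel_measurable_integrable intro: borel_measurable_continuous_onI)
      then show "set_borel_measurable lborel J (\<lambda>x. g x * \<phi> x)"
        by (simp add: set_borel_measurable_def mult.assoc)
      show "AE x in lborel. x \<in> J \<longrightarrow> norm (g x * \<phi> x) \<le> norm (B * g x)"
      proof (intro AE_I2 impI)
        fix x assume "x \<in> J"
        then have "\<bar>\<phi> x\<bar> \<le> \<bar>B\<bar>" using B by force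
        then have "\<bar>\<phi> x\<bar> * \<bar>g x\<bar> \<le> \<bar>B\<bar> * \<bar>g x\<bar>" by (rule mult_right_mono) simp
        then show "norm (g x * \<phi> x) \<le> norm (B * g x)" by (simp add: abs_mult mult.commute)
      qed
    qed
  qed
  have fJ: "set_integrable lborel J (\<lambda>x. f x * D x)"
    unfolding J_def by (intro borel_integrable_atLeastAtMost' continuous_intros continuous_on_subset[OF cont] continuous_on_subset[OF D(2)]) auto
  have "((\<lambda>x. f x * D x + g x * \<phi> x) has_integral (f (R+1) * \<phi> (R+1) - f (-R-1) * \<phi> (-R-1))) J"
    unfolding J_def
  proof (rule fundamental_theorem_of_calculus_interior_strong[OF \<open>finite S\<close>])
    show "((\<lambda>x. f x * \<phi> x) has_vector_derivative f x * D x + g x * \<phi> x) (at x)" if "x \<in> {-R-1<..<R+1} - S" for x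
      using DERIV_mult[OF d[of x] D(1)[of x]] that
      by (simp add: has_real_derivative_iff_has_vector_derivative[symmetric] algebra_simps)
    show "continuous_on {- R - 1..R + 1} (\<lambda>x. f x * \<phi> x)"
      by (intro continuous_intros continuous_on_subset[OF cont] continuous_on_subset[OF contphi]) auto
  qed (use R in auto)
  moreover have "\<phi> (R+1) = 0" "\<phi> (-R-1) = 0" using K(3) R by fastforce+
  ultimately have "integral J (\<lambda>x. f x * D x + g x * \<phi> x) = 0" by (simp add: integral_unique)
  then have "(LINT x:J|lborel. f x * D x) + (LINT x:J|lborel. g x * \<phi> x) = 0"
    using set_borel_integral_eq_integral(2)[OF set_integral_add(1)[OF fJ gJ]] set_integral_add(2)[OF fJ gJ] by simp
  moreover have "(LINT x:I|lborel. f x * D x) = (LINT x:J|lborel. f x * D x)"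
    using set_integral_restrict[OF K(2), of "\<lambda>x. f x * D x"] set_integral_restrict[OF KJ, of "\<lambda>x. f x * D x"] D0 by simp
  moreover have "(LINT x:I|lborel. g x * \<phi> x) = (LINT x:J|lborel. g x * \<phi> x)"
    using set_integral_restrict[OF K(2), of "\<lambda>x. g x * \<phi> x"] set_integral_restrict[OF KJ, of "\<lambda>x. g x * \<phi> x"] K(3) by simp
  moreover have "deriv \<phi> = D" using D(1) DERIV_imp_deriv by blast
  ultimately show "(LINT x:I|lborel. f x * deriv \<phi> x) = - (LINT x:I|lborel. g x * \<phi> x)" by simp
qed

section \<open>The explicit soliton: decay, mass and energy\<close>

context
  fixes p :: real
  assumes p: "2 < p"
begin

definition rate :: real where "rate = (p - 2) / 2 * sqrt (2 / p)"

text \<open>A power of sech: the decaying solution of \<open>u'\<^sup>2 = 2 * pot p 1 u\<close> with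
  \<open>u 0 = 1\<close>. This equation dictates the exponent and \<open>rate\<close>.\<close>

definition sol :: "real \<Rightarrow> real" where "sol x = cosh (rate * x) powr (- (2 / (p - 2)))"

definition dsol :: "real \<Rightarrow> real" where "dsol x = - sqrt (2 / p) * tanh (rate * x) * sol x"

lemma rate_pos: "0 < rate" using p by (simp add: rate_def)

lemma sol_pos: "0 < sol x" by (simp add: sol_def)

lemma sol_le_1: "sol x \<le> 1"
  unfolding sol_def using p cosh_real_ge_1[of "rate * x"] powr_mono2'[of "- (2 / (p - 2))" 1 "cosh (rate * x)"]
  by simp

lemma sol_0: "sol 0 = 1" by (simp add: sol_def)

lemma sol_minus: "sol (- x) = sol x" by (simp add: sol_def)

lemma dsol_minus: "dsol (- x) = - dsol x" by (simp add: dsol_def sol_minus)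

lemma sol_antimono: "\<bar>x\<bar> \<le> \<bar>y\<bar> \<Longrightarrow> sol y \<le> sol x"
proof -
  assume "\<bar>x\<bar> \<le> \<bar>y\<bar>"
  then have "cosh \<bar>rate * x\<bar> \<le> cosh \<bar>rate * y\<bar>"
    using rate_pos by (subst cosh_real_nonneg_le_iff) (auto simp: abs_mult)
  then have "cosh (rate * x) \<le> cosh (rate * y)" by simp
  then show ?thesis unfolding sol_def using p by (intro powr_mono2') auto
qed

lemma sol_derivative: "(sol has_real_derivative dsol x) (at x)"
proof -
  have "(sol has_real_derivative (- (2 / (p - 2))) * cosh (rate * x) powr (- (2 / (p - 2)) - 1) * (sinh (rate * x) * rate)) (at x)"
    unfolding sol_def[abs_def]
    by (rule DERIV_fun_powr derivative_eq_intros refl | simp)+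
  moreover have "(- (2 / (p - 2))) * cosh (rate * x) powr (- (2 / (p - 2)) - 1) * (sinh (rate * x) * rate) = dsol x"
  proof -
    have "cosh (rate * x) powr (- (2 / (p - 2)) - 1) = sol x / cosh (rate * x)"
      unfolding sol_def by (simp add: powr_diff)
    moreover have "- c * (S / C) * (h * r) = - (c * r) * (h / C) * S" for c S C h r :: real by simp
    ultimately have "(- (2 / (p - 2))) * cosh (rate * x) powr (- (2 / (p - 2)) - 1) * (sinh (rate * x) * rate)
        = - (2 / (p - 2) * rate) * (sinh (rate * x) / cosh (rate * x)) * sol x"
      by metis
    also have "2 / (p - 2) * rate = sqrt (2 / p)" using p by (simp add: rate_def)
    finally show ?thesis unfolding dsol_def tanh_def by simp
  qed
  ultimately show ?thesis by simp
qed

lemma sol_powr: "sol x powr (p - 2) = 1 - (tanh (rate * x))\<^sup>2"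
proof -
  have "sol x powr (p - 2) = cosh (rate * x) powr (- 2)"
  proof -
    have "- (2 / (p - 2)) * (p - 2) = - 2" using p by (simp add: field_simps)
    then show ?thesis unfolding sol_def powr_powr by (simp only:)
  qed
  also have "\<dots> = 1 / (cosh (rate * x))\<^sup>2" by (simp add: powr_minus_divide)
  also have "\<dots> = 1 - (tanh (rate * x))\<^sup>2"
  proof -
    have "(cosh (rate * x))\<^sup>2 / (cosh (rate * x))\<^sup>2 = 1" by simp
    then have "1 - (tanh (rate * x))\<^sup>2 = ((cosh (rate * x))\<^sup>2 - (sinh (rate * x))\<^sup>2) / (cosh (rate * x))\<^sup>2"
      by (simp only: tanh_def power_divide diff_divide_distrib)
    then show ?thesis by (simp only: hyperbolic_pythagoras)
  qed
  finally show ?thesis .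
qed

lemma sol_powr_p: "sol x powr p = (sol x)\<^sup>2 * sol x powr (p - 2)"
  using abs_powr_split[OF p, of "sol x"] sol_pos[of x] by simp

lemma dsol_square: "(dsol x)\<^sup>2 = 2 / p * ((sol x)\<^sup>2 - sol x powr p)"
  using p by (simp add: dsol_def power_mult_distrib sol_powr_p sol_powr algebra_simps)

text \<open>Equipartition: along the soliton the Modica-Mortola inequality is an equality, which is
  why the lower bound from calibrations is sharp.\<close>

lemma cal_sol: "cal p (sol x) = \<bar>dsol x\<bar>"
proof -
  have "cal p (sol x) = sqrt (2 / p) * sol x * sqrt ((tanh (rate * x))\<^sup>2)"
    using sol_pos[of x] by (simp add: cal_def sol_powr)
  then show ?thesis using sol_pos[of x] p by (simp add: dsol_def abs_mult)
qed

lemma continuous_on_sol [continuous_intros]: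
  "continuous_on S f \<Longrightarrow> continuous_on S (\<lambda>x. sol (f x))"
  using continuous_on_compose2[of UNIV sol S f] sol_derivative
  by (auto intro: DERIV_isCont simp: continuous_on_eq_continuous_at)

lemma continuous_on_dsol [continuous_intros]:
  "continuous_on S f \<Longrightarrow> continuous_on S (\<lambda>x. dsol (f x))"
  unfolding dsol_def by (intro continuous_intros) auto

lemma sol_le_exp: "sol x \<le> 2 powr (2 / (p - 2)) * exp (- sqrt (2 / p) * \<bar>x\<bar>)"
proof -
  have "exp (rate * \<bar>x\<bar>) / 2 \<le> cosh \<bar>rate * x\<bar>"
    using rate_pos by (simp add: cosh_def abs_mult)
  then have "exp (rate * \<bar>x\<bar>) / 2 \<le> cosh (rate * x)" by simp
  then have "sol x \<le> (exp (rate * \<bar>x\<bar>) / 2) powr (- (2 / (p - 2)))"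
    unfolding sol_def using p by (intro powr_mono2') auto
  also have "\<dots> = 2 powr (2 / (p - 2)) * exp (rate * \<bar>x\<bar>) powr (- (2 / (p - 2)))"
    by (simp add: powr_divide powr_minus_divide)
  also have "exp (rate * \<bar>x\<bar>) powr (- (2 / (p - 2))) = exp (- (rate * (2 / (p - 2))) * \<bar>x\<bar>)"
    by (simp add: powr_def)
  also have "rate * (2 / (p - 2)) = sqrt (2 / p)" using p by (simp add: rate_def)
  finally show ?thesis .
qed

lemma sol_at_top: "(sol \<longlongrightarrow> 0) at_top"
proof (rule tendsto_sandwich[where f = "\<lambda>_. 0"])
  show "\<forall>\<^sub>F x in at_top. sol x \<le> 2 powr (2 / (p - 2)) * exp (- sqrt (2 / p) * \<bar>x\<bar>)"
    using sol_le_exp by simp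
  have "filterlim (\<lambda>x. - sqrt (2 / p) * x) at_bot at_top"
    using p by (intro filterlim_tendsto_neg_mult_at_bot[OF tendsto_const]) (auto simp: filterlim_ident)
  then have "((\<lambda>x. exp (- sqrt (2 / p) * x)) \<longlongrightarrow> 0) at_top"
    by (rule filterlim_compose[OF exp_at_bot])
  then have "((\<lambda>x. 2 powr (2 / (p - 2)) * exp (- sqrt (2 / p) * x)) \<longlongrightarrow> 2 powr (2 / (p - 2)) * 0) at_top"
    by (intro tendsto_intros)
  then show "((\<lambda>x. 2 powr (2 / (p - 2)) * exp (- sqrt (2 / p) * \<bar>x\<bar>)) \<longlongrightarrow> 0) at_top"
    by (subst (asm) tendsto_cong[of _ "\<lambda>x. 2 powr (2 / (p - 2)) * exp (- sqrt (2 / p) * \<bar>x\<bar>)"])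
       (auto intro: eventually_mono[OF eventually_ge_at_top[of 0]])
qed (auto intro!: always_eventually less_imp_le[OF sol_pos])

lemma sol_at_bot: "(sol \<longlongrightarrow> 0) at_bot"
  using sol_at_top by (simp add: filterlim_at_bot_mirror sol_minus)

lemma sol_measurable [measurable]: "sol \<in> borel_measurable borel"
  by (intro borel_measurable_continuous_onI continuous_on_sol continuous_on_id)

lemma dsol_measurable [measurable]: "dsol \<in> borel_measurable borel"
  by (intro borel_measurable_continuous_onI continuous_on_dsol continuous_on_id)

lemma sol_square_integrable: "integrable lborel (\<lambda>x. (sol x)\<^sup>2)"
proof -
  let ?c = "(2 powr (2 / (p - 2)))\<^sup>2"
  have "integrable lborel (\<lambda>x. ?c * exp (- (2 * sqrt (2 / p)) * \<bar>x\<bar>))"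
    using p by (intro integrable_mult_right integrable_exp_minus_abs) auto
  then show ?thesis
  proof (rule Bochner_Integration.integrable_bound)
    show "AE x in lborel. norm ((sol x)\<^sup>2) \<le> norm (?c * exp (- (2 * sqrt (2 / p)) * \<bar>x\<bar>))"
    proof (rule AE_I2)
      fix x
      have "(sol x)\<^sup>2 \<le> (2 powr (2 / (p - 2)) * exp (- sqrt (2 / p) * \<bar>x\<bar>))\<^sup>2"
        using sol_le_exp sol_pos[of x] by (intro power_mono) auto
      then show "norm ((sol x)\<^sup>2) \<le> norm (?c * exp (- (2 * sqrt (2 / p)) * \<bar>x\<bar>))"
        by (simp add: power_mult_distrib exp_double[symmetric] algebra_simps)
    qed
  qed simp
qed

lemma sol_powr_le: "sol x powr p \<le> (sol x)\<^sup>2"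
  using sol_powr_p[of x] sol_powr[of x] mult_left_le[of "sol x powr (p - 2)" "(sol x)\<^sup>2"] by simp

lemma sol_powr_integrable: "integrable lborel (\<lambda>x. sol x powr p)"
  by (rule Bochner_Integration.integrable_bound[OF sol_square_integrable]) (use sol_powr_le in auto)

lemma dsol_square_integrable: "integrable lborel (\<lambda>x. (dsol x)\<^sup>2)"
  unfolding dsol_square
  by (intro integrable_mult_right Bochner_Integration.integrable_diff sol_square_integrable sol_powr_integrable)

definition mass :: real where "mass = (LINT x|lborel. (sol x)\<^sup>2)"

lemma mass_pos: "0 < mass"
proof -
  have "mass \<noteq> 0"
  proof
    assume "mass = 0"
    then have "AE x in lborel. (sol x)\<^sup>2 = 0"
      unfolding mass_def by (subst (asm) integral_nonneg_eq_0_iff_AE[OF sol_square_integrable]) auto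
    then have "AE x::real in lborel. False" by (rule AE_mp) (use sol_pos in \<open>auto simp: less_imp_neq[symmetric]\<close>)
    then show False by (simp add: eventually_False ae_filter_eq_bot_iff)
  qed
  moreover have "0 \<le> mass" unfolding mass_def by simp
  ultimately show ?thesis by simp
qed

text \<open>The Pohozaev identity: the integrand below is the derivative of \<open>sol * sol'\<close>.\<close>

lemma sol_powr_integral: "(LINT x|lborel. sol x powr p) = 4 / (p + 2) * mass"
proof -
  let ?f = "\<lambda>x. 4 / p * (sol x)\<^sup>2 - (p + 2) / p * sol x powr p"
  have dd: "((\<lambda>x. sol x * dsol x) has_real_derivative ?f x) (at x)" for x
  proof -
    have "(dsol has_real_derivative (- sqrt (2 / p)) * ((1 - (tanh (rate * x))\<^sup>2) * rate * sol x + tanh (rate * x) * dsol x)) (at x)"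
      unfolding dsol_def[abs_def]
      by (rule derivative_eq_intros sol_derivative refl | simp add: dsol_def algebra_simps)+
    from DERIV_mult[OF sol_derivative this] show ?thesis
    proof (rule DERIV_cong)
      have "sqrt (2 / p) * rate = (p - 2) / 2 * (sqrt (2 / p))\<^sup>2"
        unfolding rate_def power2_eq_square by (simp only: mult_ac)
      also have "(sqrt (2 / p))\<^sup>2 = 2 / p" using p by simp
      finally have r: "sqrt (2 / p) * rate = (p - 2) / p" using p by (simp add: field_simps)
      have "dsol x * dsol x + (- sqrt (2 / p)) * ((1 - (tanh (rate * x))\<^sup>2) * rate * sol x + tanh (rate * x) * dsol x) * sol x
        = 2 * (dsol x)\<^sup>2 - (sqrt (2 / p) * rate) * ((sol x)\<^sup>2 * (1 - (tanh (rate * x))\<^sup>2))"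
        by (simp add: dsol_def power2_eq_square algebra_simps)
      also have "\<dots> = 2 * (dsol x)\<^sup>2 - (p - 2) / p * sol x powr p"
        unfolding r sol_powr_p sol_powr ..
      also have "\<dots> = ?f x"
        unfolding dsol_square using p by (simp add: field_simps)
      finally show "dsol x * dsol x + (- sqrt (2 / p)) * ((1 - (tanh (rate * x))\<^sup>2) * rate * sol x + tanh (rate * x) * dsol x) * sol x = ?f x" .
    qed
  qed
  have ab: "\<bar>sol x * dsol x\<bar> \<le> sqrt (2 / p) * sol x" for x
  proof -
    have "\<bar>tanh (rate * x)\<bar> * sol x \<le> 1 * 1"
      using tanh_real_bounds[of "rate * x"] sol_le_1[of x] sol_pos[of x] by (intro mult_mono) auto
    then have "sqrt (2 / p) * sol x * (\<bar>tanh (rate * x)\<bar> * sol x) \<le> sqrt (2 / p) * sol x * 1"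
      using p sol_pos[of x] by (intro mult_left_mono) auto
    then show ?thesis using p sol_pos[of x] by (simp add: dsol_def abs_mult mult_ac)
  qed
  have lim: "((\<lambda>x. sol x * dsol x) \<longlongrightarrow> 0) F" if "(sol \<longlongrightarrow> 0) F" for F
  proof (rule Lim_null_comparison)
    show "\<forall>\<^sub>F x in F. norm (sol x * dsol x) \<le> sqrt (2 / p) * sol x" using ab by simp
    show "((\<lambda>x. sqrt (2 / p) * sol x) \<longlongrightarrow> 0) F" using tendsto_mult_right_zero[OF that] by simp
  qed
  have "(LINT x|lborel. ?f x) = 0 - 0"
  proof (rule lborel_FTC[OF dd])
    show "continuous_on UNIV ?f"
      using sol_pos by (intro continuous_intros) (auto simp: less_imp_neq[symmetric])
    show "integrable lborel ?f"
      by (intro integrable_mult_right Bochner_Integration.integrable_diff sol_square_integrable sol_powr_integrable)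
  qed (intro lim sol_at_bot sol_at_top)+
  moreover have "(LINT x|lborel. ?f x) = 4 / p * mass - (p + 2) / p * (LINT x|lborel. sol x powr p)"
    unfolding mass_def using sol_square_integrable sol_powr_integrable by simp
  ultimately show ?thesis using p by (simp add: field_simps)
qed

text \<open>The first integral \<open>dsol_square\<close> leaves only the mass and the power
  integral, and the latter is a multiple of the mass by the Pohozaev identity.\<close>

lemma dsol_square_integral: "(LINT x|lborel. (dsol x)\<^sup>2) = 2 / p * ((p - 2) / (p + 2)) * mass"
proof -
  have "(LINT x|lborel. (dsol x)\<^sup>2) = 2 / p * (mass - 4 / (p + 2) * mass)"
    unfolding dsol_square mass_def using sol_square_integrable sol_powr_integrable sol_powr_integral
    by (simp add: mass_def)
  then show ?thesis using p by (simp add: field_simps)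
qed

text \<open>Substitution of \<open>z = sol x\<close>: on each half of the line the soliton passes
  once over the values between 0 and 1, with speed \<open>cal p z\<close>. Together with
  \<open>dsol_square_integral\<close> this expresses the inexplicit constant \<Phi> 1 through the
  mass.\<close>

lemma dsol_square_integral_eq:
  assumes \<Phi>: "\<And>z. (\<Phi> has_real_derivative cal p z) (at z)" "\<Phi> 0 = 0"
  shows "(LINT x|lborel. (dsol x)\<^sup>2) = 2 * \<Phi> 1"
proof -
  have cont: "isCont (\<lambda>x. (dsol x)\<^sup>2) x" for x
    using continuous_on_power[OF continuous_on_dsol[OF continuous_on_id], of UNIV 2]
    by (simp add: continuous_on_eq_continuous_at)
  have si: "set_integrable lborel A (\<lambda>x. (dsol x)\<^sup>2)" if "A \<in> sets borel" for A
    using integrable_mult_indicator[of A lborel "\<lambda>x. (dsol x)\<^sup>2"] that dsol_square_integrable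
    by (simp add: set_integrable_def)
  have d: "((\<lambda>x. \<Phi> (sol x)) has_real_derivative \<bar>dsol x\<bar> * dsol x) (at x)" for x
    using DERIV_chain2[OF \<Phi>(1) sol_derivative, of x] by (simp add: cal_sol)
  have c\<Phi>: "isCont \<Phi> z" for z using \<Phi>(1) by (rule DERIV_isCont)
  have lim: "((\<lambda>x. \<Phi> (sol x)) \<longlongrightarrow> \<Phi> c) F" if "(sol \<longlongrightarrow> c) F" for F c
    using isCont_tendsto_compose[OF c\<Phi> that] .
  have sc: "(sol \<longlongrightarrow> 1) (at 0 within A)" for A
    using DERIV_isCont[OF sol_derivative, of 0] sol_0 unfolding isCont_def
    by (metis tendsto_within_subset subset_UNIV)
  have neg: "dsol x \<le> 0" if "0 < x" for x
    using that rate_pos sol_pos[of x] p by (auto simp: dsol_def intro!: mult_nonneg_nonneg)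
  have pos: "0 \<le> dsol x" if "x < 0" for x
    using neg[of "- x"] dsol_minus[of x] that by simp
  \<comment> \<open>The primitive of \<open>(dsol x)\<^sup>2\<close> is \<plusminus>\<Phi> (sol x),
    with the sign of \<open>dsol\<close>, hence the split at 0.\<close>
  have "(LBINT x=0..\<infinity>. (dsol x)\<^sup>2) = - 0 - (- \<Phi> 1)"
  proof (rule interval_integral_FTC_integrable[where F = "\<lambda>x. - \<Phi> (sol x)"])
    show "((\<lambda>x. - \<Phi> (sol x)) has_vector_derivative (dsol x)\<^sup>2) (at x)" if "0 < ereal x" for x
      using DERIV_minus[OF d[of x]] neg[of x] that
      by (simp add: has_real_derivative_iff_has_vector_derivative[symmetric] power2_eq_square zero_ereal_def)
    show "(((\<lambda>x. - \<Phi> (sol x)) \<circ> real_of_ereal) \<longlongrightarrow> - \<Phi> 1) (at_right 0)"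
      unfolding zero_ereal_def ereal_tendsto_simps by (intro tendsto_minus lim sc)
    show "(((\<lambda>x. - \<Phi> (sol x)) \<circ> real_of_ereal) \<longlongrightarrow> - 0) (at_left \<infinity>)"
      unfolding ereal_tendsto_simps using lim[OF sol_at_top] by (intro tendsto_minus) (simp add: \<Phi>(2))
  qed (auto intro: si cont)
  moreover have "(LBINT x=-\<infinity>..0. (dsol x)\<^sup>2) = \<Phi> 1 - 0"
  proof (rule interval_integral_FTC_integrable[where F = "\<lambda>x. \<Phi> (sol x)"])
    show "((\<lambda>x. \<Phi> (sol x)) has_vector_derivative (dsol x)\<^sup>2) (at x)" if "ereal x < 0" for x
      using d[of x] pos[of x] that
      by (simp add: has_real_derivative_iff_has_vector_derivative[symmetric] power2_eq_square zero_ereal_def)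
    show "(((\<lambda>x. \<Phi> (sol x)) \<circ> real_of_ereal) \<longlongrightarrow> \<Phi> 1) (at_left 0)"
      unfolding zero_ereal_def ereal_tendsto_simps by (intro lim sc)
    show "(((\<lambda>x. \<Phi> (sol x)) \<circ> real_of_ereal) \<longlongrightarrow> 0) (at_right (-\<infinity>))"
      unfolding ereal_tendsto_simps using lim[OF sol_at_bot] by (simp add: \<Phi>(2))
  qed (auto intro: si cont)
  moreover have "(LBINT x=-\<infinity>..0. (dsol x)\<^sup>2) + (LBINT x=0..\<infinity>. (dsol x)\<^sup>2) = (LBINT x=-\<infinity>..\<infinity>. (dsol x)\<^sup>2)"
    by (rule interval_integral_sum) (auto simp: interval_lebesgue_integrable_def intro: si)
  moreover have "(LBINT x=-\<infinity>..\<infinity>. (dsol x)\<^sup>2) = (LINT x|lborel. (dsol x)\<^sup>2)"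
    by (simp add: interval_lebesgue_integral_def set_lebesgue_integral_def)
  ultimately show ?thesis by simp
qed

end

section \<open>Compactly supported competitors with almost the energy of the soliton\<close>

context
  fixes p :: real
  assumes p: "2 < p"
begin

text \<open>The soliton is lowered by its value at \<open>n\<close> before the positive part is
  taken. This makes the truncation to \<open>[-n, n]\<close> continuous.\<close>

definition cut :: "nat \<Rightarrow> real \<Rightarrow> real" where
  "cut n y = max (sol p y - sol p (real n)) 0"

definition dcut :: "nat \<Rightarrow> real \<Rightarrow> real" where
  "dcut n y = (if \<bar>y\<bar> < real n then dsol p y else 0)"

lemma cut_bounds: "0 \<le> cut n y" "cut n y \<le> sol p y"
  using sol_pos[OF p, of y] sol_pos[OF p, of "real n"] by (auto simp: cut_def)

lemma cut_eq_0: "real n \<le> \<bar>y\<bar> \<Longrightarrow> cut n y = 0"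
  using sol_antimono[OF p, of "real n" y] by (auto simp: cut_def)

lemma continuous_on_cut: "continuous_on S (cut n)"
  unfolding cut_def[abs_def] by (intro continuous_intros continuous_on_sol[OF p])

lemma cut_measurable [measurable]: "cut n \<in> borel_measurable borel"
  by (rule borel_measurable_continuous_onI[OF continuous_on_cut])

lemma dcut_measurable [measurable]: "dcut n \<in> borel_measurable borel"
  unfolding dcut_def[abs_def] using dsol_measurable[OF p] by measurable

lemma cut_derivative:
  assumes "y \<notin> {real n, - real n}"
  shows "(cut n has_real_derivative dcut n y) (at y)"
proof (cases "\<bar>y\<bar> < real n")
  case True
  have "((\<lambda>y. sol p y - sol p (real n)) has_real_derivative dsol p y - 0) (at y)"
    by (intro DERIV_diff sol_derivative[OF p] DERIV_const)
  then have "(cut n has_real_derivative dsol p y - 0) (at y)"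
  proof (rule DERIV_cong_ev[THEN iffD1, OF refl _ refl, rotated])
    have "eventually (\<lambda>z. z \<in> {- real n<..<real n}) (nhds y)"
      using True by (intro eventually_nhds_in_open) auto
    then show "\<forall>\<^sub>F z in nhds y. sol p z - sol p (real n) = cut n z"
    proof eventually_elim
      case (elim z)
      then have "sol p (real n) \<le> sol p z" by (intro sol_antimono[OF p]) auto
      then show ?case by (simp add: cut_def)
    qed
  qed
  then show ?thesis using True by (simp add: dcut_def)
next
  case False
  have "((\<lambda>y. 0) has_real_derivative 0) (at y)" by simp
  then have "(cut n has_real_derivative 0) (at y)"
  proof (rule DERIV_cong_ev[THEN iffD1, OF refl _ refl, rotated])
    have "eventually (\<lambda>z. z \<in> - {- real n..real n}) (nhds y)"
      using False assms by (intro eventually_nhds_in_open) auto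
    then show "\<forall>\<^sub>F z in nhds y. 0 = cut n z"
    proof eventually_elim
      case (elim z)
      then have "real n \<le> \<bar>z\<bar>" by auto
      then show ?case by (simp add: cut_eq_0)
    qed
  qed
  then show ?thesis using False by (simp add: dcut_def)
qed

lemma dcut_abs_le: "\<bar>dcut n y\<bar> \<le> \<bar>dsol p y\<bar>"
  by (simp add: dcut_def)

lemma cut_tendsto: "(\<lambda>n. cut n y) \<longlonglongrightarrow> sol p y"
proof -
  have "(\<lambda>n. sol p (real n)) \<longlonglongrightarrow> 0"
    using sol_at_top[OF p] filterlim_real_sequentially by (rule filterlim_compose)
  then have "(\<lambda>n. max (sol p y - sol p (real n)) 0) \<longlonglongrightarrow> max (sol p y - 0) 0"
    by (intro tendsto_intros)
  then show ?thesis using sol_pos[OF p, of y] by (simp add: cut_def)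
qed

lemma dcut_tendsto: "(\<lambda>n. dcut n y) \<longlonglongrightarrow> dsol p y"
proof -
  obtain N :: nat where "\<bar>y\<bar> < real N" using reals_Archimedean2 by blast
  then have "eventually (\<lambda>n. dcut n y = dsol p y) sequentially"
    by (intro eventually_sequentiallyI[of N]) (auto simp: dcut_def)
  then show ?thesis by (rule tendsto_eventually)
qed

lemma cut_square_integrable: "integrable lborel (\<lambda>y. (cut n y)\<^sup>2)"
  by (rule Bochner_Integration.integrable_bound[OF sol_square_integrable[OF p]])
     (use cut_bounds in \<open>auto intro!: power_mono\<close>)

lemma dcut_square_integrable: "integrable lborel (\<lambda>y. (dcut n y)\<^sup>2)"
  by (rule Bochner_Integration.integrable_bound[OF dsol_square_integrable[OF p]])
     (measurable, auto simp: dcut_def)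

lemma cut_square_tendsto: "(\<lambda>n. LINT y|lborel. (cut n y)\<^sup>2) \<longlonglongrightarrow> mass p"
  unfolding mass_def[OF p]
  by (rule integral_dominated_convergence[OF _ _ sol_square_integrable[OF p]])
     (use sol_measurable[OF p] cut_bounds in \<open>auto intro!: tendsto_intros cut_tendsto power_mono\<close>)

lemma dcut_square_tendsto: "(\<lambda>n. LINT y|lborel. (dcut n y)\<^sup>2) \<longlonglongrightarrow> (LINT y|lborel. (dsol p y)\<^sup>2)"
  by (rule integral_dominated_convergence[OF _ _ dsol_square_integrable[OF p]])
     (use dsol_measurable[OF p] dcut_abs_le in \<open>auto intro!: tendsto_intros dcut_tendsto simp: abs_le_square_iff\<close>)

lemma cut_powr_tendsto: "(\<lambda>n. LINT y|lborel. cut n y powr p) \<longlonglongrightarrow> (LINT y|lborel. sol p y powr p)"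
  by (rule integral_dominated_convergence[OF _ _ sol_powr_integrable[OF p]])
     (use sol_measurable[OF p] sol_pos[OF p] cut_bounds p
       in \<open>auto intro!: tendsto_powr' cut_tendsto powr_mono2 tendsto_const simp: less_imp_neq[symmetric]\<close>)

lemma set_integral_shift:
  fixes h :: "real \<Rightarrow> real"
  assumes "\<And>y. y \<le> - c \<Longrightarrow> h y = 0" 
  shows "(LINT x:{0<..}|lborel. h (x - c)) = (LINT y|lborel. h y)"
    "integrable lborel h \<Longrightarrow> set_integrable lborel {0<..} (\<lambda>x. h (x - c))"
proof -
  have eq: "(\<lambda>x. indicator {0<..} x *\<^sub>R h (x - c)) = (\<lambda>x. h (- c + 1 * x))"
    using assms by (auto simp: indicator_def fun_eq_iff)
  show "(LINT x:{0<..}|lborel. h (x - c)) = (LINT y|lborel. h y)"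
    unfolding set_lebesgue_integral_def eq using lborel_integral_real_affine[of 1 h "- c"] by simp
  show "set_integrable lborel {0<..} (\<lambda>x. h (x - c))" if "integrable lborel h"
    unfolding set_integrable_def eq using lborel_integrable_real_affine[OF that, of 1 "- c"] by simp
qed

text \<open>The truncated soliton is multiplied by a factor tending to 1, which restores the mass,
  and shifted by \<open>n\<close>, which moves its support into the half-line. It vanishes at the
  origin, so later there is no vertex term. The value in the last bound is the energy of the full
  soliton.\<close>

lemma soliton_competitor:
  assumes "0 < \<epsilon>"
  obtains f g where "continuous_on UNIV f" "\<forall>x\<le>0. f x = 0"
    "has_weak_deriv {0<..} f g"
    "set_integrable lborel {0<..} (\<lambda>x. (f x)\<^sup>2)" "set_integrable lborel {0<..} (\<lambda>x. (g x)\<^sup>2)"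
    "(LINT x:{0<..}|lborel. (f x)\<^sup>2) = mass p"
    "1 / 2 * (LINT x:{0<..}|lborel. (g x)\<^sup>2) - 1 / p * (LINT x:{0<..}|lborel. \<bar>f x\<bar> powr p)
      < (p - 6) / (p + 2) * mass p / p + \<epsilon>"
proof -
  define N where "N n = (LINT y|lborel. (cut n y)\<^sup>2)" for n
  define c where "c n = sqrt (mass p / N n)" for n
  have M: "0 < mass p" by (rule mass_pos[OF p])
  have N: "N \<longlonglongrightarrow> mass p" unfolding N_def by (rule cut_square_tendsto)
  then have "(\<lambda>n. sqrt (mass p / N n)) \<longlonglongrightarrow> sqrt (mass p / mass p)"
    using M by (intro tendsto_intros) auto
  then have c: "c \<longlonglongrightarrow> 1" using M by (simp add: c_def[abs_def])
  \<comment> \<open>Only large \<open>n\<close> are usable: \<open>cut 0\<close> is identically 0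
    and cannot be rescaled.\<close>
  have evN: "eventually (\<lambda>n. 0 < N n) sequentially" using order_tendstoD(1)[OF N M] .
  let ?E = "\<lambda>n. 1 / 2 * ((c n)\<^sup>2 * (LINT y|lborel. (dcut n y)\<^sup>2)) - 1 / p * ((c n) powr p * (LINT y|lborel. cut n y powr p))"
  have "?E \<longlonglongrightarrow> 1 / 2 * (1\<^sup>2 * (LINT y|lborel. (dsol p y)\<^sup>2)) - 1 / p * (1 powr p * (LINT y|lborel. sol p y powr p))"
    by (intro tendsto_intros c dcut_square_tendsto cut_powr_tendsto) auto
  also have "1 / 2 * (1\<^sup>2 * (LINT y|lborel. (dsol p y)\<^sup>2)) - 1 / p * (1 powr p * (LINT y|lborel. sol p y powr p))
      = (p - 6) / (p + 2) * mass p / p"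
  proof -
    have e1: "1 / 2 * (2 / p * a * m) - 1 / p * (b * m) = (a - b) * m / p" for a b m :: real
      by (simp add: algebra_simps diff_divide_distrib)
    have e2: "(p - 2) / (p + 2) - 4 / (p + 2) = (p - 6) / (p + 2)"
      by (simp flip: diff_divide_distrib)
    show ?thesis
      unfolding dsol_square_integral[OF p] sol_powr_integral[OF p] power_one powr_one_eq_one mult_1_left e1 e2 ..
  qed
  finally have E: "?E \<longlonglongrightarrow> (p - 6) / (p + 2) * mass p / p" .
  have "eventually (\<lambda>n. ?E n < (p - 6) / (p + 2) * mass p / p + \<epsilon>) sequentially"
    using order_tendstoD(2)[OF E, of "(p - 6) / (p + 2) * mass p / p + \<epsilon>"] \<open>0 < \<epsilon>\<close> by simp
  with evN have "eventually (\<lambda>n. 0 < N n \<and> ?E n < (p - 6) / (p + 2) * mass p / p + \<epsilon>) sequentially"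
    by eventually_elim auto
  from eventually_happens'[OF sequentially_bot this]
  obtain n where n: "0 < N n" "?E n < (p - 6) / (p + 2) * mass p / p + \<epsilon>" by blast
  define f where "f x = c n * cut n (x - real n)" for x
  define g where "g x = c n * dcut n (x - real n)" for x
  have c0: "0 \<le> c n" using M n(1) by (simp add: c_def)
  have z: "cut n y = 0" "dcut n y = 0" if "y \<le> - real n" for y
    using that by (auto intro: cut_eq_0 simp: dcut_def)
  have contf: "continuous_on UNIV f"
    unfolding f_def[abs_def] by (intro continuous_intros continuous_on_compose2[OF continuous_on_cut]) auto
  have f2: "(\<lambda>x. (f x)\<^sup>2) = (\<lambda>x. (c n)\<^sup>2 * (cut n (x - real n))\<^sup>2)"
    and g2: "(\<lambda>x. (g x)\<^sup>2) = (\<lambda>x. (c n)\<^sup>2 * (dcut n (x - real n))\<^sup>2)"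
    and fp: "(\<lambda>x. \<bar>f x\<bar> powr p) = (\<lambda>x. (c n) powr p * cut n (x - real n) powr p)"
    using c0 cut_bounds by (auto simp: f_def g_def power_mult_distrib powr_mult abs_mult)
  show ?thesis
  proof (rule that)
    show "continuous_on UNIV f" by fact
    show "\<forall>x\<le>0. f x = 0" using z by (simp add: f_def)
    show "has_weak_deriv {0<..} f g"
    proof (rule has_weak_derivI[OF contf])
      show "finite {0, 2 * real n}" by simp
      show "(f has_real_derivative g x) (at x)" if "x \<notin> {0, 2 * real n}" for x
      proof -
        have "((\<lambda>x. cut n (x - real n)) has_real_derivative dcut n (x - real n) * 1) (at x)"
          using that by (intro DERIV_chain2[OF cut_derivative]) (auto intro!: derivative_eq_intros)
        then show ?thesis unfolding f_def[abs_def] g_def by (auto intro!: derivative_eq_intros)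
      qed
      fix K :: "real set" assume K: "compact K"
      have "continuous_on K (\<lambda>x. c n * dsol p (x - real n))"
        by (intro continuous_intros continuous_on_dsol[OF p])
      from borel_integrable_compact[OF K this]
      have "set_integrable lborel K (\<lambda>x. c n * dsol p (x - real n))" by (simp add: set_integrable_def)
      then show "set_integrable lborel K g"
      proof (rule set_integrable_bound)
        show "set_borel_measurable lborel K g"
        proof -
          have [measurable]: "K \<in> sets borel" using K by (rule borel_compact)
          show ?thesis unfolding set_borel_measurable_def g_def[abs_def] by measurable
        qed
        show "AE x in lborel. x \<in> K \<longrightarrow> norm (g x) \<le> norm (c n * dsol p (x - real n))"
          by (intro AE_I2) (auto simp: g_def dcut_def)
      qed
    qed auto
    show "set_integrable lborel {0<..} (\<lambda>x. (f x)\<^sup>2)" unfolding f2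
      using set_integral_shift(2)[of "real n" "\<lambda>y. (cut n y)\<^sup>2"] cut_square_integrable z by simp
    show "set_integrable lborel {0<..} (\<lambda>x. (g x)\<^sup>2)" unfolding g2
      using set_integral_shift(2)[of "real n" "\<lambda>y. (dcut n y)\<^sup>2"] dcut_square_integrable z by simp
    have "(LINT x:{0<..}|lborel. (f x)\<^sup>2) = (c n)\<^sup>2 * N n" unfolding f2 N_def
      using set_integral_shift(1)[of "real n" "\<lambda>y. (cut n y)\<^sup>2"] z by simp
    also have "(c n)\<^sup>2 * N n = mass p" using n(1) M by (simp add: c_def)
    finally show "(LINT x:{0<..}|lborel. (f x)\<^sup>2) = mass p" .
    show "1 / 2 * (LINT x:{0<..}|lborel. (g x)\<^sup>2) - 1 / p * (LINT x:{0<..}|lborel. \<bar>f x\<bar> powr p)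
      < (p - 6) / (p + 2) * mass p / p + \<epsilon>"
      unfolding g2 fp using n(2) set_integral_shift(1)[of "real n" "\<lambda>y. (dcut n y)\<^sup>2"]
        set_integral_shift(1)[of "real n" "\<lambda>y. cut n y powr p"] z p by simp
  qed
qed

end

section \<open>The rose graph\<close>

lemma chain_lipschitz:
  assumes "\<And>P Q c. step P Q c \<Longrightarrow> \<bar>h P - h Q\<bar> \<le> c" and "chain step P Q l"
  shows "\<bar>h P - h Q\<bar> \<le> (l :: real)"
  using assms(2)
proof induction
  case (chain_step P Q l R c)
  then show ?case using assms(1)[of Q R c] by linarith
qed simp

text \<open>A function that is 1-Lipschitz along steps bounds the distance from below. The chain in
  the hypothesis ensures that the infimum is not taken over the empty set.\<close>

lemma chain_dist_ge:
  assumes "\<And>P Q c. step P Q c \<Longrightarrow> \<bar>h P - h Q\<bar> \<le> c" and "chain step P Q l"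
  shows "\<bar>h P - h Q\<bar> \<le> chain_dist step P Q"
  unfolding chain_dist_def using assms(2) chain_lipschitz[OF assms(1)]
  by (intro cInf_greatest) auto

lemma chain_dist_le:
  assumes "\<And>P Q c. step P Q c \<Longrightarrow> 0 \<le> c" and "chain step P Q l"
  shows "chain_dist step P Q \<le> l"
  unfolding chain_dist_def
proof (rule cInf_lower)
  show "bdd_below {l. chain step P Q l}"
    using chain_lipschitz[of step "\<lambda>_. 0"] assms(1) by (intro bdd_belowI[of _ 0]) auto
qed (use assms(2) in simp)

lemma chain_single: "step P Q c \<Longrightarrow> chain step P Q c"
  using chain.chain_step[OF chain.chain_refl, of step P Q c] by simp

text \<open>Among three points of a line, the largest distance is the sum of the other two.\<close>

lemma card_equidistant_real_le_2:
  fixes r :: "'a \<Rightarrow> real"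
  assumes "0 < d" "\<And>i j. i \<in> I \<Longrightarrow> j \<in> I \<Longrightarrow> i \<noteq> j \<Longrightarrow> \<bar>r i - r j\<bar> = d"
  shows "\<not> 3 \<le> card I"
proof
  assume "3 \<le> card I"
  then obtain J where "J \<subseteq> I" "card J = 3" by (meson obtain_subset_with_card_n)
  then obtain a b c where "a \<in> I" "b \<in> I" "c \<in> I" "a \<noteq> b" "b \<noteq> c" "a \<noteq> c"
    by (auto simp: card_3_iff)
  then have "\<bar>r a - r b\<bar> = d" "\<bar>r b - r c\<bar> = d" "\<bar>r a - r c\<bar> = d" using assms(2) by auto
  then show False using assms(1) by linarith
qed

text \<open>The two half-lines of a tower of bubbles are isometric copies of rays, so at most two points of each can be
  pairwise equidistant.\<close>

lemma tower_dist_same_sign: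
  assumes X: "X \<in> tower_points A" "x \<in> X" and Y: "Y \<in> tower_points A" "y \<in> Y"
    and sgn: "0 \<le> x \<longleftrightarrow> 0 \<le> y"
  shows "tower_dist A X Y = \<bar>x - y\<bar>"
proof -
  \<comment> \<open>The common absolute value of the members of a class, well defined because only
    opposite numbers are glued. It is the 1-Lipschitz function for the lower bound.\<close>
  define h where "h X = \<bar>SOME x. x \<in> X\<bar>" for X :: "real set"
  have h: "h X = \<bar>x\<bar>" if "X \<in> tower_points A" "x \<in> X" for X x
  proof -
    obtain a where a: "X = tower_rel A `` {a}"
      using \<open>X \<in> tower_points A\<close> by (auto simp: tower_points_def quotient_def)
    have "\<bar>z\<bar> = \<bar>a\<bar>" if "z \<in> X" for z using that unfolding a by (auto simp: tower_rel_def)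
    moreover have "(SOME x. x \<in> X) \<in> X" using \<open>x \<in> X\<close> by (rule someI)
    ultimately show ?thesis using \<open>x \<in> X\<close> by (simp add: h_def)
  qed
  have lip: "\<bar>h P - h Q\<bar> \<le> c" if "tower_step A P Q c" for P Q c
    using that h unfolding tower_step_def by (fastforce simp: dist_real_def)
  have step: "tower_step A X Y \<bar>x - y\<bar>"
    using X Y unfolding tower_step_def dist_real_def by blast
  have ch: "chain (tower_step A) X Y \<bar>x - y\<bar>" by (rule chain_single) (rule step)
  have "\<bar>h X - h Y\<bar> \<le> tower_dist A X Y"
    unfolding tower_dist_def by (rule chain_dist_ge[OF lip ch])
  moreover have "\<bar>h X - h Y\<bar> = \<bar>x - y\<bar>" using h[OF X] h[OF Y] sgn by auto
  moreover have "tower_dist A X Y \<le> \<bar>x - y\<bar>"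
    unfolding tower_dist_def using lip by (intro chain_dist_le[OF _ ch]) (meson abs_ge_zero order_trans)
  ultimately show ?thesis by simp
qed

text \<open>By the pigeonhole principle three of the five points have representatives on the same
  ray.\<close>

lemma tower_no_equidistant:
  assumes "0 < d" "finite I" "card I = 5" "\<And>i. i \<in> I \<Longrightarrow> X i \<in> tower_points A"
    and eq: "\<And>i j. i \<in> I \<Longrightarrow> j \<in> I \<Longrightarrow> i \<noteq> j \<Longrightarrow> tower_dist A (X i) (X j) = d"
  shows False
proof -
  have "\<exists>x. x \<in> X i" if "i \<in> I" for i
    using assms(4)[OF that] by (auto simp: tower_points_def quotient_def tower_rel_def)
  then obtain r where r: "\<And>i. i \<in> I \<Longrightarrow> r i \<in> X i" by metis
  have sub: "\<not> 3 \<le> card {i \<in> I. (0 \<le> r i) = b}" for b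
  proof (rule card_equidistant_real_le_2[OF assms(1), of _ r])
    fix i j assume "i \<in> {i \<in> I. (0 \<le> r i) = b}" "j \<in> {i \<in> I. (0 \<le> r i) = b}" "i \<noteq> j"
    then show "\<bar>r i - r j\<bar> = d"
      using eq[of i j] tower_dist_same_sign[OF assms(4) r assms(4) r, of i j] by auto
  qed
  have "card I \<le> card {i \<in> I. (0 \<le> r i) = True} + card {i \<in> I. (0 \<le> r i) = False}"
    using card_Un_le[of "{i \<in> I. (0 \<le> r i) = True}" "{i \<in> I. (0 \<le> r i) = False}"]
    by (rule order_trans[rotated]) (auto intro!: card_mono \<open>finite I\<close>)
  then show False using sub[of True] sub[of False] \<open>card I = 5\<close> by linarith
qed

section \<open>The rose: degree, trails and metric shape\<close>

definition rose :: "nat \<Rightarrow> real \<Rightarrow> (nat, nat) mgraph" where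
  "rose k l = \<lparr>verts = {0}, edges = {..<k + 2}, src = \<lambda>_. 0, tgt = \<lambda>_. 0,
     len = \<lambda>e. if e < 2 then \<infinity> else ereal l\<rparr>"

lemma rose_simps [simp]:
  "verts (rose k l) = {0}" "edges (rose k l) = {..<k + 2}" "src (rose k l) e = 0"
  "tgt (rose k l) e = 0" "len (rose k l) e = (if e < 2 then \<infinity> else ereal l)"
  by (simp_all add: rose_def)

lemma half_lines_rose: "half_lines (rose k l) = {0, 1}"
  by (auto simp: half_lines_def)

lemma bounded_edges_rose: "bounded_edges (rose k l) = {2..<k + 2}"
  by (auto simp: bounded_edges_def)

lemma metric_graph_rose: "0 < l \<Longrightarrow> metric_graph (rose k l)"
  by (auto simp: metric_graph_def bounded_edges_rose)

text \<open>Loops count twice, so the degree is \<open>2 * k + 2\<close>.\<close>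

lemma vdegree_rose: "vdegree (rose k l) v \<noteq> 2" if "v \<in> verts (rose k l)" "0 < k"
proof -
  have "{e. e < k + 2} = {..<k + 2}" by auto
  moreover have "{e \<in> bounded_edges (rose k l). tgt (rose k l) e = v} = {2..<k + 2}"
    using that by (auto simp: bounded_edges_rose)
  ultimately show ?thesis using that by (simp add: vdegree_def)
qed

lemma pt_rose: "pt (rose k l) e x = (if x = 0 \<or> 2 \<le> e \<and> x = l then Vertex 0 else Inner e x)"
  by (auto simp: pt_def)

lemma closed_edge_rose: "closed_edge (rose k l) e = (if e < 2 then {0..} else {0..l})"
  by (auto simp: closed_edge_def)

lemma trail_rose:
  assumes "P \<in> points (rose k l)" "0 < l"
  shows "\<exists>t. trail (rose k l) t \<and> contains_two_half_lines (rose k l) t \<and> lies_on (rose k l) P t"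
proof -
  have through: ?thesis if e: "e < k + 2" and x: "x \<in> closed_edge (rose k l) e" "P = pt (rose k l) e x" for e x
  proof (cases "e < 2")
    case True
    \<comment> \<open>The first half-line is run through backwards, since its end at infinity can
      only be the start of a trail.\<close>
    let ?t = "[(0, False), (1, True)] :: (nat \<times> bool) list"
    have "trail (rose k l) ?t"
      by (auto simp: trail_def run_end_def run_start_def)
    moreover have "contains_two_half_lines (rose k l) ?t"
      unfolding contains_two_half_lines_def half_lines_rose by auto
    moreover have "e = 0 \<or> e = 1" using True by auto
    then have "e \<in> fst ` set ?t" by auto
    then have "lies_on (rose k l) P ?t" using x unfolding lies_on_def by blast
    ultimately show ?thesis by blast
  next
    case False
    let ?t = "[(0, False), (e, True), (1, True)] :: (nat \<times> bool) list"
    have "trail (rose k l) ?t"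
      using False e by (auto simp: trail_def run_end_def run_start_def)
    moreover have "contains_two_half_lines (rose k l) ?t"
      unfolding contains_two_half_lines_def half_lines_rose by auto
    moreover have "e \<in> fst ` set ?t" by auto
    then have "lies_on (rose k l) P ?t" using x unfolding lies_on_def by blast
    ultimately show ?thesis by blast
  qed
  from assms(1) consider "P = Vertex 0" | e x where "e < k + 2" "x \<in> einterval 0 (len (rose k l) e)" "P = Inner e x"
    by (auto simp: points_def)
  then show ?thesis
  proof cases
    case 1
    then show ?thesis using through[of 0 0] by (auto simp: closed_edge_rose pt_rose)
  next
    case 2
    then show ?thesis using through[of e x]
      by (auto simp: closed_edge_rose pt_rose einterval_0_infinity einterval_0_ereal split: if_splits)
  qed
qed

text \<open>The lower bound comes from the distance to the vertex, counted positively on loop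
  \<open>i\<close>, negatively on loop \<open>j\<close> and as 0 elsewhere, which is 1-Lipschitz.
  The upper bound is the route through the vertex.\<close>

lemma gdist_rose_midpoints:
  assumes "0 < l" "2 \<le> i" "i < k + 2" "2 \<le> j" "j < k + 2" "i \<noteq> j"
  shows "gdist (rose k l) (Inner i (l / 2)) (Inner j (l / 2)) = l"
proof -
  define sg :: "nat \<Rightarrow> real" where "sg e = (if e = i then 1 else if e = j then - 1 else 0)" for e
  define h where "h P = (case P of Vertex v \<Rightarrow> 0 | Inner e x \<Rightarrow> sg e * min x (l - x))" for P :: "(nat, nat) gpoint"
  have lip: "\<bar>h P - h Q\<bar> \<le> c" if st: "edge_step (rose k l) P Q c" for P Q c
  proof -
    from st obtain e x y where exy: "e < k + 2" "x \<in> closed_edge (rose k l) e" "y \<in> closed_edge (rose k l) e"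
      "P = pt (rose k l) e x" "Q = pt (rose k l) e y" "c = \<bar>x - y\<bar>"
      unfolding edge_step_def dist_real_def by auto
    have hp: "h (pt (rose k l) e z) = sg e * min z (l - z)" if "z \<in> closed_edge (rose k l) e" for z
      using that assms by (auto simp: h_def pt_rose closed_edge_rose sg_def split: if_splits)
    have "\<bar>sg e\<bar> * \<bar>min x (l - x) - min y (l - y)\<bar> \<le> 1 * \<bar>x - y\<bar>"
      by (rule mult_mono) (auto simp: sg_def)
    then show ?thesis
      unfolding exy(4,5,6) hp[OF exy(2)] hp[OF exy(3)] by (simp add: abs_mult flip: right_diff_distrib)
  qed
  have half: "edge_step (rose k l) (pt (rose k l) e x) (pt (rose k l) e y) \<bar>x - y\<bar>"
    if "2 \<le> e" "e < k + 2" "x \<in> {0..l}" "y \<in> {0..l}" for e x y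
    unfolding edge_step_def dist_real_def using that
    by (intro bexI[of _ e] bexI[of _ x] bexI[of _ y]) (auto simp: closed_edge_rose)
  have st: "edge_step (rose k l) (Inner i (l / 2)) (Vertex 0) (l / 2)"
    "edge_step (rose k l) (Vertex 0) (Inner j (l / 2)) (l / 2)"
    using half[of i "l / 2" 0] half[of j 0 "l / 2"] assms by (simp_all add: pt_rose)
  have ch: "chain (edge_step (rose k l)) (Inner i (l / 2)) (Inner j (l / 2)) l"
    using chain.chain_step[OF chain_single[of "edge_step (rose k l)", OF st(1)] st(2)] by simp
  have "\<bar>h (Inner i (l / 2)) - h (Inner j (l / 2))\<bar> \<le> gdist (rose k l) (Inner i (l / 2)) (Inner j (l / 2))"
    unfolding gdist_def by (rule chain_dist_ge[OF lip ch])
  moreover have "\<bar>h (Inner i (l / 2)) - h (Inner j (l / 2))\<bar> = l"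
    using assms by (simp add: h_def sg_def)
  moreover have "gdist (rose k l) (Inner i (l / 2)) (Inner j (l / 2)) \<le> l"
    unfolding gdist_def using lip by (intro chain_dist_le[OF _ ch]) (meson abs_ge_zero order_trans)
  ultimately show ?thesis by simp
qed

text \<open>The five points are the images of the midpoints of the loops 2 to 6, which exist because
  \<open>5 \<le> k\<close>.\<close>

lemma rose_equidistant_image:
  assumes "isometric (points (rose k l)) (gdist (rose k l)) N d" "0 < l" "5 \<le> k"
  obtains Q :: "nat \<Rightarrow> 'a" where "\<And>i. i \<in> {2..<7} \<Longrightarrow> Q i \<in> N"
    "\<And>i j. i \<in> {2..<7} \<Longrightarrow> j \<in> {2..<7} \<Longrightarrow> i \<noteq> j \<Longrightarrow> d (Q i) (Q j) = l"
proof -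
  obtain f where f: "bij_betw f (points (rose k l)) N"
    "\<And>x y. x \<in> points (rose k l) \<Longrightarrow> y \<in> points (rose k l) \<Longrightarrow> d (f x) (f y) = gdist (rose k l) x y"
    using assms(1) unfolding isometric_def by blast
  have P: "Inner i (l / 2) \<in> points (rose k l)" if "i \<in> {2..<7}" for i
  proof -
    have "l / 2 \<in> einterval 0 (len (rose k l) i)" "i \<in> edges (rose k l)"
      using that assms by (auto simp: einterval_0_ereal)
    then show ?thesis unfolding points_def by blast
  qed
  show ?thesis
  proof (rule that)
    show "f (Inner i (l / 2)) \<in> N" if "i \<in> {2..<7}" for i
      using P[OF that] f(1) by (auto simp: bij_betw_def)
    show "d (f (Inner i (l / 2))) (f (Inner j (l / 2))) = l"
      if "i \<in> {2..<7}" "j \<in> {2..<7}" "i \<noteq> j" for i j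
      using f(2)[OF P P] gdist_rose_midpoints[of l i k j] that assms by auto
  qed
qed

lemma rose_not_isometric_line:
  assumes "0 < l" "5 \<le> k"
  shows "\<not> isometric (points (rose k l)) (gdist (rose k l)) (UNIV :: real set) dist"
proof
  assume "isometric (points (rose k l)) (gdist (rose k l)) (UNIV :: real set) dist"
  from rose_equidistant_image[OF this assms] obtain Q :: "nat \<Rightarrow> real"
    where Q: "\<And>i j. i \<in> {2..<7} \<Longrightarrow> j \<in> {2..<7} \<Longrightarrow> i \<noteq> j \<Longrightarrow> dist (Q i) (Q j) = l" by metis
  have "\<not> 3 \<le> card {2..<7::nat}"
    by (rule card_equidistant_real_le_2[OF \<open>0 < l\<close>, of _ Q]) (use Q in \<open>simp only: dist_real_def\<close>)
  then show False by simp
qed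

lemma rose_not_isometric_tower:
  assumes "0 < l" "5 \<le> k"
  shows "\<not> isometric_to_tower (rose k l)"
proof
  assume "isometric_to_tower (rose k l)"
  then obtain A where "isometric (points (rose k l)) (gdist (rose k l)) (tower_points A) (tower_dist A)"
    unfolding isometric_to_tower_def by blast
  from rose_equidistant_image[OF this assms] obtain Q where
    "\<And>i. i \<in> {2..<7::nat} \<Longrightarrow> Q i \<in> tower_points A"
    "\<And>i j. i \<in> {2..<7} \<Longrightarrow> j \<in> {2..<7} \<Longrightarrow> i \<noteq> j \<Longrightarrow> tower_dist A (Q i) (Q j) = l" by metis
  then show False using tower_no_equidistant[OF \<open>0 < l\<close>, of "{2..<7}" Q A] by simp
qed

text \<open>The energy is defined through the representative that \<open>weak_deriv\<close> happens
  to choose; this puts any convenient weak derivative in its place.\<close>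

lemma weak_deriv_square:
  assumes wd: "has_weak_deriv (einterval a b) f g" "continuous_on (einterval a b) f" "a < b"
    and g2: "set_integrable lborel (einterval a b) (\<lambda>x. (g x)\<^sup>2)"
  shows "set_integrable lborel (einterval a b) (\<lambda>x. (weak_deriv (einterval a b) f x)\<^sup>2)"
    and "(LINT x:einterval a b|lborel. (weak_deriv (einterval a b) f x)\<^sup>2) =
      (LINT x:einterval a b|lborel. (g x)\<^sup>2)"
proof -
  let ?I = "einterval a b" and ?w = "weak_deriv (einterval a b) f"
  note w = weak_deriv_AE_eq[OF wd]
  have m: "(\<lambda>x. indicator ?I x *\<^sub>R (h x)\<^sup>2) \<in> borel_measurable lborel" if "has_weak_deriv ?I f h" for h
  proof -
    have "(\<lambda>x. indicator ?I x *\<^sub>R h x) \<in> borel_measurable lborel"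
      using locally_integrable_measurable[OF _ wd(3), of h] that
      unfolding has_weak_deriv_def set_borel_measurable_def by blast
    then have "(\<lambda>x. (indicator ?I x *\<^sub>R h x)\<^sup>2) \<in> borel_measurable lborel" by (rule borel_measurable_power)
    also have "(\<lambda>x. (indicator ?I x *\<^sub>R h x)\<^sup>2) = (\<lambda>x. indicator ?I x *\<^sub>R (h x)\<^sup>2)"
      by (auto simp: indicator_def)
    finally show ?thesis .
  qed
  have ae: "AE x in lborel. indicator ?I x *\<^sub>R (?w x)\<^sup>2 = indicator ?I x *\<^sub>R (g x)\<^sup>2"
    using w(2) by (rule AE_mp) (auto simp: indicator_def)
  show "set_integrable lborel ?I (\<lambda>x. (?w x)\<^sup>2)"
    using g2 integrable_cong_AE[OF m[OF w(1)] m[OF wd(1)] ae] by (simp add: set_integrable_def)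
  show "(LINT x:?I|lborel. (?w x)\<^sup>2) = (LINT x:?I|lborel. (g x)\<^sup>2)"
    unfolding set_lebesgue_integral_def by (rule integral_cong_AE[OF m[OF w(1)] m[OF wd(1)] ae])
qed

section \<open>Functions on the rose graph\<close>

text \<open>A function on the rose, seen as a family of functions on the edges that share the vertex
  value \<tau>. Within the locale the points of the graph no longer appear.\<close>

locale rose_fun =
  fixes k :: nat and l M \<tau> :: real and f g :: "nat \<Rightarrow> real \<Rightarrow> real" and L :: "nat \<Rightarrow> ereal"
  assumes l: "0 < l" and M: "0 < M"
    and L: "\<And>e. L e = (if e < 2 then \<infinity> else ereal l)"
    and edge: "\<And>e. e < k + 2 \<Longrightarrow> H1_edge (L e) (f e) (g e)"
    and start: "\<And>e. e < k + 2 \<Longrightarrow> f e 0 = \<tau>"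
    and finish: "\<And>e. 2 \<le> e \<Longrightarrow> e < k + 2 \<Longrightarrow> f e l = \<tau>"
    and total: "(\<Sum>e<k + 2. LINT x:einterval 0 (L e)|lborel. (f e x)\<^sup>2) = M"
begin

lemma H1_edge_half_line: "e < 2 \<Longrightarrow> H1_edge \<infinity> (f e) (g e)"
  using edge[of e] by (simp add: L)

lemma loop_mass_le: "2 \<le> e \<Longrightarrow> e < k + 2 \<Longrightarrow> (LINT x:{0<..<l}|lborel. (f e x)\<^sup>2) \<le> M"
proof -
  assume e: "2 \<le> e" "e < k + 2"
  have "(LINT x:einterval 0 (L e)|lborel. (f e x)\<^sup>2) \<le> (\<Sum>e<k + 2. LINT x:einterval 0 (L e)|lborel. (f e x)\<^sup>2)"
    by (rule member_le_sum[of e "{..<k + 2}" "\<lambda>e. LINT x:einterval 0 (L e)|lborel. (f e x)\<^sup>2"])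
       (use e in \<open>auto intro: set_integral_nonneg\<close>)
  then show ?thesis using e unfolding total by (simp add: L einterval_0_ereal)
qed

text \<open>Decay gives a maximum on each half-line and compactness on each loop. It is positive
  because the mass is.\<close>

lemma attains_max:
  obtains e0 x0 where "e0 < k + 2" "x0 \<in> cedge (L e0)" "0 < \<bar>f e0 x0\<bar>"
    "\<forall>e<k + 2. \<forall>x\<in>cedge (L e). \<bar>f e x\<bar> \<le> \<bar>f e0 x0\<bar>"
proof -
  have "\<exists>y\<in>cedge (L e). \<forall>x\<in>cedge (L e). \<bar>f e x\<bar> \<le> \<bar>f e y\<bar>" if "e < k + 2" for e
  proof (cases "e < 2")
    case True
    from half_line_attains_max[OF H1_edge_half_line[OF this]] obtain y where "0 \<le> y" "\<And>x. 0 \<le> x \<Longrightarrow> \<bar>f e x\<bar> \<le> \<bar>f e y\<bar>"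
      by blast
    then show ?thesis using True by (auto simp: L cedge_infinity)
  next
    case False
    have "continuous_on {0..l} (\<lambda>x. \<bar>f e x\<bar>)"
      using edge[OF that] False unfolding H1_edge_def by (intro continuous_intros) (simp add: L cedge_ereal)
    moreover have "compact {0..l}" "{0..l} \<noteq> {}" using l by auto
    ultimately show ?thesis
      using continuous_attains_sup[of "{0..l}" "\<lambda>x. \<bar>f e x\<bar>"] False by (simp add: L cedge_ereal)
  qed
  then obtain y where y: "\<And>e. e < k + 2 \<Longrightarrow> y e \<in> cedge (L e)"
    "\<And>e x. e < k + 2 \<Longrightarrow> x \<in> cedge (L e) \<Longrightarrow> \<bar>f e x\<bar> \<le> \<bar>f e (y e)\<bar>" by metis
  define m where "m = Max ((\<lambda>e. \<bar>f e (y e)\<bar>) ` {..<k + 2})"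
  have "m \<in> (\<lambda>e. \<bar>f e (y e)\<bar>) ` {..<k + 2}" unfolding m_def by (rule Max_in) auto
  then obtain e0 where e0: "e0 < k + 2" "m = \<bar>f e0 (y e0)\<bar>" by auto
  have le: "\<bar>f e x\<bar> \<le> m" if "e < k + 2" "x \<in> cedge (L e)" for e x
  proof -
    have "\<bar>f e (y e)\<bar> \<le> m" unfolding m_def by (rule Max_ge) (use that in auto)
    then show ?thesis using y(2)[OF that] by linarith
  qed
  have "m \<noteq> 0"
  proof
    assume "m = 0"
    then have "(LINT x:einterval 0 (L e)|lborel. (f e x)\<^sup>2) = 0" if "e < k + 2" for e
      using le[OF that] einterval_subset_cedge[of "L e"] unfolding set_lebesgue_integral_def
      by (intro Bochner_Integration.integral_eq_zero_AE AE_I2) (force simp: indicator_def)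
    then have "M = 0" unfolding total[symmetric] by simp
    then show False using M by simp
  qed
  then show ?thesis using that[of e0 "y e0"] e0 y(1) le by auto
qed

context
  fixes s e0 x0
  assumes s: "0 < s" and e0: "e0 < k + 2" and x0: "x0 \<in> cedge (L e0)" and max: "\<bar>f e0 x0\<bar> = s"
    and bd: "\<And>e x. e < k + 2 \<Longrightarrow> x \<in> cedge (L e) \<Longrightarrow> \<bar>f e x\<bar> \<le> s"
begin

lemma abs_tau_le: "\<bar>\<tau>\<bar> \<le> s"
  using bd[of 0 0] start[of 0] by (simp add: L cedge_infinity)

lemma powr_integral_le:
  assumes "2 < p"
  shows "(\<Sum>e<k + 2. LINT x:einterval 0 (L e)|lborel. \<bar>f e x\<bar> powr p) \<le> s powr (p - 2) * M"
proof -
  have "(LINT x:einterval 0 (L e)|lborel. \<bar>f e x\<bar> powr p) \<le> s powr (p - 2) * (LINT x:einterval 0 (L e)|lborel. (f e x)\<^sup>2)"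
    if e: "e < k + 2" for e
  proof -
    have "(LINT x:einterval 0 (L e)|lborel. \<bar>f e x\<bar> powr p) \<le> (LINT x:einterval 0 (L e)|lborel. s powr (p - 2) * (f e x)\<^sup>2)"
    proof (rule set_integral_mono)
      show "set_integrable lborel (einterval 0 (L e)) (\<lambda>x. \<bar>f e x\<bar> powr p)"
        by (rule H1_edge_powr_integrable[OF edge[OF e] bd[OF e] assms])
      show "set_integrable lborel (einterval 0 (L e)) (\<lambda>x. s powr (p - 2) * (f e x)\<^sup>2)"
        using edge[OF e] unfolding H1_edge_def by auto
      fix x assume "x \<in> einterval 0 (L e)"
      then have "\<bar>f e x\<bar> \<le> s" using bd[OF e] einterval_subset_cedge by blast
      then show "\<bar>f e x\<bar> powr p \<le> s powr (p - 2) * (f e x)\<^sup>2"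
        using assms unfolding abs_powr_split[OF assms] by (subst mult.commute) (intro mult_right_mono powr_mono2, auto)
    qed
    then show ?thesis by simp
  qed
  then have "(\<Sum>e<k + 2. LINT x:einterval 0 (L e)|lborel. \<bar>f e x\<bar> powr p) \<le>
      (\<Sum>e<k + 2. s powr (p - 2) * (LINT x:einterval 0 (L e)|lborel. (f e x)\<^sup>2))"
    by (intro sum_mono) simp
  then show ?thesis by (simp only: total flip: sum_distrib_left)
qed

lemma kinetic_ge:
  "s ^ 4 / (4 * M) \<le> (\<Sum>e<k + 2. LINT x:einterval 0 (L e)|lborel. (g e x)\<^sup>2)"
proof -
  \<comment> \<open>The optimal weight in \<open>2 \<bar>f\<bar> \<bar>g\<bar> \<le> \<kappa> f\<^sup>2 + g\<^sup>2 / \<kappa>\<close>, up to a constant factor.\<close>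
  define \<kappa> where "\<kappa> = s\<^sup>2 / (2 * M)"
  have \<kappa>: "0 < \<kappa>" using s M by (simp add: \<kappa>_def)
  let ?h = "\<lambda>e x. \<kappa> * (f e x)\<^sup>2 + (g e x)\<^sup>2 / \<kappa>"
  define H where "H e = (LINT x:einterval 0 (L e)|lborel. ?h e x)" for e
  have hint: "set_integrable lborel (einterval 0 (L e)) (?h e)" if "e < k + 2" for e
    by (rule H1_edge_square_bound(1)[OF edge[OF that] \<kappa>])
  have H0: "0 \<le> H e" for e unfolding H_def using \<kappa> by (intro set_integral_nonneg) auto
  have half: "(f e x)\<^sup>2 \<le> H e" if "e < 2" "0 \<le> x" for e x
  proof -
    have "(f e x)\<^sup>2 \<le> (LINT t:{x<..}|lborel. ?h e t)"
      by (rule half_line_square_le[OF H1_edge_half_line[OF that(1)] that(2) \<kappa>])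
    also have "\<dots> \<le> H e"
      unfolding H_def by (rule set_integral_mono_set[OF hint]) (use that \<kappa> in \<open>auto simp: L einterval_0_infinity\<close>)
    finally show ?thesis .
  qed
  have sumH: "(\<Sum>e<k + 2. H e) = H 0 + (\<Sum>e\<in>{..<k + 2} - {0}. H e)"
    by (rule sum.remove) auto
  have "s\<^sup>2 \<le> (\<Sum>e<k + 2. H e)"
  proof (cases "e0 < 2")
    case True
    moreover have "s\<^sup>2 = (f e0 x0)\<^sup>2" using max by (metis power2_abs)
    ultimately have "s\<^sup>2 \<le> H e0" using half[of e0 x0] x0 by (simp add: L cedge_infinity)
    also have "\<dots> \<le> (\<Sum>e<k + 2. H e)" by (rule member_le_sum) (use e0 H0 in auto)
    finally show ?thesis .
  next
    case False
    have x: "x0 \<in> {0..l}" using x0 False by (simp add: L cedge_ereal)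
    have "\<bar>(f e0 x0)\<^sup>2 - (f e0 0)\<^sup>2\<bar> \<le> (LINT t:{0<..<x0}|lborel. ?h e0 t)"
    proof (rule H1_edge_calibration[OF edge[OF e0] _ _ _ hint[OF e0] has_real_derivative_square])
      show "continuous_on UNIV (\<lambda>z. 2 * z :: real)" by (intro continuous_intros)
      show "\<bar>2 * f e0 x\<bar> * \<bar>g e0 x\<bar> \<le> ?h e0 x" for x by (rule H1_edge_square_bound(2)[OF edge[OF e0] \<kappa>])
    qed (use x l False in \<open>auto simp: L cedge_ereal\<close>)
    also have "\<dots> \<le> H e0"
      unfolding H_def by (rule set_integral_mono_set[OF hint[OF e0]])
        (use x \<kappa> False in \<open>auto simp: L einterval_0_ereal\<close>)
    finally have "(f e0 x0)\<^sup>2 - (f e0 0)\<^sup>2 \<le> H e0" by simp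
    moreover have "(f e0 0)\<^sup>2 \<le> H 0" using half[of 0 0] start[of 0] start[OF e0] by simp
    moreover have "H e0 \<le> (\<Sum>e\<in>{..<k + 2} - {0}. H e)"
      by (rule member_le_sum) (use e0 False H0 in auto)
    moreover have "s\<^sup>2 = (f e0 x0)\<^sup>2" using max by (metis power2_abs)
    ultimately show ?thesis unfolding sumH by linarith
  qed
  also have "(\<Sum>e<k + 2. H e) = (\<Sum>e<k + 2. \<kappa> * (LINT x:einterval 0 (L e)|lborel. (f e x)\<^sup>2)
      + (LINT x:einterval 0 (L e)|lborel. (g e x)\<^sup>2) / \<kappa>)"
  proof (rule sum.cong[OF refl])
    fix e assume "e \<in> {..<k + 2}"
    then have "H1_edge (L e) (f e) (g e)" using edge by simp
    then have i: "set_integrable lborel (einterval 0 (L e)) (\<lambda>x. \<kappa> * (f e x)\<^sup>2)"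
      "set_integrable lborel (einterval 0 (L e)) (\<lambda>x. (g e x)\<^sup>2 / \<kappa>)" unfolding H1_edge_def by auto
    show "H e = \<kappa> * (LINT x:einterval 0 (L e)|lborel. (f e x)\<^sup>2) + (LINT x:einterval 0 (L e)|lborel. (g e x)\<^sup>2) / \<kappa>"
      unfolding H_def set_integral_add(2)[OF i] by simp
  qed
  also have "\<dots> = \<kappa> * M + (\<Sum>e<k + 2. LINT x:einterval 0 (L e)|lborel. (g e x)\<^sup>2) / \<kappa>"
    unfolding sum.distrib by (simp only: sum_distrib_left[symmetric] sum_divide_distrib[symmetric] total)
  also have "\<kappa> * M = s\<^sup>2 / 2" using M by (simp add: \<kappa>_def)
  finally have "s\<^sup>2 / 2 * \<kappa> \<le> (\<Sum>e<k + 2. LINT x:einterval 0 (L e)|lborel. (g e x)\<^sup>2)"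
    using \<kappa> by (simp add: field_simps)
  moreover have "s\<^sup>2 / 2 * \<kappa> = s ^ 4 / (4 * M)" by (simp add: \<kappa>_def power4_eq_xxxx power2_eq_square)
  ultimately show ?thesis by simp
qed

lemma action_sum:
  assumes "2 < p"
  shows "(\<Sum>e<k + 2. action p (L e) s (f e) (g e)) =
    1 / 2 * (\<Sum>e<k + 2. LINT x:einterval 0 (L e)|lborel. (g e x)\<^sup>2) + s powr (p - 2) / p * M
    - 1 / p * (\<Sum>e<k + 2. LINT x:einterval 0 (L e)|lborel. \<bar>f e x\<bar> powr p)"
proof -
  have "action p (L e) s (f e) (g e) = 1 / 2 * (LINT x:einterval 0 (L e)|lborel. (g e x)\<^sup>2)
      + s powr (p - 2) / p * (LINT x:einterval 0 (L e)|lborel. (f e x)\<^sup>2)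
      - 1 / p * (LINT x:einterval 0 (L e)|lborel. \<bar>f e x\<bar> powr p)" if e: "e < k + 2" for e
  proof -
    have i: "set_integrable lborel (einterval 0 (L e)) (\<lambda>x. 1 / 2 * (g e x)\<^sup>2)"
      "set_integrable lborel (einterval 0 (L e)) (\<lambda>x. s powr (p - 2) / p * (f e x)\<^sup>2)"
      using edge[OF e] unfolding H1_edge_def by auto
    have ip: "set_integrable lborel (einterval 0 (L e)) (\<lambda>x. 1 / p * \<bar>f e x\<bar> powr p)"
      using H1_edge_powr_integrable[OF edge[OF e] bd[OF e] assms] by auto
    have "action p (L e) s (f e) (g e) = (LINT x:einterval 0 (L e)|lborel.
        (1 / 2 * (g e x)\<^sup>2 + s powr (p - 2) / p * (f e x)\<^sup>2) - 1 / p * \<bar>f e x\<bar> powr p)"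
      unfolding action_def pot_def by (simp add: diff_divide_distrib add_diff_eq)
    also have "\<dots> = (LINT x:einterval 0 (L e)|lborel. 1 / 2 * (g e x)\<^sup>2)
        + (LINT x:einterval 0 (L e)|lborel. s powr (p - 2) / p * (f e x)\<^sup>2)
        - (LINT x:einterval 0 (L e)|lborel. 1 / p * \<bar>f e x\<bar> powr p)"
      unfolding set_integral_diff(2)[OF set_integral_add(1)[OF i] ip] set_integral_add(2)[OF i] ..
    finally show ?thesis by (simp only: set_integral_mult_right)
  qed
  then have "(\<Sum>e<k + 2. action p (L e) s (f e) (g e)) = (\<Sum>e<k + 2. 1 / 2 * (LINT x:einterval 0 (L e)|lborel. (g e x)\<^sup>2)
      + s powr (p - 2) / p * (LINT x:einterval 0 (L e)|lborel. (f e x)\<^sup>2)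
      - 1 / p * (LINT x:einterval 0 (L e)|lborel. \<bar>f e x\<bar> powr p))"
    by (intro sum.cong) auto
  then show ?thesis
    by (simp only: sum_subtractf sum.distrib sum_distrib_left[symmetric] total)
qed

context
  fixes p :: real and \<Phi> :: "real \<Rightarrow> real"
  assumes p: "2 < p"
    and \<Phi>: "\<And>z. (\<Phi> has_real_derivative cal p z) (at z)" "\<Phi> 0 = 0"
      "\<And>z. \<Phi> (- z) = - \<Phi> z" "mono \<Phi>"
begin

text \<open>A half-line costs at least \<open>T\<close>, the descent from |\<tau>| to 0, and the
  edge with the maximum supplies what is missing to twice \<Psi>(s), so that \<open>T\<close>
  cancels in both cases. If this edge is a loop, it cannot be counted as an extra loop as well,
  hence \<open>k - 1\<close>. For \<tau> = 0 this edge alone costs strictly more than twice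
  \<Psi>(s).\<close>

lemma action_sum_ge:
  assumes c: "\<And>e. 2 \<le> e \<Longrightarrow> e < k + 2 \<Longrightarrow> c \<le> action p (L e) s (f e) (g e)" and "0 \<le> c" "0 < k"
  shows "2 * Psi p \<Phi> s s + (real k - 1) * c \<le> (\<Sum>e<k + 2. action p (L e) s (f e) (g e))"
    and "\<tau> = 0 \<Longrightarrow> 2 * Psi p \<Phi> s s < (\<Sum>e<k + 2. action p (L e) s (f e) (g e))"
proof -
  let ?A = "\<lambda>e. action p (L e) s (f e) (g e)"
  have nn: "0 \<le> ?A e" if "e < k + 2" for e
    by (rule action_nonneg[OF p \<Phi> edge[OF that] bd[OF that] s])
  have sum: "(\<Sum>e<k + 2. ?A e) = ?A 0 + ?A 1 + (\<Sum>e\<in>{2..<k + 2}. ?A e)"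
  proof -
    have "{..<k + 2} = {0, 1} \<union> {2..<k + 2}" by auto
    then show ?thesis by (simp add: sum.union_disjoint)
  qed
  define T where "T = Psi p \<Phi> s \<bar>\<tau>\<bar>"
  have half: "T \<le> ?A e" if "e < 2" for e
    unfolding T_def using half_line_action_ge[OF p \<Phi> edge bd s, of e] start[of e] that by (simp add: L)
  show "2 * Psi p \<Phi> s s + (real k - 1) * c \<le> (\<Sum>e<k + 2. ?A e)"
  proof (cases "e0 < 2")
    case True
    have "2 * Psi p \<Phi> s s - T \<le> ?A e0"
      unfolding T_def using half_line_action_max_ge[OF p \<Phi> edge[OF e0] bd[OF e0] s _ _ max] x0 True start[OF e0]
      by (simp add: L cedge_infinity)
    moreover have "T \<le> ?A (1 - e0)" by (rule half) simp
    moreover have "?A e0 + ?A (1 - e0) = ?A 0 + ?A 1" using True by (auto simp: less_2_cases_iff)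
    moreover have "(\<Sum>e\<in>{2..<k + 2}. c) \<le> (\<Sum>e\<in>{2..<k + 2}. ?A e)" by (intro sum_mono c) auto
    then have "(real k - 1) * c \<le> (\<Sum>e\<in>{2..<k + 2}. ?A e)" using \<open>0 \<le> c\<close> by (simp add: algebra_simps)
    ultimately show ?thesis unfolding sum by linarith
  next
    case False
    have le: "2 * (Psi p \<Phi> s s - T) \<le> ?A e0"
      unfolding T_def using loop_action_ge[OF p \<Phi> edge[OF e0] bd[OF e0] s _ _ _ max, of l] x0 False start[OF e0] finish[OF _ e0]
      by (simp add: L cedge_ereal)
    have ge: "(\<Sum>e\<in>{2..<k + 2} - {e0}. c) \<le> (\<Sum>e\<in>{2..<k + 2} - {e0}. ?A e)" by (intro sum_mono c) auto
    have const: "(\<Sum>e\<in>{2..<k + 2} - {e0}. c) = (real k - 1) * c"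
      using e0 False \<open>0 < k\<close> by (simp add: card_Diff_singleton of_nat_diff)
    have rest: "(real k - 1) * c \<le> (\<Sum>e\<in>{2..<k + 2} - {e0}. ?A e)" using ge unfolding const .
    have split: "(\<Sum>e\<in>{2..<k + 2}. ?A e) = ?A e0 + (\<Sum>e\<in>{2..<k + 2} - {e0}. ?A e)"
      using e0 False by (intro sum.remove) auto
    have "2 * P + d \<le> a0 + a1 + (a + b)"
      if "2 * (P - T) \<le> a" "T \<le> a0" "T \<le> a1" "d \<le> b" for P a a0 a1 b d :: real
      using that unfolding right_diff_distrib by linarith
    from this[OF le half half rest] show ?thesis unfolding sum split by simp
  qed
  assume "\<tau> = 0"
  have "2 * Psi p \<Phi> s s < ?A e0"
  proof (cases "e0 < 2")
    case True
    then show ?thesis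
      using half_line_action_greater[OF p \<Phi> edge[OF e0] bd[OF e0] s _ _ max] x0 start[OF e0] \<open>\<tau> = 0\<close>
      by (simp add: L cedge_infinity)
  next
    case False
    then show ?thesis
      using loop_action_greater[OF p \<Phi> edge[OF e0] bd[OF e0] s _ _ _ max, of l] x0 start[OF e0] finish[OF _ e0] \<open>\<tau> = 0\<close>
      by (simp add: L cedge_ereal)
  qed
  also have "?A e0 \<le> (\<Sum>e<k + 2. ?A e)" by (rule member_le_sum) (use e0 nn in auto)
  finally show "2 * Psi p \<Phi> s s < (\<Sum>e<k + 2. ?A e)" .
qed

end

end

end

section \<open>Comparison of heights and choice of the constants\<close>

lemma reduced_energy_ge:
  fixes p s M :: real
  assumes p: "2 < p" "p < 6" and "0 < s" and M: "0 \<le> M"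
  shows "(p - 6) / (p + 2) * M / p \<le> 2 / p * ((p - 2) / (p + 2)) * M * s powr (p / 2 + 1) - s powr (p - 2) / p * M"
proof -
  \<comment> \<open>In terms of \<open>y\<close> the right-hand side of the claim is
    \<open>M / p * (y powr r / r - y)\<close>. For \<open>r > 1\<close>, that is
    \<open>p < 6\<close>, it is minimal at \<open>y = 1\<close>, which is Young's inequality with
    second factor 1.\<close>
  define r where "r = (p + 2) / (2 * (p - 2))"
  define y where "y = s powr (p - 2)"
  have r: "1 < r" "1 / r = 2 * (p - 2) / (p + 2)" using p by (auto simp: r_def field_simps)
  have "(p - 2) * r = p / 2 + 1" using p by (simp add: r_def field_simps)
  then have yr: "y powr r = s powr (p / 2 + 1)" unfolding y_def powr_powr by simp
  have "(y powr r) powr (1 / r) * 1 powr (1 - 1 / r) \<le> 1 / r * y powr r + (1 - 1 / r) * 1"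
    using r(1) \<open>0 < s\<close> by (intro Youngs_inequality_0) (auto simp: y_def)
  moreover have "(y powr r) powr (1 / r) = y" using r(1) \<open>0 < s\<close> by (simp add: powr_powr y_def)
  ultimately have "1 / r - 1 \<le> 1 / r * y powr r - y" by simp
  then have "M / p * (1 / r - 1) \<le> M / p * (1 / r * y powr r - y)" using p M by (intro mult_left_mono) auto
  moreover have "M / p * (1 / r - 1) = (p - 6) / (p + 2) * M / p"
  proof -
    have "1 / r - 1 = (p - 6) / (p + 2)" unfolding r(2) using p by (simp add: field_simps)
    then show ?thesis by (simp add: mult.commute)
  qed
  moreover have "M / p * (1 / r * y powr r - y) = 2 / p * ((p - 2) / (p + 2)) * M * y powr r - y / p * M"
  proof -
    have "M / p * (2 * a / b * Y - y) = 2 / p * (a / b) * M * Y - y / p * M" for a b Y :: real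
      by (simp add: right_diff_distrib mult_ac)
    then show ?thesis unfolding r(2) .
  qed
  ultimately show ?thesis unfolding yr[symmetric] y_def[symmetric] by linarith
qed

text \<open>At height \<open>s\<close> the negative terms of the energy amount to at most the
  displayed sum, which tends to 0 with \<open>s\<close>. For \<theta> equal to minus the energy of
  the soliton, low functions are thereby excluded.\<close>

lemma small_height_exists:
  fixes p q M \<theta> :: real
  assumes "2 < p" "2 < q" "0 < \<theta>"
  obtains s1 where "0 < s1" "M / p * s1 powr (p - 2) + s1 powr q / q < \<theta>"
proof -
  have "((\<lambda>s. M / p * s powr (p - 2) + s powr q / q) \<longlongrightarrow> M / p * 0 powr (p - 2) + 0 powr q / q) (at_right 0)"
    using assms eventually_at_right_less[of 0]
    by (intro tendsto_intros tendsto_powr') (auto elim: eventually_mono)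
  then have "((\<lambda>s. M / p * s powr (p - 2) + s powr q / q) \<longlongrightarrow> 0) (at_right 0)" using assms by simp
  then have "eventually (\<lambda>s. M / p * s powr (p - 2) + s powr q / q < \<theta>) (at_right 0)"
    using assms by (intro order_tendstoD)
  then have "eventually (\<lambda>s. 0 < s \<and> M / p * s powr (p - 2) + s powr q / q < \<theta>) (at_right 0)"
    using eventually_at_right_less[of 0] by eventually_elim auto
  from eventually_happens'[OF _ this] show ?thesis using that by auto
qed

text \<open>Division by \<open>s ^ 4\<close> leaves the negative exponents \<open>p - 6\<close> and
  \<open>q - 4\<close>. The expression is half the bound of \<open>kinetic_ge\<close> minus the
  bounds for the two other terms of the energy, hence a lower bound for it.\<close>

lemma large_height_exists:
  fixes p q M :: real
  assumes "p < 6" "0 < q" "q < 4" "0 < M"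
  obtains S where "0 < S" "\<And>s. S \<le> s \<Longrightarrow> 0 < s ^ 4 / (8 * M) - M / p * s powr (p - 2) - s powr q / q"
proof -
  have "((\<lambda>s. 1 / (8 * M) - M / p * s powr (p - 6) - s powr (q - 4) / q) \<longlongrightarrow> 1 / (8 * M) - M / p * 0 - 0 / q) at_top"
    using assms by (intro tendsto_intros tendsto_neg_powr filterlim_ident) auto
  then have "eventually (\<lambda>s. 0 < 1 / (8 * M) - M / p * s powr (p - 6) - s powr (q - 4) / q) at_top"
    using assms by (intro order_tendstoD(1)[of _ "1 / (8 * M) - M / p * 0 - 0 / q"]) auto
  then obtain S where S: "\<And>s. S \<le> s \<Longrightarrow> 0 < 1 / (8 * M) - M / p * s powr (p - 6) - s powr (q - 4) / q"
    by (auto simp: eventually_at_top_linorder)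
  show ?thesis
  proof (rule that)
    show "0 < max S 1" by simp
    fix s assume s: "max S 1 \<le> s"
    then have "0 < s" by simp
    have e: "s ^ 4 * s powr (r - 4) = s powr r" for r
    proof -
      have "s ^ 4 = s powr 4" using powr_realpow[OF \<open>0 < s\<close>, of 4] by simp
      then show ?thesis by (simp flip: powr_add)
    qed
    have "0 < s ^ 4 * (1 / (8 * M) - M / p * s powr (p - 6) - s powr (q - 4) / q)"
      using S s \<open>0 < s\<close> by (intro mult_pos_pos) auto
    also have "\<dots> = s ^ 4 / (8 * M) - M / p * (s ^ 4 * s powr (p - 2 - 4)) - (s ^ 4 * s powr (q - 4)) / q"
      by (simp add: algebra_simps)
    finally show "0 < s ^ 4 / (8 * M) - M / p * s powr (p - 2) - s powr q / q" unfolding e .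
  qed
qed

lemma H1_rose_edge:
  assumes "u \<in> H1 (rose k l)" "0 < l" "e < k + 2"
  shows "H1_edge (len (rose k l) e) (\<lambda>x. u (pt (rose k l) e x))
    (weak_deriv (open_edge (rose k l) e) (\<lambda>x. u (pt (rose k l) e x)))"
proof -
  let ?L = "len (rose k l) e" and ?f = "\<lambda>x. u (pt (rose k l) e x)"
  have e: "e \<in> edges (rose k l)" using assms by simp
  have cont: "continuous_on (cedge ?L) ?f"
    using assms(1) e unfolding H1_def continuous_on_graph_def closed_edge_def cedge_def by blast
  have cont': "continuous_on (einterval 0 ?L) ?f"
    by (rule continuous_on_subset[OF cont einterval_subset_cedge])
  have L: "0 < ?L" using assms by simp
  obtain g where g: "has_weak_deriv (einterval 0 ?L) ?f g" "set_integrable lborel (einterval 0 ?L) (\<lambda>x. (g x)\<^sup>2)"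
    using assms(1) e unfolding H1_def by auto
  have f2: "set_integrable lborel (einterval 0 ?L) (\<lambda>x. (?f x)\<^sup>2)"
    using assms(1) e unfolding H1_def by auto
  show ?thesis
    by (rule H1_edgeI[OF weak_deriv_AE_eq(1)[OF g(1) cont' L] cont f2 weak_deriv_square(1)[OF g(1) cont' L g(2)] L])
qed

lemma rose_competitor:
  assumes p: "2 < p" and l: "0 < l" and k: "0 < k"
    and f: "continuous_on UNIV f" "\<forall>x\<le>0. f x = 0" "has_weak_deriv {0<..} f g"
      "set_integrable lborel {0<..} (\<lambda>x. (f x)\<^sup>2)" "set_integrable lborel {0<..} (\<lambda>x. (g x)\<^sup>2)"
  obtains u where "u \<in> H1_mass (rose k l) (LINT x:{0<..}|lborel. (f x)\<^sup>2)"
    "energy p q (rose k l) u =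
      1 / 2 * (LINT x:{0<..}|lborel. (g x)\<^sup>2) - 1 / p * (LINT x:{0<..}|lborel. \<bar>f x\<bar> powr p)"
proof -
  let ?G = "rose k l"
  define u where "u P = (case P of Vertex v \<Rightarrow> 0 | Inner e x \<Rightarrow> if e = 0 then f x else 0)" for P :: "(nat, nat) gpoint"
  define F where "F e = (if e = 0 then f else (\<lambda>_. 0))" for e :: nat
  define D where "D e = (if e = 0 then g else (\<lambda>_. 0))" for e :: nat
  have uF: "u (pt ?G e x) = F e x" for e x
    using f(2) by (auto simp: u_def F_def pt_rose)
  have uV: "u (Vertex v) = 0" for v by (simp add: u_def)
  have L: "0 < len ?G e" for e using l by simp
  have wd: "has_weak_deriv (open_edge ?G e) (F e) (D e)" for e
  proof (cases "e = 0")
    case True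
    then show ?thesis using f(3) by (simp add: F_def D_def einterval_0_infinity)
  next
    case False
    then show ?thesis
      by (simp add: F_def D_def has_weak_deriv_def locally_integrable_def set_integrable_def set_lebesgue_integral_def)
  qed
  have D2: "set_integrable lborel (open_edge ?G e) (\<lambda>x. (D e x)\<^sup>2)" for e
    using f(5) by (cases "e = 0") (auto simp: D_def einterval_0_infinity set_integrable_def)
  have F2: "set_integrable lborel (open_edge ?G e) (\<lambda>x. (F e x)\<^sup>2)" for e
    using f(4) by (cases "e = 0") (auto simp: F_def einterval_0_infinity set_integrable_def)
  have cont: "continuous_on A (F e)" for A e
    using f(1) by (auto simp: F_def intro: continuous_on_subset)
  have "u \<in> H1 ?G"
    unfolding H1_def mem_Collect_eq continuous_on_graph_def uF power2_abs
    using wd D2 F2 cont by (auto simp del: rose_simps)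
  have sum0: "(\<Sum>e<k + 2. if e = 0 then a else 0) = (a :: real)" for a
    by (subst sum.delta) auto
  have mass: "graph_integral ?G (\<lambda>e x. \<bar>u (pt ?G e x)\<bar>\<^sup>2) = (LINT x:{0<..}|lborel. (f x)\<^sup>2)"
  proof -
    have "graph_integral ?G (\<lambda>e x. \<bar>u (pt ?G e x)\<bar>\<^sup>2) = (\<Sum>e<k + 2. if e = 0 then (LINT x:{0<..}|lborel. (f x)\<^sup>2) else 0)"
      unfolding graph_integral_def uF
      by (rule sum.cong) (auto simp: F_def einterval_0_infinity set_lebesgue_integral_def)
    then show ?thesis unfolding sum0 .
  qed
  have pw: "graph_integral ?G (\<lambda>e x. \<bar>u (pt ?G e x)\<bar> powr p) = (LINT x:{0<..}|lborel. \<bar>f x\<bar> powr p)"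
  proof -
    have "graph_integral ?G (\<lambda>e x. \<bar>u (pt ?G e x)\<bar> powr p) = (\<Sum>e<k + 2. if e = 0 then (LINT x:{0<..}|lborel. \<bar>f x\<bar> powr p) else 0)"
      unfolding graph_integral_def uF
      by (rule sum.cong) (auto simp: F_def einterval_0_infinity set_lebesgue_integral_def)
    then show ?thesis unfolding sum0 .
  qed
  have kin: "graph_integral ?G (\<lambda>e x. \<bar>weak_deriv (open_edge ?G e) (\<lambda>y. u (pt ?G e y)) x\<bar>\<^sup>2) = (LINT x:{0<..}|lborel. (g x)\<^sup>2)"
  proof -
    have "graph_integral ?G (\<lambda>e x. \<bar>weak_deriv (open_edge ?G e) (\<lambda>y. u (pt ?G e y)) x\<bar>\<^sup>2)
        = (\<Sum>e<k + 2. if e = 0 then (LINT x:{0<..}|lborel. (g x)\<^sup>2) else 0)"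
      unfolding graph_integral_def uF
    proof (rule sum.cong)
      fix e
      have "(LINT x:open_edge ?G e|lborel. (weak_deriv (open_edge ?G e) (F e) x)\<^sup>2) = (LINT x:open_edge ?G e|lborel. (D e x)\<^sup>2)"
        by (rule weak_deriv_square(2)[OF wd cont L D2])
      also have "\<dots> = (if e = 0 then (LINT x:{0<..}|lborel. (g x)\<^sup>2) else 0)"
        by (auto simp: D_def einterval_0_infinity set_lebesgue_integral_def)
      finally show "(LINT x:open_edge ?G e|lborel. \<bar>weak_deriv (open_edge ?G e) (F e) x\<bar>\<^sup>2)
          = (if e = 0 then (LINT x:{0<..}|lborel. (g x)\<^sup>2) else 0)"
        by (simp only: power2_abs)
    qed simp
    then show ?thesis unfolding sum0 .
  qed
  show ?thesis
  proof (rule that)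
    show "u \<in> H1_mass ?G (LINT x:{0<..}|lborel. (f x)\<^sup>2)"
      unfolding H1_mass_def using \<open>u \<in> H1 ?G\<close> mass by simp
    show "energy p q ?G u = 1 / 2 * (LINT x:{0<..}|lborel. (g x)\<^sup>2) - 1 / p * (LINT x:{0<..}|lborel. \<bar>f x\<bar> powr p)"
      unfolding energy_def pw kin by (simp add: uV)
  qed
qed

theorem theorem1p8:
  fixes p q :: real
  assumes "2 < p" and "p < 6" and "2 < q" and "q < 4" and "q > p / 2 + 1"
  shows "\<exists>(G :: (nat, nat) mgraph) (m :: real).
    metric_graph G \<and> noncompact G \<and> card (half_lines G) = 2 \<and>
    (\<forall>v \<in> verts G. vdegree G v \<noteq> 2) \<and>
    \<not> isometric (points G) (gdist G) (UNIV :: real set) dist \<and>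
    \<not> isometric_to_tower G \<and>
    (\<forall>P \<in> points G. \<exists>t. trail G t \<and> contains_two_half_lines G t \<and> lies_on G P t) \<and>
    m > 0 \<and> \<not> (\<exists>u. ground_state p q G m u)"
proof -
  note p = \<open>2 < p\<close>
  define M where "M = mass p"
  have M: "0 < M" unfolding M_def by (rule mass_pos[OF p])
  \<comment> \<open>Minus the energy of the soliton, positive because \<open>p < 6\<close>.\<close>
  define \<theta> where "\<theta> = - ((p - 6) / (p + 2) * M / p)"
  have \<theta>: "0 < \<theta>" unfolding \<theta>_def using assms M by (simp add: divide_simps zero_less_mult_iff mult_less_0_iff)
  obtain s1 where s1: "0 < s1" "M / p * s1 powr (p - 2) + s1 powr q / q < \<theta>"
    using small_height_exists[OF p \<open>2 < q\<close> \<theta>] .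
  obtain S where S: "0 < S" "\<And>s. S \<le> s \<Longrightarrow> 0 < s ^ 4 / (8 * M) - M / p * s powr (p - 2) - s powr q / q"
    using large_height_exists[OF \<open>p < 6\<close> _ \<open>q < 4\<close> M] \<open>2 < q\<close> by auto
  \<comment> \<open>The length for which at most half of a loop can carry values above
    \<open>s1 / 2\<close>.\<close>
  define l where "l = 8 * M / s1\<^sup>2"
  have l: "0 < l" using M s1 by (simp add: l_def)
  define c where "c = min (1 / (8 * l)) (s1 powr (p - 2) * (1 - (1/2) powr (p - 2)) / p * l / 8)"
  have c: "0 < c"
  proof -
    have "(1/2) powr (p - 2) < (1/2 :: real) powr 0" using p by (intro powr_less_mono') auto
    then have "0 < 1 - (1/2 :: real) powr (p - 2)" by simp
    then show ?thesis unfolding c_def using p l s1(1) by (simp add: zero_less_mult_iff zero_less_divide_iff)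
  qed
  \<comment> \<open>Up to height \<open>S\<close> the vertex term is at most
    \<open>S powr (q - 2) / q\<close> times \<tau>^2, and the extra loops together have to cost
    more. The \<open>+ 5\<close> below covers the loop that may carry the maximum and provides the
    five midpoints.\<close>
  obtain k0 :: nat where k0: "real k0 > S powr (q - 2) / q / c" using reals_Archimedean2 by blast
  define k where "k = k0 + 5"
  have k: "5 \<le> k" "S powr (q - 2) / q < (real k - 1) * c"
  proof -
    have "S powr (q - 2) / q < real k0 * c" using k0 c by (simp only: pos_divide_less_eq)
    also have "\<dots> \<le> (real k - 1) * c" using c by (simp add: k_def)
    finally show "S powr (q - 2) / q < (real k - 1) * c" .
  qed (simp add: k_def)
  let ?G = "rose k l"
  have no: "\<not> ground_state p q ?G M u" for u
  proof
    assume gs: "ground_state p q ?G M u"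
    \<comment> \<open>A ground state has at most the energy of each competitor, and these come
      arbitrarily close to the energy of the soliton.\<close>
    have le: "energy p q ?G u \<le> - \<theta>"
    proof (rule field_le_epsilon)
      fix \<epsilon> :: real assume "0 < \<epsilon>"
      obtain f g where fg: "continuous_on UNIV f" "\<forall>x\<le>0. f x = 0"
        "has_weak_deriv {0<..} f g" "set_integrable lborel {0<..} (\<lambda>x. (f x)\<^sup>2)" "set_integrable lborel {0<..} (\<lambda>x. (g x)\<^sup>2)"
        and m: "(LINT x:{0<..}|lborel. (f x)\<^sup>2) = mass p"
        and en: "1 / 2 * (LINT x:{0<..}|lborel. (g x)\<^sup>2) - 1 / p * (LINT x:{0<..}|lborel. \<bar>f x\<bar> powr p)
          < (p - 6) / (p + 2) * mass p / p + \<epsilon>"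
        using soliton_competitor[OF p \<open>0 < \<epsilon>\<close>] .
      from rose_competitor[OF p l _ fg, of k q] k obtain w where w: "w \<in> H1_mass ?G M"
        "energy p q ?G w = 1 / 2 * (LINT x:{0<..}|lborel. (g x)\<^sup>2) - 1 / p * (LINT x:{0<..}|lborel. \<bar>f x\<bar> powr p)"
        unfolding m M_def by auto
      have "ereal (energy p q ?G u) \<le> ereal (energy p q ?G w)"
        using gs w(1) unfolding ground_state_def by (auto intro: INF_lower)
      then show "energy p q ?G u \<le> - \<theta> + \<epsilon>" using w(2) en by (simp add: \<theta>_def M_def)
    qed
    have u: "u \<in> H1 ?G" and um: "graph_integral ?G (\<lambda>e x. \<bar>u (pt ?G e x)\<bar>\<^sup>2) = M"
      using gs unfolding ground_state_def H1_mass_def by auto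
    define f where "f e x = u (pt ?G e x)" for e x
    define g where "g e = weak_deriv (open_edge ?G e) (f e)" for e
    define L where "L e = len ?G e" for e
    define \<tau> where "\<tau> = u (Vertex 0)"
    interpret rose_fun k l M \<tau> f g L
    proof
      show "H1_edge (L e) (f e) (g e)" if "e < k + 2" for e
        using H1_rose_edge[OF u l that] by (simp only: f_def[abs_def] g_def L_def)
      show "(\<Sum>e<k + 2. LINT x:einterval 0 (L e)|lborel. (f e x)\<^sup>2) = M"
        using um unfolding graph_integral_def f_def L_def by (simp only: rose_simps(2) power2_abs)
    qed (use l M in \<open>simp_all add: L_def f_def \<tau>_def pt_rose\<close>)
    define K where "K = (\<Sum>e<k + 2. LINT x:einterval 0 (L e)|lborel. (g e x)\<^sup>2)"
    define P where "P = (\<Sum>e<k + 2. LINT x:einterval 0 (L e)|lborel. \<bar>f e x\<bar> powr p)"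
    have en: "energy p q ?G u = 1 / 2 * K - 1 / p * P - 1 / q * \<bar>\<tau>\<bar> powr q"
      unfolding energy_def graph_integral_def K_def P_def g_def f_def[abs_def] L_def \<tau>_def
      by (simp only: rose_simps(1,2) power2_abs sum.insert finite.emptyI empty_iff not_False_eq_True sum.empty add_0_right)
    have K0: "0 \<le> K" unfolding K_def by (intro sum_nonneg set_integral_nonneg) auto
    obtain e0 x0 where e0: "e0 < k + 2" "x0 \<in> cedge (L e0)" "0 < \<bar>f e0 x0\<bar>"
      "\<forall>e<k + 2. \<forall>x\<in>cedge (L e). \<bar>f e x\<bar> \<le> \<bar>f e0 x0\<bar>"
      using attains_max .
    define s where "s = \<bar>f e0 x0\<bar>"
    have s: "0 < s" "\<bar>f e0 x0\<bar> = s" "\<And>e x. e < k + 2 \<Longrightarrow> x \<in> cedge (L e) \<Longrightarrow> \<bar>f e x\<bar> \<le> s"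
      using e0 by (auto simp: s_def)
    note ctx = s(1) e0(1,2) s(2,3)
    have \<tau>s: "\<bar>\<tau>\<bar> \<le> s" by (rule abs_tau_le[OF ctx])
    have \<tau>q: "1 / q * \<bar>\<tau>\<bar> powr q \<le> s powr q / q"
      using \<tau>s \<open>2 < q\<close> by (simp add: divide_right_mono powr_mono2)
    have "P \<le> s powr (p - 2) * M" unfolding P_def by (rule powr_integral_le[OF ctx p])
    then have Ps: "1 / p * P \<le> M / p * s powr (p - 2)"
      using p by (simp add: divide_right_mono mult.commute)
    \<comment> \<open>For low functions the negative terms are too small, for high ones the kinetic
      energy wins; calibrations are used for the heights in between.\<close>
    consider "s \<le> s1" | "S \<le> s" | "s1 \<le> s" "s \<le> S" by linarith
    then have "- \<theta> < energy p q ?G u"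
    proof cases
      case 1
      have "M / p * s powr (p - 2) \<le> M / p * s1 powr (p - 2)"
        using 1 s(1) p M by (intro mult_left_mono powr_mono2) auto
      moreover have "s powr q / q \<le> s1 powr q / q"
        using 1 s(1) \<open>2 < q\<close> by (intro divide_right_mono powr_mono2) auto
      ultimately show ?thesis unfolding en using Ps \<tau>q s1(2) K0 by linarith
    next
      case 2
      have "s ^ 4 / (4 * M) \<le> K" unfolding K_def by (rule kinetic_ge[OF ctx])
      moreover have "s ^ 4 / (8 * M) = 1 / 2 * (s ^ 4 / (4 * M))" by simp
      ultimately have "s ^ 4 / (8 * M) \<le> 1 / 2 * K" by linarith
      then show ?thesis unfolding en using Ps \<tau>q S(2)[OF 2] \<theta> by linarith
    next
      case 3
      obtain \<Phi> where \<Phi>: "\<And>z. (\<Phi> has_real_derivative cal p z) (at z)" "\<Phi> 0 = 0"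
        "\<And>z. \<Phi> (- z) = - \<Phi> z" "mono \<Phi>" using cal_primitive_exists[OF p] by blast
      \<comment> \<open>Here the mass matters: it is the mass of the soliton, so the cost of
        covering all values twice is known in terms of \<open>M\<close>.\<close>
      have "2 * \<Phi> 1 = 2 / p * ((p - 2) / (p + 2)) * M"
        using dsol_square_integral_eq[OF p \<Phi>(1,2)] dsol_square_integral[OF p] by (simp add: M_def)
      moreover have "2 * Psi p \<Phi> s s = 2 * \<Phi> 1 * s powr (p / 2 + 1)"
        unfolding Psi_self[OF p \<Phi> s(1)] by simp
      ultimately have Psi: "2 * Psi p \<Phi> s s = 2 / p * ((p - 2) / (p + 2)) * M * s powr (p / 2 + 1)" by simp
      have red: "- \<theta> \<le> 2 * Psi p \<Phi> s s - s powr (p - 2) / p * M"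
        unfolding Psi \<theta>_def using reduced_energy_ge[OF p \<open>p < 6\<close> s(1), of M] M by simp
      have en': "energy p q ?G u = (\<Sum>e<k + 2. action p (L e) s (f e) (g e)) - s powr (p - 2) / p * M - 1 / q * \<bar>\<tau>\<bar> powr q"
        using action_sum[OF ctx p, folded K_def P_def] unfolding en by linarith
      show ?thesis
      \<comment> \<open>At \<tau> = 0 the vertex term and the guaranteed cost of the extra loops
        both vanish, so the strict inequality has to come from the edge with the maximum.\<close>
      proof (cases "\<tau> = 0")
        case True
        have "2 * Psi p \<Phi> s s < (\<Sum>e<k + 2. action p (L e) s (f e) (g e))"
        proof (rule action_sum_ge(2)[OF ctx p \<Phi> _ order_refl _ True])
          show "0 \<le> action p (L e) s (f e) (g e)" if "2 \<le> e" "e < k + 2" for e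
            by (rule action_nonneg[OF p \<Phi> edge[OF that(2)] s(3)[OF that(2)] s(1)])
          show "0 < k" using k by simp
        qed
        then show ?thesis unfolding en' using red True by simp
      next
        case False
        have "2 * Psi p \<Phi> s s + (real k - 1) * (c * \<tau>\<^sup>2) \<le> (\<Sum>e<k + 2. action p (L e) s (f e) (g e))"
        proof (rule action_sum_ge(1)[OF ctx p \<Phi>])
          show "c * \<tau>\<^sup>2 \<le> action p (L e) s (f e) (g e)" if e: "2 \<le> e" "e < k + 2" for e
          proof -
            have "min (1 / (8 * l)) (s1 powr (p - 2) * (1 - (1/2) powr (p - 2)) / p * l / 8) * (f e 0)\<^sup>2
                \<le> action p (L e) s (f e) (g e)"
              by (rule extra_loop_action_ge[OF p \<Phi> edge[OF e(2)] s(3)[OF e(2)] s(1) _ s1(1) 3(1) l_def M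
                    loop_mass_le[OF e]])
                 (use e start[OF e(2)] False in \<open>auto simp: L_def\<close>)
            then show ?thesis using start[OF e(2)] by (simp add: c_def)
          qed
          show "0 \<le> c * \<tau>\<^sup>2" using c by simp
          show "0 < k" using k by simp
        qed
        moreover have "1 / q * \<bar>\<tau>\<bar> powr q < (real k - 1) * (c * \<tau>\<^sup>2)"
        proof -
          \<comment> \<open>After \<tau>^2 is factored out of the vertex term, a factor bounded
            through |\<tau>| \<le> s \<le> S remains.\<close>
          have "\<bar>\<tau>\<bar> powr (q - 2) \<le> S powr (q - 2)"
            using \<tau>s 3 \<open>2 < q\<close> by (intro powr_mono2) auto
          then have "\<bar>\<tau>\<bar> powr (q - 2) / q \<le> S powr (q - 2) / q"
            using \<open>2 < q\<close> by (intro divide_right_mono) auto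
          then have "\<bar>\<tau>\<bar> powr (q - 2) / q < (real k - 1) * c" using k(2) by linarith
          then have "\<tau>\<^sup>2 * (\<bar>\<tau>\<bar> powr (q - 2) / q) < \<tau>\<^sup>2 * ((real k - 1) * c)"
            using False by (intro mult_strict_left_mono) auto
          then show ?thesis unfolding abs_powr_split[OF \<open>2 < q\<close>] by (simp add: mult_ac)
        qed
        ultimately show ?thesis unfolding en' using red by linarith
      qed
    qed
    then show False using le by simp
  qed
  show ?thesis
  proof (intro exI[of _ ?G] exI[of _ M] conjI)
    show "metric_graph ?G" by (rule metric_graph_rose[OF l])
    show "noncompact ?G" by (simp add: noncompact_def half_lines_rose)
    show "card (half_lines ?G) = 2" by (simp add: half_lines_rose)
    show "\<forall>v\<in>verts ?G. vdegree ?G v \<noteq> 2" using vdegree_rose k by auto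
    show "\<not> isometric (points ?G) (gdist ?G) (UNIV :: real set) dist" by (rule rose_not_isometric_line[OF l k(1)])
    show "\<not> isometric_to_tower ?G" by (rule rose_not_isometric_tower[OF l k(1)])
    show "\<forall>P\<in>points ?G. \<exists>t. trail ?G t \<and> contains_two_half_lines ?G t \<and> lies_on ?G P t"
      using trail_rose l by blast
    show "M > 0" by (rule M)
    show "\<not> (\<exists>u. ground_state p q ?G M u)" using no by blast
  qed
qed

end
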